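(* Consider a triangular array (indexed by $T$) of stationary Gaussian VARs as in the context. Let $p\in O(e^{T^a})$, $k\in O(T^b)$ and $\bar s\in O(T^c)$ for some $a,b,c\ge0$ with $3a+2b+2c<1$. Assume that there is a constant $d>0$ such that $\kappa_i\ge d$ for all $i=1,\dots,k$ and all $T$, and that $\sup_T\sigma_T<\infty$ and $\sup_T\|\Gamma\|\sum_{j=0}^T\|F^j\|<\infty$. Let $\lambda_T=\sqrt{8\ln(1+T)^5\ln(1+k)^4\ln(1+p)^2\ln(k^2p)\,\sigma_T^4/T}$ and, for $i=1,\dots,k$, let $\hat\beta_i$ be a minimizer over $\beta\in\mathbb{R}^{kp}$ of $\frac1T\|y_i-X\beta\|^2+2\lambda_T\|\beta\|_{\ell_1}$. Then, as $T\to\infty$, $$\sum_{i=1}^k\|\hat\beta_i-\beta_i^*\|_{\ell_1}\to0\quad\text{in probability.}$$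
   Context: Setting (VAR model). $T\ge1$ is the sample size; $k=k_T\ge1$ and $p=p_T\ge1$ are integers that may depend on $T$. For each $T$, the $\mathbb{R}^k$-valued data $y_t=(y_{t,1},\dots,y_{t,k})'$, $t=1-p,\dots,T$, satisfy $y_t=\sum_{l=1}^p\Phi_l y_{t-l}+\epsilon_t$ for $t=1,\dots,T$, where $\Phi_1,\dots,\Phi_p$ are $k\times k$ matrices (possibly depending on $T$ but not on $t$), $\epsilon_t$ are i.i.d. $N_k(0,\Sigma)$, all roots of $\det(I_k-\sum_{j=1}^p\Phi_jz^j)$ lie outside the unit disc, and $(y_t)$ is the stationary causal solution (so $y_t$ is centered Gaussian and $\epsilon_t$ is independent of $y_s$, $s<t$). All parameters and dimensions may vary with $T$. $\sigma_{i,y}^2$ is the variance of $y_{t,i}$, $\sigma_{i,\epsilon}^2$ the variance of $\epsilon_{t,i}$, and $\sigma_T=\max_{1\le i\le k}(\sigma_{i,y}\vee\sigma_{i,\epsilon})$. $F$ is the $kp\times kp$ companion matrix of the VAR. Stacked form: $Z_t=(y_{t-1}',\dots,y_{t-p}')'\in\mathbb{R}^{kp}$, $X=(Z_T,\dots,Z_1)'$ ($T\times kp$), $y_i=(y_{T,i},\dots,y_{1,i})'$, $\epsilon_i=(\epsilon_{T,i},\dots,\epsilon_{1,i})'$, so $y_i=X\beta_i^*+\epsilon_i$, where $\beta_i^*\in\mathbb{R}^{kp}$ is the true parameter vector of equation $i$. $J_i=\{j:\beta^*_{i,j}\neq0\}$, $s_i=|J_i|\ge1$, $\bar s=\max\{s_1,\dots,s_k\}$.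 $\|\cdot\|$ is the Euclidean norm of a vector or the spectral norm of a matrix; $\|\cdot\|_{\ell_1}$ is the $\ell_1$ norm; $\delta_R$ is the subvector of $\delta$ indexed by $R$. $\Gamma=E(Z_tZ_t')$ and $\kappa_i=\kappa_\Gamma(s_i)$, where for $1\le r\le kp$ $$\kappa_\Gamma^2(r)=\min_{R\subseteq\{1,\dots,kp\},\,|R|\le r}\ \min_{\delta\in\mathbb{R}^{kp}\setminus\{0\},\ \|\delta_{R^c}\|_{\ell_1}\le3\|\delta_R\|_{\ell_1}}\frac{\delta'\Gamma\delta}{\|\delta_R\|^2}.$$ *)

theory Defs
  imports
    "HOL-Probability.Probability"
    "HOL-Library.Landau_Symbols"
    "Jordan_Normal_Form.Determinant"
begin

no_notation inner (infix \<open>\<bullet>\<close> 70)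
no_notation vec_nth (infixl \<open>$\<close> 90)
hide_const (open) Finite_Cartesian_Product.vec Determinants.det Finite_Cartesian_Product.mat
  Finite_Cartesian_Product.transpose

text \<open>
  Dimensions vary with the sample size, so matrices and deterministic vectors are those of
  \<open>Jordan_Normal_Form\<close>, and coordinates are numbered from 0.  A (multivariate) process
  is a function \<open>y\<close> with \<open>y t i \<omega>\<close> the \<open>i\<close>-th coordinate at time \<open>t\<close>.
\<close>

definition l2_norm_vec :: "real vec \<Rightarrow> real" where
  "l2_norm_vec v = L2_set (\<lambda>j. v $ j) {..<dim_vec v}"

definition l1_norm_vec :: "real vec \<Rightarrow> real" where
  "l1_norm_vec v = (\<Sum>j<dim_vec v. \<bar>v $ j\<bar>)"

definition spectral_norm :: "real mat \<Rightarrow> real" where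
  "spectral_norm A = (SUP v \<in> {v \<in> carrier_vec (dim_col A). l2_norm_vec v \<le> 1}. l2_norm_vec (A *\<^sub>v v))"

text \<open>The case \<open>v = 0\<close> is the degenerate normal law, i.e. the point mass at 0.\<close>

definition centered_normal :: "real \<Rightarrow> real measure" where
  "centered_normal v =
     (if v = 0 then return borel 0 else density lborel (\<lambda>x. ennreal (normal_density 0 (sqrt v) x)))"

text \<open>
  \<open>X\<close> has law \<open>N\<^sub>n(0, S)\<close>, with \<open>S\<close> possibly singular: every linear combination
  \<open>u'X\<close> has law \<open>N(0, u'Su)\<close>.
\<close>

definition multivariate_normal ::
  "'a measure \<Rightarrow> nat \<Rightarrow> real mat \<Rightarrow> (nat \<Rightarrow> 'a \<Rightarrow> real) \<Rightarrow> bool" where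
  "multivariate_normal M n S X \<longleftrightarrow>
     S \<in> carrier_mat n n \<and> transpose_mat S = S \<and>
     (\<forall>u\<in>carrier_vec n. u \<bullet> (S *\<^sub>v u) \<ge> 0) \<and>
     (\<forall>i<n. X i \<in> borel_measurable M) \<and>
     (\<forall>u\<in>carrier_vec n. distr M borel (\<lambda>\<omega>. \<Sum>i<n. u $ i * X i \<omega>) = centered_normal (u \<bullet> (S *\<^sub>v u)))"

text \<open>Strict stationarity: the law of the whole process is invariant under time shifts.\<close>

definition stationary_process ::
  "'a measure \<Rightarrow> nat \<Rightarrow> (int \<Rightarrow> nat \<Rightarrow> 'a \<Rightarrow> real) \<Rightarrow> bool" where
  "stationary_process M k y \<longleftrightarrow>
     (\<forall>h. distr M (Pi\<^sub>M (UNIV \<times> {..<k}) (\<lambda>_. borel))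
            (\<lambda>\<omega>. \<lambda>(t, i)\<in>UNIV \<times> {..<k}. y (t + h) i \<omega>) =
          distr M (Pi\<^sub>M (UNIV \<times> {..<k}) (\<lambda>_. borel))
            (\<lambda>\<omega>. \<lambda>(t, i)\<in>UNIV \<times> {..<k}. y t i \<omega>))"

text \<open>Causality: \<open>y\<^sub>t = \<Sum>\<^sub>j \<Psi>\<^sub>j \<epsilon>\<^sub>t\<^sub>-\<^sub>j\<close> almost surely, with absolutely summable \<open>\<Psi>\<close>.\<close>

definition causal_process ::
  "'a measure \<Rightarrow> nat \<Rightarrow> (int \<Rightarrow> nat \<Rightarrow> 'a \<Rightarrow> real) \<Rightarrow> (int \<Rightarrow> nat \<Rightarrow> 'a \<Rightarrow> real) \<Rightarrow> bool" where
  "causal_process M k \<epsilon> y \<longleftrightarrow>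
     (\<exists>\<Psi> :: nat \<Rightarrow> real mat.
        (\<forall>j. \<Psi> j \<in> carrier_mat k k) \<and>
        (\<forall>i<k. \<forall>m<k. summable (\<lambda>j. \<bar>\<Psi> j $$ (i, m)\<bar>)) \<and>
        (\<forall>t. \<forall>i<k. AE \<omega> in M. (\<lambda>j. \<Sum>m<k. \<Psi> j $$ (i, m) * \<epsilon> (t - int j) m \<omega>) sums y t i \<omega>))"

definition var_polynomial :: "nat \<Rightarrow> nat \<Rightarrow> (nat \<Rightarrow> real mat) \<Rightarrow> complex \<Rightarrow> complex mat" where
  "var_polynomial k p \<Phi> z =
     mat k k (\<lambda>(i, m). of_bool (i = m) - (\<Sum>l=1..p. complex_of_real (\<Phi> l $$ (i, m)) * z ^ l))"

text \<open>
  Stationary causal Gaussian VAR(\<open>p\<close>).  Causality refers to the whole past of the noise,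
  so both processes are indexed by all of \<open>\<int>\<close>; the data are \<open>y\<^sub>t\<close> for \<open>1 - p \<le> t \<le> T\<close>.
\<close>

locale gaussian_var = prob_space M
  for M :: "'a measure" +
  fixes k p :: nat
    and \<Phi> :: "nat \<Rightarrow> real mat"
    and S :: "real mat"
    and \<epsilon> y :: "int \<Rightarrow> nat \<Rightarrow> 'a \<Rightarrow> real"
  assumes k_pos: "k \<ge> 1"
    and p_pos: "p \<ge> 1"
    and coeff_carrier: "l \<in> {1..p} \<Longrightarrow> \<Phi> l \<in> carrier_mat k k"
    and roots_outside: "det (var_polynomial k p \<Phi> z) = 0 \<Longrightarrow> cmod z > 1"
    and noise_normal: "multivariate_normal M k S (\<epsilon> t)"
    and noise_indep:
      "indep_vars (\<lambda>_. Pi\<^sub>M {..<k} (\<lambda>_. borel)) (\<lambda>t \<omega>. \<lambda>i\<in>{..<k}. \<epsilon> t i \<omega>) UNIV"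
    and y_measurable: "i < k \<Longrightarrow> y t i \<in> borel_measurable M"
    and var_equation: "i < k \<Longrightarrow>
      AE \<omega> in M. y t i \<omega> = (\<Sum>l=1..p. \<Sum>m<k. \<Phi> l $$ (i, m) * y (t - int l) m \<omega>) + \<epsilon> t i \<omega>"
    and stationary: "stationary_process M k y"
    and causal: "causal_process M k \<epsilon> y"

definition companion_mat :: "nat \<Rightarrow> nat \<Rightarrow> (nat \<Rightarrow> real mat) \<Rightarrow> real mat" where
  "companion_mat k p \<Phi> = mat (k * p) (k * p)
     (\<lambda>(r, c). if r < k then \<Phi> (c div k + 1) $$ (r, c mod k) else of_bool (r = c + k))"

text \<open>
  \<open>lagged k p y t \<omega>\<close> is \<open>Z\<^sub>t = (y\<^sub>t\<^sub>-\<^sub>1', \<dots>, y\<^sub>t\<^sub>-\<^sub>p')'\<close>: its entry \<open>m\<close> belongs to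
  lag \<open>m div k + 1\<close> and coordinate \<open>m mod k\<close>.
\<close>

definition lagged :: "nat \<Rightarrow> nat \<Rightarrow> (int \<Rightarrow> nat \<Rightarrow> 'a \<Rightarrow> real) \<Rightarrow> int \<Rightarrow> 'a \<Rightarrow> real vec" where
  "lagged k p y t \<omega> = vec (k * p) (\<lambda>m. y (t - int (m div k + 1)) (m mod k) \<omega>)"

definition true_param :: "nat \<Rightarrow> nat \<Rightarrow> (nat \<Rightarrow> real mat) \<Rightarrow> nat \<Rightarrow> real vec" where
  "true_param k p \<Phi> i = vec (k * p) (\<lambda>m. \<Phi> (m div k + 1) $$ (i, m mod k))"

text \<open>Rows are in reverse time order: row 0 belongs to time \<open>T\<close>, row \<open>T - 1\<close> to time 1.\<close>

definition design_mat ::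
  "nat \<Rightarrow> nat \<Rightarrow> nat \<Rightarrow> (int \<Rightarrow> nat \<Rightarrow> 'a \<Rightarrow> real) \<Rightarrow> 'a \<Rightarrow> real mat" where
  "design_mat T k p y \<omega> = mat T (k * p) (\<lambda>(r, m). lagged k p y (int T - int r) \<omega> $ m)"

definition response_vec :: "nat \<Rightarrow> (int \<Rightarrow> nat \<Rightarrow> 'a \<Rightarrow> real) \<Rightarrow> nat \<Rightarrow> 'a \<Rightarrow> real vec" where
  "response_vec T y i \<omega> = vec T (\<lambda>r. y (int T - int r) i \<omega>)"

definition active_set :: "nat \<Rightarrow> nat \<Rightarrow> (nat \<Rightarrow> real mat) \<Rightarrow> nat \<Rightarrow> nat set" where
  "active_set k p \<Phi> i = {j. j < k * p \<and> true_param k p \<Phi> i $ j \<noteq> 0}"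

definition sparsity :: "nat \<Rightarrow> nat \<Rightarrow> (nat \<Rightarrow> real mat) \<Rightarrow> nat \<Rightarrow> nat" where
  "sparsity k p \<Phi> i = card (active_set k p \<Phi> i)"

definition max_sparsity :: "nat \<Rightarrow> nat \<Rightarrow> (nat \<Rightarrow> real mat) \<Rightarrow> nat" where
  "max_sparsity k p \<Phi> = Max (sparsity k p \<Phi> ` {..<k})"

text \<open>
  \<open>\<Gamma> = E(Z\<^sub>t Z\<^sub>t')\<close> and the variances of \<open>y\<^sub>t\<close> and \<open>\<epsilon>\<^sub>t\<close> do not depend on \<open>t\<close>; they are taken at \<open>t = 1\<close>.
\<close>

definition lag_cov :: "'a measure \<Rightarrow> nat \<Rightarrow> nat \<Rightarrow> (int \<Rightarrow> nat \<Rightarrow> 'a \<Rightarrow> real) \<Rightarrow> real mat" where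
  "lag_cov M k p y = mat (k * p) (k * p)
     (\<lambda>(a, b). \<integral>\<omega>. lagged k p y 1 \<omega> $ a * lagged k p y 1 \<omega> $ b \<partial>M)"

definition max_sd ::
  "'a measure \<Rightarrow> nat \<Rightarrow> (int \<Rightarrow> nat \<Rightarrow> 'a \<Rightarrow> real) \<Rightarrow> (int \<Rightarrow> nat \<Rightarrow> 'a \<Rightarrow> real) \<Rightarrow> real" where
  "max_sd M k \<epsilon> y = Max ((\<lambda>i. max (sqrt (prob_space.variance M (y 1 i)))
                                   (sqrt (prob_space.variance M (\<epsilon> 1 i)))) ` {..<k})"

text \<open>
  \<open>\<kappa>\<^sub>G(r)\<close> for an \<open>n \<times> n\<close> matrix \<open>G\<close>.  Both minima are merged into one infimum over pairs
  \<open>(R, \<delta>)\<close>, because for \<open>R = {}\<close> no \<open>\<delta>\<close> is admissible (and \<open>Inf {}\<close> is unspecified in the reals).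
  An admissible \<open>\<delta>\<close> has \<open>\<delta>\<^sub>R \<noteq> 0\<close>, so there is no division by zero.
\<close>

definition restricted_eigenvalue :: "real mat \<Rightarrow> nat \<Rightarrow> real" where
  "restricted_eigenvalue G r = (let n = dim_row G in
     sqrt (Inf {\<delta> \<bullet> (G *\<^sub>v \<delta>) / (L2_set (\<lambda>j. \<delta> $ j) R)\<^sup>2 | R \<delta>.
       R \<subseteq> {..<n} \<and> card R \<le> r \<and> \<delta> \<in> carrier_vec n \<and> \<delta> \<noteq> 0\<^sub>v n \<and>
       (\<Sum>j\<in>{..<n} - R. \<bar>\<delta> $ j\<bar>) \<le> 3 * (\<Sum>j\<in>R. \<bar>\<delta> $ j\<bar>)}))"

definition penalty :: "nat \<Rightarrow> nat \<Rightarrow> nat \<Rightarrow> real \<Rightarrow> real" where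
  "penalty T k p \<sigma> =
     sqrt (8 * ln (1 + real T) ^ 5 * ln (1 + real k) ^ 4 * ln (1 + real p) ^ 2
             * ln (real k ^ 2 * real p) * \<sigma> ^ 4 / real T)"

definition lasso_objective :: "real mat \<Rightarrow> real vec \<Rightarrow> real \<Rightarrow> real vec \<Rightarrow> real" where
  "lasso_objective X v l \<beta> =
     1 / real (dim_vec v) * (l2_norm_vec (v - X *\<^sub>v \<beta>))\<^sup>2 + 2 * l * l1_norm_vec \<beta>"

definition lasso_minimizer :: "real mat \<Rightarrow> real vec \<Rightarrow> real \<Rightarrow> real vec \<Rightarrow> bool" where
  "lasso_minimizer X v l b \<longleftrightarrow> b \<in> carrier_vec (dim_col X) \<and>
     (\<forall>\<beta>\<in>carrier_vec (dim_col X). lasso_objective X v l b \<le> lasso_objective X v l \<beta>)"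

text \<open>
  Convergence in probability to a constant along a triangular array: the probability space may
  change with the index.  The measurability requirement excludes that the limit holds only
  because \<open>measure\<close> is 0 on non-measurable sets.
\<close>

definition tendsto_in_prob :: "(nat \<Rightarrow> 'a measure) \<Rightarrow> (nat \<Rightarrow> 'a \<Rightarrow> real) \<Rightarrow> real \<Rightarrow> bool" where
  "tendsto_in_prob M X c \<longleftrightarrow>
     (\<forall>\<^sub>F T in sequentially. X T \<in> borel_measurable (M T)) \<and>
     (\<forall>e>0. (\<lambda>T. measure (M T) {\<omega> \<in> space (M T). \<bar>X T \<omega> - c\<bar> > e}) \<longlonglongrightarrow> 0)"

end

theory Submission
  imports Defs "HOL-Real_Asymp.Real_Asymp"
begin

text \<open>
  Fix the sample size and let the noise level \<open>\<mu>\<close> bound every entry of \<open>X'\<epsilon>\<^sub>i / T\<close>, let the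
  Gram matrix \<open>X'X / T\<close> be entrywise within \<open>q\<close> of \<open>\<Gamma>\<close>, and let \<open>l\<close> be the penalty.  The usual lasso
  argument then bounds the \<open>\<ell>\<^sub>1\<close> error of every equation by a multiple of \<open>(\<mu> + l) s / d\<^sup>2\<close>, as soon as
  \<open>2 \<mu> \<le> l\<close> and \<open>32 q s \<le> d\<^sup>2\<close>: the error lies in the cone on which the restricted eigenvalue of \<open>\<Gamma>\<close>
  is available, and on that cone the Gram matrix inherits half of it (\<open>lasso_l1_error\<close>).
  Summed over the \<open>k\<close> equations this is of order \<open>k s l\<close>, which vanishes because \<open>l\<^sup>2\<close> is at most of
  order \<open>T\<^bsup>3a - 1\<^esup>\<close> up to powers of \<open>ln T\<close> (\<open>penalty_rate\<close>).
  
  It remains to show that the two conditions hold with probability tending to 1.  Both concern sums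
  \<open>\<Sum>\<^sub>t X\<^sub>t Y\<^sub>t\<close> of products of jointly Gaussian sequences: the Gram entries with \<open>X, Y\<close> two coordinates
  of \<open>Z\<^sub>t\<close>, and the noise entries with \<open>X\<close> a coordinate of \<open>\<epsilon>\<^sub>t\<close> and \<open>Y\<close> one of \<open>Z\<^sub>t\<close>.  One inequality
  serves both (\<open>gaussian_sum_products_concentration\<close>): such a sum of length \<open>n\<close> deviates from its mean
  by \<open>n x\<close> with probability at most \<open>4 exp (- n x\<^sup>2 / (64 L\<^sup>2))\<close> for \<open>0 < x \<le> L\<close>, where \<open>L\<close> bounds the
  absolute row sums of the covariance matrices.  Reading the noise terms as Gaussian quadratic forms
  replaces a martingale argument.
  
  The row sums are bounded uniformly in \<open>T\<close> because covariances propagate through the companion matrix,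
  \<open>E Z\<^sub>t\<^sub>+\<^sub>j Z\<^sub>t' = F\<^sup>j \<Gamma>\<close> (\<open>cov_Z_power\<close>), and \<open>\<parallel>\<Gamma>\<parallel> \<Sum> \<parallel>F\<^sup>j\<parallel>\<close> is bounded.  Joint Gaussianity comes from
  causality: all variables are almost sure limits of finite linear combinations of the noise, and such
  limits are Gaussian with convergent second moments (\<open>gaussian_rv_AE_limit\<close>).
  
  Both deviation probabilities survive the union bound.  There are \<open>(k p)\<^sup>2\<close> Gram entries, with
  \<open>ln p\<close> at most of order \<open>T\<^sup>a\<close>, against an exponent \<open>T q\<^sup>2\<close> of order at least \<open>T\<^bsup>1 - 2c\<^esup>\<close>; and \<open>k\<^sup>2 p\<close>
  noise entries, against an exponent \<open>T l\<^sup>2\<close> that eventually exceeds every multiple of \<open>ln (k\<^sup>2 p)\<close>.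
  The case \<open>k = p = 1\<close> is special: there \<open>ln (k\<^sup>2 p) = 0\<close>, so the penalty vanishes and the estimator is
  least squares.  The single coefficient is then active, the cone condition is void, and
  \<open>\<mu> = T\<^bsup>-1/4\<^esup>\<close> works.
\<close>

section \<open>The l1 error of the lasso on a good event\<close>

lemma sum_squared_le_card_mult:
  fixes f :: "'i \<Rightarrow> real"
  assumes "finite J" "card J \<le> s"
  shows "(\<Sum>j\<in>J. \<bar>f j\<bar>)\<^sup>2 \<le> real s * (\<Sum>j\<in>J. (f j)\<^sup>2)"
proof -
  have "(\<Sum>j\<in>J. \<bar>f j\<bar>)\<^sup>2 \<le> (\<Sum>j\<in>J. \<bar>f j\<bar>\<^sup>2) * real (card J)"
    by (rule sum_squared_le_sum_of_squares)
  also have "\<dots> \<le> (\<Sum>j\<in>J. \<bar>f j\<bar>\<^sup>2) * real s"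
    using assms by (intro mult_left_mono sum_nonneg) auto
  finally show ?thesis by (simp add: mult.commute)
qed

text \<open>
  Comparing the minimizer with \<open>b0\<close> gives \<open>\<parallel>X \<delta>\<parallel>\<^sup>2 / N \<le> 2 \<mu> \<parallel>\<delta>\<parallel>\<^sub>1 + 2 l (\<parallel>\<delta>\<^sub>J\<parallel>\<^sub>1 - \<parallel>\<delta>\<^bsub>-J\<^esub>\<parallel>\<^sub>1)\<close> for \<open>\<delta> = b - b0\<close>.
  Nonnegativity of the left side confines \<open>\<delta>\<close> to the cone when \<open>2 \<mu> \<le> l\<close>; when \<open>J\<close> contains every
  index the cone is everything, which also covers least squares, \<open>l = 0\<close>.  On the cone
  \<open>\<parallel>\<delta>\<parallel>\<^sub>1\<^sup>2 \<le> 16 s \<parallel>\<delta>\<^sub>J\<parallel>\<^sup>2\<close>, so replacing \<open>G\<close> by the Gram matrix costs at most \<open>16 q s \<parallel>\<delta>\<^sub>J\<parallel>\<^sup>2\<close>, half of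
  what the restricted eigenvalue provides.
\<close>

lemma lasso_l1_error:
  fixes x :: "nat \<Rightarrow> nat \<Rightarrow> real" and e b b0 :: "nat \<Rightarrow> real" and G :: "nat \<Rightarrow> nat \<Rightarrow> real"
  assumes N: "N > 0"
    and minimal: "(\<Sum>r<N. (e r - (\<Sum>j<n. x r j * (b j - b0 j)))\<^sup>2) / N + 2 * l * (\<Sum>j<n. \<bar>b j\<bar>)
       \<le> (\<Sum>r<N. (e r)\<^sup>2) / N + 2 * l * (\<Sum>j<n. \<bar>b0 j\<bar>)"
    and noise: "\<And>j. j < n \<Longrightarrow> \<bar>(\<Sum>r<N. e r * x r j) / N\<bar> \<le> \<mu>"
    and gram: "\<And>i j. i < n \<Longrightarrow> j < n \<Longrightarrow> \<bar>(\<Sum>r<N. x r i * x r j) / N - G i j\<bar> \<le> q"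
    and J: "J \<subseteq> {..<n}" "card J \<le> s" "\<And>j. j < n \<Longrightarrow> j \<notin> J \<Longrightarrow> b0 j = 0"
    and re: "\<And>\<delta>. (\<Sum>j\<in>{..<n} - J. \<bar>\<delta> j\<bar>) \<le> 3 * (\<Sum>j\<in>J. \<bar>\<delta> j\<bar>) \<Longrightarrow>
       d\<^sup>2 * (\<Sum>j\<in>J. (\<delta> j)\<^sup>2) \<le> (\<Sum>i<n. \<Sum>j<n. \<delta> i * \<delta> j * G i j)"
    and q: "q \<ge> 0" "32 * q * s \<le> d\<^sup>2" and d: "d > 0" and nonneg: "\<mu> \<ge> 0" "l \<ge> 0"
    and cone: "(l > 0 \<and> 2 * \<mu> \<le> l) \<or> J = {..<n}"
  shows "(\<Sum>j<n. \<bar>b j - b0 j\<bar>) \<le> 64 * (\<mu> + l) * s / d\<^sup>2"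
proof -
  define D where "D j = b j - b0 j" for j
  define Xd where "Xd r = (\<Sum>j<n. x r j * D j)" for r
  define DJ where "DJ = (\<Sum>j\<in>J. \<bar>D j\<bar>)"
  define DC where "DC = (\<Sum>j\<in>{..<n} - J. \<bar>D j\<bar>)"
  define Sq where "Sq = (\<Sum>j\<in>J. (D j)\<^sup>2)"
  define R where "R = (\<Sum>r<N. (Xd r)\<^sup>2) / N"
  have finJ: "finite J" using J(1) finite_subset by auto
  have split: "(\<Sum>j<n. f j) = (\<Sum>j\<in>J. f j) + (\<Sum>j\<in>{..<n} - J. f j)" for f :: "nat \<Rightarrow> real"
    using sum.subset_diff[OF J(1), of f] by simp
  have Dsum: "(\<Sum>j<n. \<bar>D j\<bar>) = DJ + DC" unfolding DJ_def DC_def by (rule split)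
  have DJ0: "DJ \<ge> 0" and DC0: "DC \<ge> 0" by (auto simp: DJ_def DC_def intro: sum_nonneg)
  have R0: "R \<ge> 0" by (auto simp: R_def intro!: sum_nonneg divide_nonneg_nonneg)
  have "(\<Sum>r<N. (e r - Xd r)\<^sup>2) = (\<Sum>r<N. (e r)\<^sup>2) - 2 * (\<Sum>r<N. e r * Xd r) + (\<Sum>r<N. (Xd r)\<^sup>2)"
    by (simp add: power2_diff sum.distrib sum_subtractf sum_distrib_left mult_ac)
  then have "(\<Sum>r<N. (e r - Xd r)\<^sup>2) / N = (\<Sum>r<N. (e r)\<^sup>2) / N - 2 * ((\<Sum>r<N. e r * Xd r) / N) + R"
    by (simp add: R_def add_divide_distrib diff_divide_distrib)
  then have basic: "R \<le> 2 * ((\<Sum>r<N. e r * Xd r) / N) + 2 * l * ((\<Sum>j<n. \<bar>b0 j\<bar>) - (\<Sum>j<n. \<bar>b j\<bar>))"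
    using minimal unfolding Xd_def D_def by (simp add: right_diff_distrib)
  have "(\<Sum>r<N. e r * Xd r) / N = (\<Sum>j<n. D j * ((\<Sum>r<N. e r * x r j) / N))"
    unfolding Xd_def sum_distrib_left sum_divide_distrib
    by (subst sum.swap) (simp add: mult_ac)
  also have "\<dots> \<le> (\<Sum>j<n. \<bar>D j\<bar> * \<mu>)"
  proof (rule sum_mono)
    fix j assume "j \<in> {..<n}"
    then have "\<bar>D j * ((\<Sum>r<N. e r * x r j) / N)\<bar> \<le> \<bar>D j\<bar> * \<mu>"
      unfolding abs_mult using noise[of j] by (intro mult_left_mono) (auto simp: abs_divide)
    then show "D j * ((\<Sum>r<N. e r * x r j) / N) \<le> \<bar>D j\<bar> * \<mu>" by linarith
  qed
  also have "\<dots> = \<mu> * (DJ + DC)" unfolding Dsum[symmetric] by (simp add: sum_distrib_left mult.commute)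
  finally have noise_part: "(\<Sum>r<N. e r * Xd r) / N \<le> \<mu> * (DJ + DC)" .
  have "(\<Sum>j\<in>J. \<bar>b0 j\<bar>) - (\<Sum>j\<in>J. \<bar>b j\<bar>) \<le> DJ"
    unfolding DJ_def sum_subtractf[symmetric] D_def by (intro sum_mono) auto
  moreover have "(\<Sum>j\<in>{..<n} - J. \<bar>b0 j\<bar>) - (\<Sum>j\<in>{..<n} - J. \<bar>b j\<bar>) = - DC"
    unfolding DC_def sum_subtractf[symmetric] D_def sum_negf[symmetric]
    using J(3) by (intro sum.cong) auto
  ultimately have pen: "(\<Sum>j<n. \<bar>b0 j\<bar>) - (\<Sum>j<n. \<bar>b j\<bar>) \<le> DJ - DC"
    unfolding split[of "\<lambda>j. \<bar>b0 j\<bar>"] split[of "\<lambda>j. \<bar>b j\<bar>"] by linarith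
  have Rle: "R \<le> 2 * \<mu> * (DJ + DC) + 2 * l * (DJ - DC)"
    using basic noise_part mult_left_mono[OF pen, of "2 * l"] nonneg by linarith
  (* The cone condition: when 2 \<mu> \<le> l, the noise consumes at most l of the 2 l by which
     the penalty charges the inactive coordinates. *)
  have DC: "DC \<le> 3 * DJ"
    using cone
  proof
    assume l: "l > 0 \<and> 2 * \<mu> \<le> l"
    then have "2 * \<mu> * (DJ + DC) \<le> l * (DJ + DC)" using DJ0 DC0 by (intro mult_right_mono) auto
    then have "l * DC \<le> l * (3 * DJ)" using Rle R0 by (simp add: algebra_simps)
    then show ?thesis using l by simp
  qed (use DJ0 in \<open>auto simp: DC_def\<close>)
  have upper: "R \<le> 8 * (\<mu> + l) * DJ"
  proof -
    have "2 * \<mu> * (DJ + DC) \<le> 2 * \<mu> * (4 * DJ)" using DC nonneg by (intro mult_left_mono) auto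
    moreover have "2 * l * (DJ - DC) \<le> 2 * l * (4 * DJ)" using DC0 DJ0 nonneg by (intro mult_left_mono) auto
    ultimately show ?thesis using Rle by (simp add: algebra_simps)
  qed
  have CS: "DJ\<^sup>2 \<le> s * Sq" unfolding DJ_def Sq_def by (rule sum_squared_le_card_mult[OF finJ J(2)])
  have lower: "d\<^sup>2 / 2 * Sq \<le> R"
  proof -
    have "(\<Sum>r<N. (Xd r)\<^sup>2) = (\<Sum>i<n. \<Sum>j<n. D i * D j * (\<Sum>r<N. x r i * x r j))"
    proof -
      have "(\<Sum>r<N. (Xd r)\<^sup>2) = (\<Sum>r<N. \<Sum>i<n. \<Sum>j<n. D i * D j * (x r i * x r j))"
        by (simp add: Xd_def power2_eq_square sum_product mult_ac)
      also have "\<dots> = (\<Sum>i<n. \<Sum>r<N. \<Sum>j<n. D i * D j * (x r i * x r j))" by (rule sum.swap)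
      also have "\<dots> = (\<Sum>i<n. \<Sum>j<n. \<Sum>r<N. D i * D j * (x r i * x r j))"
        by (intro sum.cong refl sum.swap)
      finally show ?thesis by (simp add: sum_distrib_left)
    qed
    then have "R = (\<Sum>i<n. \<Sum>j<n. D i * D j * ((\<Sum>r<N. x r i * x r j) / N))"
      by (simp add: R_def sum_divide_distrib sum_distrib_left)
    then have "(\<Sum>i<n. \<Sum>j<n. D i * D j * G i j) - R
        = (\<Sum>i<n. \<Sum>j<n. D i * D j * (G i j - (\<Sum>r<N. x r i * x r j) / N))"
      by (simp add: sum_subtractf[symmetric] right_diff_distrib)
    also have "\<dots> \<le> (\<Sum>i<n. \<Sum>j<n. \<bar>D i\<bar> * \<bar>D j\<bar> * q)"
    proof (intro sum_mono)
      fix i j assume "i \<in> {..<n}" "j \<in> {..<n}"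
      then have "\<bar>D i * D j * (G i j - (\<Sum>r<N. x r i * x r j) / N)\<bar> \<le> \<bar>D i\<bar> * \<bar>D j\<bar> * q"
        unfolding abs_mult using gram[of i j] by (intro mult_left_mono) (auto simp: abs_minus_commute)
      then show "D i * D j * (G i j - (\<Sum>r<N. x r i * x r j) / N) \<le> \<bar>D i\<bar> * \<bar>D j\<bar> * q" by linarith
    qed
    also have "\<dots> = q * (DJ + DC)\<^sup>2"
      unfolding Dsum[symmetric] by (simp add: power2_eq_square sum_product sum_distrib_left mult_ac)
    also have "\<dots> \<le> q * (4 * DJ)\<^sup>2"
      using DC DC0 DJ0 q by (intro mult_left_mono power_mono) auto
    also have "\<dots> \<le> 16 * q * (s * Sq)"
      using mult_left_mono[OF CS, of "16 * q"] q by (simp add: power2_eq_square mult_ac)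
    also have "\<dots> \<le> d\<^sup>2 / 2 * Sq"
      using mult_right_mono[OF q(2), of Sq] by (simp add: Sq_def sum_nonneg mult_ac)
    finally have "(\<Sum>i<n. \<Sum>j<n. D i * D j * G i j) - R \<le> d\<^sup>2 / 2 * Sq" .
    moreover have "d\<^sup>2 * Sq \<le> (\<Sum>i<n. \<Sum>j<n. D i * D j * G i j)"
      unfolding Sq_def by (rule re) (use DC in \<open>simp add: DJ_def DC_def\<close>)
    ultimately show ?thesis by simp
  qed
  have "DJ \<le> 16 * (\<mu> + l) * s / d\<^sup>2"
  proof (cases "DJ = 0")
    case False
    then have pos: "DJ > 0" using DJ0 by simp
    have "d\<^sup>2 / 2 * DJ\<^sup>2 \<le> d\<^sup>2 / 2 * (s * Sq)" using CS by (intro mult_left_mono) auto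
    also have "\<dots> \<le> s * (8 * (\<mu> + l) * DJ)"
      using mult_left_mono[OF order_trans[OF lower upper], of s] by (simp add: mult_ac)
    finally have "(d\<^sup>2 * DJ) * DJ \<le> (16 * (\<mu> + l) * s) * DJ"
      by (simp add: power2_eq_square algebra_simps)
    then have "d\<^sup>2 * DJ \<le> 16 * (\<mu> + l) * s" using pos by simp
    then show ?thesis using d by (simp add: field_simps)
  qed (use nonneg in simp)
  moreover have "(\<Sum>j<n. \<bar>b j - b0 j\<bar>) \<le> 4 * DJ" using Dsum DC by (simp add: D_def)
  moreover have "64 * (\<mu> + l) * s / d\<^sup>2 = 4 * (16 * (\<mu> + l) * s / d\<^sup>2)" by simp
  ultimately show ?thesis by linarith
qed

section \<open>Centered Gaussian variables and Gaussian spaces\<close>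

interpretation std_normal: prob_space std_normal_distribution
  by (rule prob_space_normal_density) simp

text \<open>
  Representing the law by a scaled standard normal variable treats the degenerate case \<open>v = 0\<close>
  together with the others.
\<close>

lemma centered_normal_eq_distr:
  assumes "v \<ge> 0"
  shows "centered_normal v = distr std_normal_distribution borel (\<lambda>x. sqrt v * x)"
proof (cases "v = 0")
  case True
  then show ?thesis by (simp add: centered_normal_def std_normal.distr_const)
next
  case False
  then have v: "sqrt v > 0" using assms by simp
  have id: "distributed std_normal_distribution lborel (\<lambda>x. x) std_normal_density"
    unfolding distributed_def
    by (auto intro!: measure_eqI simp: emeasure_distr)
  have "distributed std_normal_distribution lborel (\<lambda>x. 0 + sqrt v * x) (normal_density 0 (sqrt v))"
    using std_normal.normal_density_affine[OF id, of "sqrt v" 0] v by simp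
  then have "distr std_normal_distribution lborel (\<lambda>x. sqrt v * x) = density lborel (normal_density 0 (sqrt v))"
    by (auto simp: distributed_def)
  moreover have "distr std_normal_distribution lborel (\<lambda>x. sqrt v * x) = distr std_normal_distribution borel (\<lambda>x. sqrt v * x)"
    by (intro distr_cong) auto
  ultimately show ?thesis using False by (simp add: centered_normal_def)
qed

text \<open>
  A real exponent shifts the density and an imaginary one yields the characteristic function; complex
  exponents are needed because the linearization of a difference of squares mixes the two.
\<close>

lemma std_normal_cexp:
  fixes c :: complex
  shows "integrable std_normal_distribution (\<lambda>x. exp (c * of_real x))"
    and "(\<integral>x. exp (c * of_real x) \<partial>std_normal_distribution) = exp (c\<^sup>2 / 2)"
proof -
  define a b where "a = Re c" and "b = Im c"
  have c: "c = of_real a + \<i> * of_real b" by (simp add: a_def b_def complex_eq_iff)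
  define f :: "real \<Rightarrow> complex" where "f x = std_normal_density x *\<^sub>R iexp (b * x)" for x
  have [measurable]: "f \<in> borel_measurable borel" unfolding f_def by measurable
  have intf: "integrable lborel f"
  proof -
    have "integrable std_normal_distribution (\<lambda>x. iexp (b * x))" 
      by (rule std_normal.integrable_iexp) auto
    then show ?thesis unfolding f_def by (subst (asm) integrable_density) auto
  qed
  have valf: "integral\<^sup>L lborel f = exp (complex_of_real (- b\<^sup>2 / 2))"
  proof -
    have "char std_normal_distribution b = integral\<^sup>L lborel f"
      unfolding char_def f_def by (subst integral_density) auto
    then show ?thesis by (simp add: char_std_normal_distribution exp_of_real[symmetric])
  qed
  have eq: "std_normal_density x *\<^sub>R exp (c * of_real x) = exp (of_real (a\<^sup>2 / 2) + \<i> * of_real (a * b)) * f (-a + 1 * x)" for x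
  proof -
    have n: "std_normal_density x = std_normal_density (x - a) * exp (a\<^sup>2 / 2 - a * x)"
      unfolding std_normal_density_def by (simp add: mult_exp_exp power2_diff field_simps)
    have e: "exp (of_real (a\<^sup>2 / 2 - a * x)) * exp (c * of_real x)
        = exp (of_real (a\<^sup>2 / 2) + \<i> * of_real (a * b)) * iexp (b * (x - a))"
      unfolding c by (simp add: mult_exp_exp algebra_simps)
    show ?thesis
      using arg_cong[OF e, of "\<lambda>z. of_real (std_normal_density (x - a)) * z"]
      unfolding f_def n scaleR_conv_of_real by (simp add: exp_of_real[symmetric] mult_ac)
  qed
  have "integrable lborel (\<lambda>x. exp (of_real (a\<^sup>2 / 2) + \<i> * of_real (a * b)) * f (-a + 1 * x))"
    using lborel_integrable_real_affine[OF intf, of 1 "-a"] by simp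
  then show "integrable std_normal_distribution (\<lambda>x. exp (c * of_real x))"
    by (subst integrable_density) (auto simp: eq)
  have "(\<integral>x. exp (c * of_real x) \<partial>std_normal_distribution) = (\<integral>x. std_normal_density x *\<^sub>R exp (c * of_real x) \<partial>lborel)"
    by (subst integral_density) auto
  also have "\<dots> = exp (of_real (a\<^sup>2 / 2) + \<i> * of_real (a * b)) * (\<integral>x. f (-a + 1 * x) \<partial>lborel)"
    unfolding eq by simp
  also have "(\<integral>x. f (-a + 1 * x) \<partial>lborel) = exp (complex_of_real (- b\<^sup>2 / 2))"
    using lborel_integral_real_affine[of 1 f "-a"] valf by (simp del: of_real_minus of_real_divide)
  also have "exp (of_real (a\<^sup>2 / 2) + \<i> * of_real (a * b)) * exp (complex_of_real (- b\<^sup>2 / 2)) = exp (c\<^sup>2 / 2)"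
    unfolding exp_add[symmetric] c by (intro arg_cong[where f = exp]) (simp add: power2_eq_square field_simps)
  finally show "(\<integral>x. exp (c * of_real x) \<partial>std_normal_distribution) = exp (c\<^sup>2 / 2)" by simp
qed

definition gaussian_rv :: "'a measure \<Rightarrow> ('a \<Rightarrow> real) \<Rightarrow> bool" where
  "gaussian_rv M X \<longleftrightarrow> X \<in> borel_measurable M \<and> (\<exists>v\<ge>0. distr M borel X = centered_normal v)"

lemma gaussian_rv_measurable[measurable_dest]: "gaussian_rv M X \<Longrightarrow> X \<in> borel_measurable M"
  by (simp add: gaussian_rv_def)

lemma std_normal_moments:
  "integrable std_normal_distribution (\<lambda>x. x)" "(\<integral>x. x \<partial>std_normal_distribution) = 0"
  "integrable std_normal_distribution (\<lambda>x. x\<^sup>2)" "(\<integral>x. x\<^sup>2 \<partial>std_normal_distribution) = 1"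
  using integrable_std_normal_distribution_moment[of 1] integral_std_normal_distribution_moment_odd[of 1]
    std_normal_distribution_even_moments[of 1]
  by (auto simp: fact_numeral)

context
  fixes M :: "'a measure" and X :: "'a \<Rightarrow> real"
  assumes X: "gaussian_rv M X"
begin

lemma gaussian_rv_scaled_std_normal:
  obtains v where "v \<ge> 0" "distr M borel X = centered_normal v"
    "\<And>f :: real \<Rightarrow> real. f \<in> borel_measurable borel \<Longrightarrow>
      integrable std_normal_distribution (\<lambda>x. f (sqrt v * x)) \<Longrightarrow> integrable M (\<lambda>\<omega>. f (X \<omega>))"
    "\<And>f :: real \<Rightarrow> real. f \<in> borel_measurable borel \<Longrightarrow>
      (\<integral>\<omega>. f (X \<omega>) \<partial>M) = (\<integral>x. f (sqrt v * x) \<partial>std_normal_distribution)"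
proof -
  obtain v where v: "v \<ge> 0" "distr M borel X = centered_normal v" and [measurable]: "X \<in> borel_measurable M"
    using X by (auto simp: gaussian_rv_def)
  then have d: "distr M borel X = distr std_normal_distribution borel (\<lambda>x. sqrt v * x)"
    using centered_normal_eq_distr by simp
  show thesis
  proof (rule that[OF v])
    fix f :: "real \<Rightarrow> real" assume [measurable]: "f \<in> borel_measurable borel"
    show "integrable M (\<lambda>\<omega>. f (X \<omega>))" if "integrable std_normal_distribution (\<lambda>x. f (sqrt v * x))"
    proof -
      have "integrable (distr std_normal_distribution borel (\<lambda>x. sqrt v * x)) f"
        using that by (subst integrable_distr_eq) auto
      then show ?thesis by (subst (asm) d[symmetric]) (simp add: integrable_distr_eq)
    qed
    have "(\<integral>\<omega>. f (X \<omega>) \<partial>M) = integral\<^sup>L (distr M borel X) f" by (simp add: integral_distr)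
    also have "\<dots> = (\<integral>x. f (sqrt v * x) \<partial>std_normal_distribution)" by (simp add: d integral_distr)
    finally show "(\<integral>\<omega>. f (X \<omega>) \<partial>M) = (\<integral>x. f (sqrt v * x) \<partial>std_normal_distribution)" .
  qed
qed

lemma gaussian_rv_square_integrable: "integrable M (\<lambda>\<omega>. (X \<omega>)\<^sup>2)"
proof (rule gaussian_rv_scaled_std_normal)
  fix v assume "\<And>f :: real \<Rightarrow> real. f \<in> borel_measurable borel \<Longrightarrow>
     integrable std_normal_distribution (\<lambda>x. f (sqrt v * x)) \<Longrightarrow> integrable M (\<lambda>\<omega>. f (X \<omega>))"
  from this[of "\<lambda>x. x\<^sup>2"] show ?thesis by (simp add: power_mult_distrib std_normal_moments)
qed

lemma gaussian_rv_mean: "(\<integral>\<omega>. X \<omega> \<partial>M) = 0"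
proof (rule gaussian_rv_scaled_std_normal)
  fix v assume "\<And>f :: real \<Rightarrow> real. f \<in> borel_measurable borel \<Longrightarrow>
     (\<integral>\<omega>. f (X \<omega>) \<partial>M) = (\<integral>x. f (sqrt v * x) \<partial>std_normal_distribution)"
  from this[of "\<lambda>x. x"] show ?thesis by (simp add: std_normal_moments)
qed

lemma gaussian_rv_law: "distr M borel X = centered_normal (\<integral>\<omega>. (X \<omega>)\<^sup>2 \<partial>M)"
proof (rule gaussian_rv_scaled_std_normal)
  fix v :: real assume v: "v \<ge> 0" and d: "distr M borel X = centered_normal v"
    and *: "\<And>f :: real \<Rightarrow> real. f \<in> borel_measurable borel \<Longrightarrow>
     (\<integral>\<omega>. f (X \<omega>) \<partial>M) = (\<integral>x. f (sqrt v * x) \<partial>std_normal_distribution)"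
  have "(\<integral>\<omega>. (X \<omega>)\<^sup>2 \<partial>M) = v" using *[of "\<lambda>x. x\<^sup>2"] v by (simp add: power_mult_distrib std_normal_moments)
  then show ?thesis using d by simp
qed

lemma gaussian_rv_cexp:
  fixes c :: complex
  shows "integrable M (\<lambda>\<omega>. exp (c * of_real (X \<omega>)))"
    and "(\<integral>\<omega>. exp (c * of_real (X \<omega>)) \<partial>M) = exp (c\<^sup>2 * of_real (\<integral>\<omega>. (X \<omega>)\<^sup>2 \<partial>M) / 2)"
proof -
  define v where "v = (\<integral>\<omega>. (X \<omega>)\<^sup>2 \<partial>M)"
  have v: "v \<ge> 0" by (simp add: v_def)
  have [measurable]: "X \<in> borel_measurable M" using X by simp
  have d: "distr M borel X = distr std_normal_distribution borel (\<lambda>x. sqrt v * x)"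
    using gaussian_rv_law centered_normal_eq_distr[OF v] by (simp add: v_def)
  have eq: "c * of_real (sqrt v * x) = (c * of_real (sqrt v)) * of_real x" for x by simp
  have "integrable (distr std_normal_distribution borel (\<lambda>x. sqrt v * x)) (\<lambda>x. exp (c * of_real x))"
    by (subst integrable_distr_eq) (auto simp only: eq std_normal_cexp, auto)
  then show "integrable M (\<lambda>\<omega>. exp (c * of_real (X \<omega>)))"
    by (subst (asm) d[symmetric]) (simp add: integrable_distr_eq)
  have "(\<integral>\<omega>. exp (c * of_real (X \<omega>)) \<partial>M) = (\<integral>x. exp (c * of_real x) \<partial>distr M borel X)" by (simp add: integral_distr)
  also have "\<dots> = (\<integral>x. exp ((c * of_real (sqrt v)) * of_real x) \<partial>std_normal_distribution)"
    unfolding d by (subst integral_distr) (auto simp: mult.assoc)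
  also have "\<dots> = exp (c\<^sup>2 * of_real v / 2)"
    unfolding std_normal_cexp using v by (simp add: power_mult_distrib of_real_power[symmetric] del: of_real_power)
  finally show "(\<integral>\<omega>. exp (c * of_real (X \<omega>)) \<partial>M) = exp (c\<^sup>2 * of_real (\<integral>\<omega>. (X \<omega>)\<^sup>2 \<partial>M) / 2)" 
    by (simp add: v_def)
qed

end

text \<open>
  This is how Gaussianity of sums and limits is recognized, by uniqueness of characteristic functions.
\<close>

lemma (in prob_space) gaussian_rv_iff_char:
  assumes [measurable]: "X \<in> borel_measurable M" and v: "v \<ge> 0"
    and char: "\<And>u. (\<integral>\<omega>. iexp (u * X \<omega>) \<partial>M) = exp (- of_real (u\<^sup>2 * v / 2))"
  shows "gaussian_rv M X" "(\<integral>\<omega>. (X \<omega>)\<^sup>2 \<partial>M) = v"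
proof -
  define D where "D = distr std_normal_distribution borel (\<lambda>x. sqrt v * x)"
  have "distr M borel X = D"
  proof (rule Levy_uniqueness)
    show "real_distribution (distr M borel X)" by simp
    show "real_distribution D" unfolding D_def by (rule std_normal.real_distribution_distr) simp
    show "char (distr M borel X) = char D"
    proof
      fix u
      have "char (distr M borel X) u = exp (- of_real (u\<^sup>2 * v / 2))"
        unfolding char_def by (subst integral_distr) (auto simp only: char, measurable)
      also have "\<dots> = (\<integral>x. exp ((\<i> * of_real (u * sqrt v)) * of_real x) \<partial>std_normal_distribution)"
        unfolding std_normal_cexp using v 
        by (simp add: power_mult_distrib of_real_power[symmetric] del: of_real_power)
      also have "\<dots> = char D u" unfolding char_def D_def
        by (subst integral_distr) (auto simp: mult.assoc)
      finally show "char (distr M borel X) u = char D u" .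
    qed
  qed
  then have d: "distr M borel X = centered_normal v" using centered_normal_eq_distr[OF v] by (simp add: D_def)
  show "gaussian_rv M X" unfolding gaussian_rv_def using d v by auto
  have "(\<integral>\<omega>. (X \<omega>)\<^sup>2 \<partial>M) = (\<integral>x. x\<^sup>2 \<partial>distr M borel X)" by (simp add: integral_distr)
  also have "\<dots> = (\<integral>x. (sqrt v * x)\<^sup>2 \<partial>std_normal_distribution)"
    unfolding d centered_normal_eq_distr[OF v] by (subst integral_distr) auto
  also have "\<dots> = v" using v by (simp add: power_mult_distrib std_normal_moments)
  finally show "(\<integral>\<omega>. (X \<omega>)\<^sup>2 \<partial>M) = v" .
qed

definition iid_normal :: "nat \<Rightarrow> (nat \<Rightarrow> real) measure" where
  "iid_normal n = Pi\<^sub>M {..<n} (\<lambda>_. std_normal_distribution)"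

interpretation iid_std_normal: product_prob_space "\<lambda>_ :: nat. std_normal_distribution" UNIV
  by unfold_locales

lemma prob_space_iid_normal: "prob_space (iid_normal n)"
  unfolding iid_normal_def by (intro prob_space_PiM std_normal.prob_space_axioms)

lemma measurable_iid_normal_component [measurable]:
  "i < n \<Longrightarrow> (\<lambda>x. x i) \<in> borel_measurable (iid_normal n)"
proof -
  assume "i < n"
  then have "(\<lambda>x. x i) \<in> iid_normal n \<rightarrow>\<^sub>M std_normal_distribution"
    unfolding iid_normal_def by (intro measurable_component_singleton) simp
  then show ?thesis by simp
qed

lemma iid_normal_cexp:
  fixes a :: "nat \<Rightarrow> complex"
  shows "integrable (iid_normal n) (\<lambda>x. exp (\<Sum>t<n. a t * of_real (x t)))"
    and "(\<integral>x. exp (\<Sum>t<n. a t * of_real (x t)) \<partial>iid_normal n) = exp (\<Sum>t<n. (a t)\<^sup>2 / 2)"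
  unfolding iid_normal_def exp_sum[OF finite_lessThan]
  using iid_std_normal.product_integrable_prod[of "{..<n}" "\<lambda>t x. exp (a t * of_real x)"]
    iid_std_normal.product_integral_prod[of "{..<n}" "\<lambda>t x. exp (a t * of_real x)"]
  by (simp_all add: std_normal_cexp)

text \<open>
  The integrand is a multiple of the density of variance \<open>1 / (1 - 2 c)\<close>.
\<close>

lemma std_normal_exp_square:
  fixes c :: real
  assumes "c < 1 / 2"
  shows "integrable std_normal_distribution (\<lambda>x. exp (c * x\<^sup>2))"
    and "(\<integral>x. exp (c * x\<^sup>2) \<partial>std_normal_distribution) = 1 / sqrt (1 - 2 * c)"
proof -
  define \<sigma> where "\<sigma> = 1 / sqrt (1 - 2 * c)"
  have \<sigma>: "\<sigma> > 0" "\<sigma>\<^sup>2 = 1 / (1 - 2 * c)" using assms by (auto simp: \<sigma>_def power_divide)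
  have eq: "std_normal_density x *\<^sub>R exp (c * x\<^sup>2) = \<sigma> * normal_density 0 \<sigma> x" for x
  proof -
    have "sqrt (2 * pi * \<sigma>\<^sup>2) = sqrt (2 * pi) * \<sigma>" using \<sigma>(1) by (simp add: real_sqrt_mult)
    then have "\<sigma> * normal_density 0 \<sigma> x = 1 / sqrt (2 * pi) * exp (- (x\<^sup>2) / (2 * \<sigma>\<^sup>2))"
      using \<sigma>(1) by (simp add: normal_density_def)
    also have "- (x\<^sup>2) / (2 * \<sigma>\<^sup>2) = - (x\<^sup>2) / 2 + c * x\<^sup>2"
      using assms by (simp add: \<sigma>(2) field_simps)
    finally show ?thesis by (simp add: std_normal_density_def mult_exp_exp)
  qed
  show "integrable std_normal_distribution (\<lambda>x. exp (c * x\<^sup>2))"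
    by (subst integrable_density) (auto simp: eq simp del: real_scaleR_def intro: \<sigma>)
  show "(\<integral>x. exp (c * x\<^sup>2) \<partial>std_normal_distribution) = 1 / sqrt (1 - 2 * c)"
    by (subst integral_density) (use \<sigma> in \<open>auto simp: eq simp del: real_scaleR_def simp flip: \<sigma>_def\<close>)
qed

lemma iid_normal_exp_square:
  fixes c :: real
  assumes "c < 1 / 2"
  shows "integrable (iid_normal n) (\<lambda>x. exp (c * (\<Sum>t<n. (x t)\<^sup>2)))"
    and "(\<integral>x. exp (c * (\<Sum>t<n. (x t)\<^sup>2)) \<partial>iid_normal n) = (1 / sqrt (1 - 2 * c)) ^ n"
  unfolding iid_normal_def exp_sum[OF finite_lessThan] sum_distrib_left
  using iid_std_normal.product_integrable_prod[of "{..<n}" "\<lambda>t x. exp (c * x\<^sup>2)"]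
    iid_std_normal.product_integral_prod[of "{..<n}" "\<lambda>t x. exp (c * x\<^sup>2)"]
  by (simp_all add: std_normal_exp_square[OF assms])

text \<open>
  A linear space of centered Gaussian variables.  It encodes joint Gaussianity without fixing a finite
  family: every finite family of its elements has a Gaussian law.
\<close>

definition gaussian_space :: "'a measure \<Rightarrow> ('a \<Rightarrow> real) set \<Rightarrow> bool" where
  "gaussian_space M H \<longleftrightarrow> (\<forall>X\<in>H. gaussian_rv M X) \<and> (\<lambda>_. 0) \<in> H \<and>
     (\<forall>X\<in>H. \<forall>Y\<in>H. (\<lambda>\<omega>. X \<omega> + Y \<omega>) \<in> H) \<and> (\<forall>X\<in>H. \<forall>c. (\<lambda>\<omega>. c * X \<omega>) \<in> H)"

context
  fixes M :: "'a measure" and H :: "('a \<Rightarrow> real) set"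
  assumes H: "gaussian_space M H"
begin

lemma gaussian_space_rv: "X \<in> H \<Longrightarrow> gaussian_rv M X"
  and gaussian_space_zero: "(\<lambda>_. 0) \<in> H"
  and gaussian_space_add: "X \<in> H \<Longrightarrow> Y \<in> H \<Longrightarrow> (\<lambda>\<omega>. X \<omega> + Y \<omega>) \<in> H"
  and gaussian_space_scale: "X \<in> H \<Longrightarrow> (\<lambda>\<omega>. c * X \<omega>) \<in> H"
  using H by (auto simp: gaussian_space_def)

lemma gaussian_space_sum:
  "finite A \<Longrightarrow> (\<And>i. i \<in> A \<Longrightarrow> X i \<in> H) \<Longrightarrow> (\<lambda>\<omega>. \<Sum>i\<in>A. X i \<omega>) \<in> H"
  by (induction A rule: finite_induct) (auto simp: gaussian_space_zero gaussian_space_add)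

lemma gaussian_space_integrable_mult:
  assumes "X \<in> H" "Y \<in> H"
  shows "integrable M (\<lambda>\<omega>. X \<omega> * Y \<omega>)"
proof -
  have "integrable M (\<lambda>\<omega>. (X \<omega> + Y \<omega>)\<^sup>2)" "integrable M (\<lambda>\<omega>. (X \<omega>)\<^sup>2)" "integrable M (\<lambda>\<omega>. (Y \<omega>)\<^sup>2)"
    using assms by (auto intro: gaussian_rv_square_integrable[OF gaussian_space_rv]
        gaussian_rv_square_integrable[OF gaussian_space_rv[OF gaussian_space_add]])
  then have "integrable M (\<lambda>\<omega>. ((X \<omega> + Y \<omega>)\<^sup>2 - (X \<omega>)\<^sup>2 - (Y \<omega>)\<^sup>2) / 2)"
    by auto
  then show ?thesis by (simp add: power2_sum algebra_simps)
qed

lemma gaussian_space_cov_sum_left: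
  assumes "finite A" "\<And>i. i \<in> A \<Longrightarrow> X i \<in> H" "Y \<in> H"
  shows "(\<integral>\<omega>. (\<Sum>i\<in>A. u i * X i \<omega>) * Y \<omega> \<partial>M) = (\<Sum>i\<in>A. u i * (\<integral>\<omega>. X i \<omega> * Y \<omega> \<partial>M))"
proof -
  have "(\<integral>\<omega>. (\<Sum>i\<in>A. u i * X i \<omega>) * Y \<omega> \<partial>M) = (\<integral>\<omega>. (\<Sum>i\<in>A. u i * (X i \<omega> * Y \<omega>)) \<partial>M)"
    by (simp add: sum_distrib_right mult.assoc)
  also have "\<dots> = (\<Sum>i\<in>A. u i * (\<integral>\<omega>. X i \<omega> * Y \<omega> \<partial>M))"
    using assms gaussian_space_integrable_mult by (subst Bochner_Integration.integral_sum) auto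
  finally show ?thesis .
qed

lemma gaussian_space_cov_sum:
  assumes "finite A" "\<And>i. i \<in> A \<Longrightarrow> X i \<in> H"
  shows "(\<integral>\<omega>. (\<Sum>i\<in>A. u i * X i \<omega>)\<^sup>2 \<partial>M)
    = (\<Sum>i\<in>A. \<Sum>j\<in>A. u i * u j * (\<integral>\<omega>. X i \<omega> * X j \<omega> \<partial>M))"
proof -
  have "(\<integral>\<omega>. (\<Sum>i\<in>A. u i * X i \<omega>)\<^sup>2 \<partial>M) = (\<Sum>i\<in>A. u i * (\<integral>\<omega>. X i \<omega> * (\<Sum>j\<in>A. u j * X j \<omega>) \<partial>M))"
    unfolding power2_eq_square using assms
    by (intro gaussian_space_cov_sum_left gaussian_space_sum gaussian_space_scale) auto
  also have "\<dots> = (\<Sum>i\<in>A. u i * (\<Sum>j\<in>A. u j * (\<integral>\<omega>. X j \<omega> * X i \<omega> \<partial>M)))"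
    using assms by (intro sum.cong refl arg_cong2[where f = "(*)"])
      (simp add: mult.commute[of "X _ _" "sum _ _"] gaussian_space_cov_sum_left)
  finally show ?thesis by (simp add: sum_distrib_left mult_ac)
qed

end

section \<open>Concentration of Gaussian quadratic forms\<close>

text \<open>
  Schur's test: a symmetric matrix whose absolute row sums are at most \<open>L\<close> has operator norm at
  most \<open>L\<close>.
\<close>

lemma row_sum_norm_bounds:
  fixes G :: "nat \<Rightarrow> nat \<Rightarrow> real"
  assumes sym: "\<And>s t. s < n \<Longrightarrow> t < n \<Longrightarrow> G s t = G t s"
    and row: "\<And>t. t < n \<Longrightarrow> (\<Sum>s<n. \<bar>G t s\<bar>) \<le> L"
  shows "(\<Sum>t<n. \<Sum>s<n. x t * x s * G t s) \<le> L * (\<Sum>t<n. (x t)\<^sup>2)"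
    and "(\<Sum>t<n. (\<Sum>s<n. G t s * x s)\<^sup>2) \<le> L\<^sup>2 * (\<Sum>t<n. (x t)\<^sup>2)"
proof -
  have "(\<Sum>t<n. \<Sum>s<n. x t * x s * G t s) \<le> (\<Sum>t<n. \<Sum>s<n. ((x t)\<^sup>2 + (x s)\<^sup>2) / 2 * \<bar>G t s\<bar>)"
  proof (intro sum_mono)
    fix t s
    have "x t * x s * G t s \<le> \<bar>x t * x s\<bar> * \<bar>G t s\<bar>" by (metis abs_ge_self abs_mult)
    also have "\<dots> \<le> ((x t)\<^sup>2 + (x s)\<^sup>2) / 2 * \<bar>G t s\<bar>"
      using sum_squares_bound[of "\<bar>x t\<bar>" "\<bar>x s\<bar>"] by (intro mult_right_mono) (auto simp: abs_mult)
    finally show "x t * x s * G t s \<le> ((x t)\<^sup>2 + (x s)\<^sup>2) / 2 * \<bar>G t s\<bar>" .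
  qed
  also have "\<dots> = (\<Sum>t<n. \<Sum>s<n. (x t)\<^sup>2 / 2 * \<bar>G t s\<bar>) + (\<Sum>t<n. \<Sum>s<n. (x s)\<^sup>2 / 2 * \<bar>G t s\<bar>)"
    by (simp add: sum.distrib[symmetric] algebra_simps add_divide_distrib)
  also have "(\<Sum>t<n. \<Sum>s<n. (x s)\<^sup>2 / 2 * \<bar>G t s\<bar>) = (\<Sum>t<n. \<Sum>s<n. (x t)\<^sup>2 / 2 * \<bar>G t s\<bar>)"
    by (subst sum.swap) (intro sum.cong refl, simp add: sym)
  also have "(\<Sum>t<n. \<Sum>s<n. (x t)\<^sup>2 / 2 * \<bar>G t s\<bar>) + (\<Sum>t<n. \<Sum>s<n. (x t)\<^sup>2 / 2 * \<bar>G t s\<bar>) 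
     = (\<Sum>t<n. (x t)\<^sup>2 * (\<Sum>s<n. \<bar>G t s\<bar>))"
    by (simp add: sum.distrib[symmetric] sum_distrib_left mult.commute)
  also have "\<dots> \<le> (\<Sum>t<n. (x t)\<^sup>2 * L)" by (intro sum_mono mult_left_mono row) auto
  finally show "(\<Sum>t<n. \<Sum>s<n. x t * x s * G t s) \<le> L * (\<Sum>t<n. (x t)\<^sup>2)"
    by (simp add: sum_distrib_left mult_ac)
  have "(\<Sum>s<n. G t s * x s)\<^sup>2 \<le> L * (\<Sum>s<n. \<bar>G t s\<bar> * (x s)\<^sup>2)" if t: "t < n" for t
  proof -
    have "\<bar>\<Sum>s<n. G t s * x s\<bar> \<le> (\<Sum>s<n. sqrt \<bar>G t s\<bar> * (sqrt \<bar>G t s\<bar> * \<bar>x s\<bar>))"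
      by (rule order_trans[OF sum_abs]) (simp add: abs_mult mult.assoc[symmetric])
    then have "(\<Sum>s<n. G t s * x s)\<^sup>2 \<le> (\<Sum>s<n. sqrt \<bar>G t s\<bar> * (sqrt \<bar>G t s\<bar> * \<bar>x s\<bar>))\<^sup>2"
      by (rule abs_le_square_iff[THEN iffD1, OF order_trans[OF _ abs_ge_self]])
    also have "\<dots> \<le> (\<Sum>s<n. (sqrt \<bar>G t s\<bar>)\<^sup>2) * (\<Sum>s<n. (sqrt \<bar>G t s\<bar> * \<bar>x s\<bar>)\<^sup>2)"
      by (rule Cauchy_Schwarz_ineq_sum)
    also have "\<dots> = (\<Sum>s<n. \<bar>G t s\<bar>) * (\<Sum>s<n. \<bar>G t s\<bar> * (x s)\<^sup>2)" by (simp add: power_mult_distrib)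
    also have "\<dots> \<le> L * (\<Sum>s<n. \<bar>G t s\<bar> * (x s)\<^sup>2)"
      by (intro mult_right_mono row t sum_nonneg) auto
    finally show ?thesis .
  qed
  then have "(\<Sum>t<n. (\<Sum>s<n. G t s * x s)\<^sup>2) \<le> (\<Sum>t<n. L * (\<Sum>s<n. \<bar>G t s\<bar> * (x s)\<^sup>2))"
    by (intro sum_mono) auto
  also have "\<dots> = L * (\<Sum>s<n. (x s)\<^sup>2 * (\<Sum>t<n. \<bar>G s t\<bar>))"
    unfolding sum_distrib_left by (subst sum.swap) (intro sum.cong refl, simp add: sym mult_ac)
  also have "\<dots> \<le> L * (\<Sum>s<n. (x s)\<^sup>2 * L)"
  proof (cases "n = 0")
    case False
    then have "0 \<le> L" using row[of 0] by (intro order_trans[OF sum_nonneg row[of 0]]) auto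
    then show ?thesis by (intro mult_left_mono sum_mono row) auto
  qed simp
  finally show "(\<Sum>t<n. (\<Sum>s<n. G t s * x s)\<^sup>2) \<le> L\<^sup>2 * (\<Sum>t<n. (x t)\<^sup>2)"
    by (simp add: sum_distrib_left sum_distrib_right power2_eq_square mult_ac)
qed

abbreviation (in prob_space) cov :: "('a \<Rightarrow> real) \<Rightarrow> ('a \<Rightarrow> real) \<Rightarrow> real" where
  "cov X Y \<equiv> (\<integral>\<omega>. X \<omega> * Y \<omega> \<partial>M)"

text \<open>
  Write \<open>|W|\<^sup>2 = \<Sum>\<^sub>t W\<^sub>t\<^sup>2\<close> and let \<open>W'\<close> be an independent copy of \<open>W\<close>.  The product on the left is the
  expectation of \<open>exp (\<theta> (|W|\<^sup>2 - |W'|\<^sup>2))\<close>.  Because \<open>(u + \<i> v)\<^sup>2 + (u - \<i> v)\<^sup>2 = 2 (u\<^sup>2 - v\<^sup>2)\<close>, this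
  exponential is the mean of \<open>exp (\<surd>\<theta> ((x + y) \<bullet> W + \<i> (x - y) \<bullet> W'))\<close> over independent standard normal
  vectors \<open>x\<close> and \<open>y\<close>.  Integrating \<open>W\<close> and \<open>W'\<close> first leaves \<open>exp (2 \<theta> x' G y)\<close> with \<open>G\<close> the covariance
  matrix: the quadratic form has been decoupled.  Integrating \<open>y\<close> gives \<open>exp (2 \<theta>\<^sup>2 |G x|\<^sup>2)\<close>, and
  \<open>|G x| \<le> L |x|\<close> leaves an integral of \<open>exp (2 \<theta>\<^sup>2 L\<^sup>2 |x|\<^sup>2)\<close>.
\<close>

lemma (in prob_space) gaussian_square_mgf_product:
  fixes W :: "nat \<Rightarrow> 'a \<Rightarrow> real"
  assumes H: "gaussian_space M H" and W: "\<And>t. t < n \<Longrightarrow> W t \<in> H"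
    and row: "\<And>t. t < n \<Longrightarrow> (\<Sum>s<n. \<bar>cov (W t) (W s)\<bar>) \<le> L"
    and \<theta>: "\<theta> \<ge> 0" "\<theta> * L < 1 / 2" and L: "L \<ge> 0"
  shows "integrable M (\<lambda>\<omega>. exp (\<theta> * (\<Sum>t<n. (W t \<omega>)\<^sup>2)))"
    and "(\<integral>\<omega>. exp (\<theta> * (\<Sum>t<n. (W t \<omega>)\<^sup>2)) \<partial>M) * (\<integral>\<omega>. exp (- \<theta> * (\<Sum>t<n. (W t \<omega>)\<^sup>2)) \<partial>M)
           \<le> (1 / sqrt (1 - 4 * \<theta>\<^sup>2 * L\<^sup>2)) ^ n"
proof -
  define G where "G t s = (cov (W t) (W s))" for t s
  define Q where "Q x = (\<Sum>t<n. \<Sum>s<n. x t * x s * G t s)" for x :: "nat \<Rightarrow> real"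
  define B where "B x y = (\<Sum>s<n. y s * (\<Sum>t<n. G s t * x t))" for x y :: "nat \<Rightarrow> real"
  have G_sym: "G t s = G s t" for t s by (simp add: G_def mult.commute)
  have row': "(\<Sum>s<n. \<bar>G t s\<bar>) \<le> L" if "t < n" for t using row[OF that] by (simp add: G_def)
  have W_meas[measurable]: "W t \<in> borel_measurable M" if "t < n" for t
    using gaussian_space_rv[OF H W[OF that]] by measurable
  define lin where "lin x \<omega> = (\<Sum>t<n. x t * W t \<omega>)" for x :: "nat \<Rightarrow> real" and \<omega>
  have lin_H: "lin x \<in> H" for x unfolding lin_def
    by (intro gaussian_space_sum[OF H] gaussian_space_scale[OF H]) (auto simp: W)
  have lin_var: "(\<integral>\<omega>. (lin x \<omega>)\<^sup>2 \<partial>M) = Q x" for x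
    unfolding lin_def Q_def G_def by (rule gaussian_space_cov_sum[OF H]) (auto simp: W)
  note lin_cexp = gaussian_rv_cexp[OF gaussian_space_rv[OF H lin_H], unfolded lin_var]
  let ?N = "iid_normal n"
  interpret N: prob_space ?N by (rule prob_space_iid_normal)
  interpret NN: pair_prob_space ?N ?N ..
  interpret MM: pair_prob_space M M ..
  interpret P: pair_prob_space "?N \<Otimes>\<^sub>M ?N" "M \<Otimes>\<^sub>M M" ..
  define r where "r = sqrt \<theta>"
  have r2: "r\<^sup>2 = \<theta>" using \<theta> by (simp add: r_def)
  (* Here z = (x, y) and w = (\<omega>, \<omega>'), so W' = W \<omega>'. *)
  define f where "f = (\<lambda>z w. exp (of_real (r * lin (\<lambda>t. fst z t + snd z t) (fst w))) *
      iexp (r * lin (\<lambda>t. fst z t - snd z t) (snd w)))"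
  have f_meas[measurable]: "case_prod f \<in> borel_measurable ((?N \<Otimes>\<^sub>M ?N) \<Otimes>\<^sub>M (M \<Otimes>\<^sub>M M))"
    unfolding f_def lin_def by measurable
  have norm_f: "norm (f z w) = exp (r * lin (\<lambda>t. fst z t + snd z t) (fst w))" for z w
    unfolding f_def by (simp add: norm_mult)
  have inner_w: "integrable (M \<Otimes>\<^sub>M M) (f z)"
    "(\<integral>w. norm (f z w) \<partial>(M \<Otimes>\<^sub>M M)) = exp (\<theta> / 2 * Q (\<lambda>t. fst z t + snd z t))"
    "(\<integral>w. f z w \<partial>(M \<Otimes>\<^sub>M M)) = exp (of_real (2 * \<theta> * B (fst z) (snd z)))" for z
  proof -
    let ?p = "lin (\<lambda>t. fst z t + snd z t)" and ?m = "lin (\<lambda>t. fst z t - snd z t)"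
    have [measurable]: "?p \<in> borel_measurable M" "?m \<in> borel_measurable M" unfolding lin_def by measurable
    have i1: "integrable M (\<lambda>\<omega>. exp (complex_of_real (r * ?p \<omega>)))"
      using lin_cexp(1)[of "of_real r"] by simp
    have i2: "integrable M (\<lambda>\<omega>. iexp (r * ?m \<omega>))" by (rule integrable_iexp) auto
    have e1: "(\<integral>\<omega>. exp (complex_of_real (r * ?p \<omega>)) \<partial>M) = exp (of_real (\<theta> / 2 * Q (\<lambda>t. fst z t + snd z t)))"
      using lin_cexp(2)[of "of_real r"] by (simp add: r2 flip: of_real_power)
    have e2: "(\<integral>\<omega>. iexp (r * ?m \<omega>) \<partial>M) = exp (of_real (- \<theta> / 2 * Q (\<lambda>t. fst z t - snd z t)))"
      using lin_cexp(2)[of "\<i> * of_real r"] 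
      by (simp add: power_mult_distrib r2 mult.assoc flip: of_real_power)
    have fz: "f z = (\<lambda>(\<omega>, \<omega>'). exp (of_real (r * ?p \<omega>)) * iexp (r * ?m \<omega>'))"
      by (auto simp: f_def fun_eq_iff)
    show int: "integrable (M \<Otimes>\<^sub>M M) (f z)"
    proof (rule MM.Fubini_integrable)
      show "f z \<in> borel_measurable (M \<Otimes>\<^sub>M M)" unfolding fz by measurable
      show "integrable M (\<lambda>x. \<integral>y. norm (f z (x, y)) \<partial>M)"
        using integrable_norm[OF i1] by (simp add: fz norm_mult prob_space)
      show "AE x in M. integrable M (\<lambda>y. f z (x, y))"
        using i2 by (auto simp: fz)
    qed
    have "(\<integral>w. f z w \<partial>(M \<Otimes>\<^sub>M M)) = (\<integral>\<omega>. \<integral>\<omega>'. exp (of_real (r * ?p \<omega>)) * iexp (r * ?m \<omega>') \<partial>M \<partial>M)"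
      using MM.integral_fst'[OF int] by (simp add: fz)
    also have "\<dots> = exp (of_real (\<theta> / 2 * Q (\<lambda>t. fst z t + snd z t))) * exp (of_real (- \<theta> / 2 * Q (\<lambda>t. fst z t - snd z t)))"
      by (simp only: integral_mult_right_zero integral_mult_left_zero e1 e2)
    also have "\<dots> = exp (of_real (\<theta> / 2 * (Q (\<lambda>t. fst z t + snd z t) - Q (\<lambda>t. fst z t - snd z t))))"
      by (simp add: mult_exp_exp algebra_simps)
    also have "Q (\<lambda>t. fst z t + snd z t) - Q (\<lambda>t. fst z t - snd z t) = 4 * B (fst z) (snd z)"
    proof -
      have "Q (\<lambda>t. fst z t + snd z t) - Q (\<lambda>t. fst z t - snd z t)
         = (\<Sum>t<n. \<Sum>s<n. 2 * (snd z t * G t s * fst z s)) + (\<Sum>t<n. \<Sum>s<n. 2 * (snd z s * G t s * fst z t))"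
        unfolding Q_def sum_subtractf[symmetric] sum.distrib[symmetric]
        by (intro sum.cong refl) (simp add: algebra_simps)
      also have "(\<Sum>t<n. \<Sum>s<n. 2 * (snd z s * G t s * fst z t)) = (\<Sum>t<n. \<Sum>s<n. 2 * (snd z t * G t s * fst z s))"
        by (subst sum.swap) (simp add: G_sym)
      finally show ?thesis by (simp add: B_def sum_distrib_left mult_ac)
    qed
    finally show "(\<integral>w. f z w \<partial>(M \<Otimes>\<^sub>M M)) = exp (of_real (2 * \<theta> * B (fst z) (snd z)))" by (simp add: mult.assoc)
    have "integrable (M \<Otimes>\<^sub>M M) (\<lambda>(\<omega>, \<omega>'). norm (f z (\<omega>, \<omega>')))" using integrable_norm[OF int] by (simp add: case_prod_unfold)
    from MM.integral_fst'[OF this]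
    have "(\<integral>w. norm (f z w) \<partial>(M \<Otimes>\<^sub>M M)) = (\<integral>\<omega>. exp (r * ?p \<omega>) \<partial>M)"
      by (simp add: norm_f prob_space case_prod_unfold)
    also have "\<dots> = Re (\<integral>\<omega>. exp (complex_of_real (r * ?p \<omega>)) \<partial>M)"
      by (simp add: exp_of_real del: of_real_mult)
    finally show "(\<integral>w. norm (f z w) \<partial>(M \<Otimes>\<^sub>M M)) = exp (\<theta> / 2 * Q (\<lambda>t. fst z t + snd z t))"
      unfolding e1 by (simp only: exp_of_real Re_complex_of_real)
  qed
  have int_sq: "integrable ?N (\<lambda>x. exp (\<theta> * L * (\<Sum>t<n. (x t)\<^sup>2)))"
    using iid_normal_exp_square(1)[of "\<theta> * L" n] \<theta> by simp
  have int_dom: "integrable (?N \<Otimes>\<^sub>M ?N) (\<lambda>z. exp (\<theta> * L * (\<Sum>t<n. (fst z t)\<^sup>2)) * exp (\<theta> * L * (\<Sum>t<n. (snd z t)\<^sup>2)))"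
  proof (rule NN.Fubini_integrable)
    show "(\<lambda>z. exp (\<theta> * L * (\<Sum>t<n. (fst z t)\<^sup>2)) * exp (\<theta> * L * (\<Sum>t<n. (snd z t)\<^sup>2))) \<in> borel_measurable (?N \<Otimes>\<^sub>M ?N)"
      by measurable
  qed (use int_sq in \<open>auto simp: abs_mult\<close>)
  (* Integrability, by (x + y)' G (x + y) \<le> 2 L (|x|^2 + |y|^2) and \<theta> L < 1/2. *)
  have int_f: "integrable ((?N \<Otimes>\<^sub>M ?N) \<Otimes>\<^sub>M (M \<Otimes>\<^sub>M M)) (case_prod f)"
  proof (rule P.Fubini_integrable[OF f_meas])
    have "integrable (?N \<Otimes>\<^sub>M ?N) (\<lambda>z. exp (\<theta> / 2 * Q (\<lambda>t. fst z t + snd z t)))"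
    proof (rule Bochner_Integration.integrable_bound[OF int_dom])
      show "(\<lambda>z. exp (\<theta> / 2 * Q (\<lambda>t. fst z t + snd z t))) \<in> borel_measurable (?N \<Otimes>\<^sub>M ?N)"
        unfolding Q_def by measurable
      show "AE z in ?N \<Otimes>\<^sub>M ?N. norm (exp (\<theta> / 2 * Q (\<lambda>t. fst z t + snd z t)))
         \<le> norm (exp (\<theta> * L * (\<Sum>t<n. (fst z t)\<^sup>2)) * exp (\<theta> * L * (\<Sum>t<n. (snd z t)\<^sup>2)))"
      proof (intro AE_I2)
        fix z :: "(nat \<Rightarrow> real) \<times> (nat \<Rightarrow> real)"
        have "Q (\<lambda>t. fst z t + snd z t) \<le> L * (\<Sum>t<n. (fst z t + snd z t)\<^sup>2)"
          unfolding Q_def using G_sym row' by (intro row_sum_norm_bounds(1)) auto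
        also have "\<dots> \<le> L * (\<Sum>t<n. 2 * (fst z t)\<^sup>2 + 2 * (snd z t)\<^sup>2)"
        proof (intro mult_left_mono L sum_mono)
          fix t show "(fst z t + snd z t)\<^sup>2 \<le> 2 * (fst z t)\<^sup>2 + 2 * (snd z t)\<^sup>2"
            using zero_le_power2[of "fst z t - snd z t"] unfolding power2_diff power2_sum by linarith
        qed
        finally have "\<theta> / 2 * Q (\<lambda>t. fst z t + snd z t) \<le> \<theta> / 2 * (L * (\<Sum>t<n. 2 * (fst z t)\<^sup>2 + 2 * (snd z t)\<^sup>2))"
          using \<theta> by (intro mult_left_mono) auto
        then show "norm (exp (\<theta> / 2 * Q (\<lambda>t. fst z t + snd z t)))
         \<le> norm (exp (\<theta> * L * (\<Sum>t<n. (fst z t)\<^sup>2)) * exp (\<theta> * L * (\<Sum>t<n. (snd z t)\<^sup>2)))"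
          by (simp add: mult_exp_exp sum.distrib sum_distrib_left[symmetric] algebra_simps)
      qed
    qed
    then show "integrable (?N \<Otimes>\<^sub>M ?N) (\<lambda>x. \<integral>y. norm (case_prod f (x, y)) \<partial>(M \<Otimes>\<^sub>M M))"
      by (simp add: inner_w(2))
  qed (simp add: inner_w(1))
  define S where "S \<omega> = (\<Sum>t<n. (W t \<omega>)\<^sup>2)" for \<omega>
  have S_meas[measurable]: "S \<in> borel_measurable M" unfolding S_def by measurable
  have inner_z: "(\<integral>z. f z w \<partial>(?N \<Otimes>\<^sub>M ?N)) = of_real (exp (\<theta> * S (fst w)) * exp (- \<theta> * S (snd w)))"
    if int: "integrable (?N \<Otimes>\<^sub>M ?N) (\<lambda>z. f z w)" for w
  proof -
    (* The integrand factors over the coordinates of x and of y, with the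
       conjugate coefficients r (W \<plusminus> \<i> W'). *)
    define a b where "a t = of_real r * (of_real (W t (fst w)) + \<i> * of_real (W t (snd w)))"
      and "b t = of_real r * (of_real (W t (fst w)) - \<i> * of_real (W t (snd w)))" for t
    have f_ab: "f (x, y) w = exp (\<Sum>t<n. a t * of_real (x t)) * exp (\<Sum>t<n. b t * of_real (y t))" for x y
      unfolding f_def lin_def a_def b_def mult_exp_exp
      by (intro arg_cong[where f = exp])
        (simp add: sum_distrib_left sum.distrib[symmetric] sum_subtractf[symmetric] algebra_simps)
    have "(\<integral>z. f z w \<partial>(?N \<Otimes>\<^sub>M ?N)) = (\<integral>x. \<integral>y. f (x, y) w \<partial>?N \<partial>?N)"
      using NN.integral_fst'[OF int] by simp
    also have "\<dots> = exp (\<Sum>t<n. (a t)\<^sup>2 / 2) * exp (\<Sum>t<n. (b t)\<^sup>2 / 2)"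
      by (simp add: f_ab iid_normal_cexp)
    also have "\<dots> = exp (of_real (\<theta> * S (fst w) - \<theta> * S (snd w)))"
      unfolding mult_exp_exp sum.distrib[symmetric] S_def right_diff_distrib[symmetric] sum_subtractf[symmetric]
        sum_distrib_left of_real_sum
    proof (intro arg_cong[where f = exp] sum.cong refl)
      fix t
      have "(a t)\<^sup>2 / 2 + (b t)\<^sup>2 / 2 = (of_real r)\<^sup>2 * ((of_real (W t (fst w)))\<^sup>2 - (of_real (W t (snd w)))\<^sup>2)"
        by (simp add: a_def b_def power_mult_distrib power2_sum power2_diff field_simps)
      then show "(a t)\<^sup>2 / 2 + (b t)\<^sup>2 / 2 = of_real (\<theta> * ((W t (fst w))\<^sup>2 - (W t (snd w))\<^sup>2))"
        by (simp add: r2 flip: of_real_power)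
    qed
    finally show ?thesis by (simp only: exp_of_real mult_exp_exp) simp
  qed
  define h where "h w = exp (\<theta> * S (fst w)) * exp (- \<theta> * S (snd w))" for w
  have [measurable]: "h \<in> borel_measurable (M \<Otimes>\<^sub>M M)" unfolding h_def by measurable
  have inner_z_AE: "AE w in M \<Otimes>\<^sub>M M. (\<integral>z. f z w \<partial>(?N \<Otimes>\<^sub>M ?N)) = of_real (h w)"
    using P.AE_integrable_snd[OF int_f] by eventually_elim (simp add: inner_z h_def)
  have int_h: "integrable (M \<Otimes>\<^sub>M M) h"
  proof -
    have "integrable (M \<Otimes>\<^sub>M M) (\<lambda>w. \<integral>z. f z w \<partial>(?N \<Otimes>\<^sub>M ?N))" by (rule P.integrable_snd[OF int_f])
    then have "integrable (M \<Otimes>\<^sub>M M) (\<lambda>w. complex_of_real (h w))"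
      by (rule integrable_cong_AE_imp) (use inner_z_AE in \<open>auto simp: eq_commute\<close>)
    from integrable_Re[OF this] show ?thesis by simp
  qed
  then have int_h': "integrable (M \<Otimes>\<^sub>M M) (\<lambda>(\<omega>, \<omega>'). exp (\<theta> * S \<omega>) * exp (- \<theta> * S \<omega>'))"
    by (simp add: h_def[abs_def] case_prod_unfold)
  have "AE \<omega>' in M. integrable M (\<lambda>\<omega>. exp (\<theta> * S \<omega>) * exp (- \<theta> * S \<omega>'))"
    using MM.AE_integrable_snd[OF int_h'] .
  (* Fubini gives integrability for almost every \<omega>'; a single one suffices. *)
  then obtain \<omega>' where "integrable M (\<lambda>\<omega>. exp (\<theta> * S \<omega>) * exp (- \<theta> * S \<omega>'))"
    using AE_False eventually_mono by (metis (mono_tags, lifting))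
  then have int_S: "integrable M (\<lambda>\<omega>. exp (\<theta> * S \<omega>))" 
    using integrable_mult_left[of "exp (\<theta> * S \<omega>')" M "\<lambda>\<omega>. exp (\<theta> * S \<omega>) * exp (- \<theta> * S \<omega>')"]
    by (simp add: mult.assoc mult_exp_exp)
  then show "integrable M (\<lambda>\<omega>. exp (\<theta> * (\<Sum>t<n. (W t \<omega>)\<^sup>2)))" by (simp add: S_def)
  have int_B: "integrable (?N \<Otimes>\<^sub>M ?N) (\<lambda>z. exp (2 * \<theta> * B (fst z) (snd z)))"
  proof -
    have "integrable (?N \<Otimes>\<^sub>M ?N) (\<lambda>z. \<integral>w. f z w \<partial>(M \<Otimes>\<^sub>M M))" by (rule P.integrable_fst[OF int_f])
    then have "integrable (?N \<Otimes>\<^sub>M ?N) (\<lambda>z. Re (\<integral>w. f z w \<partial>(M \<Otimes>\<^sub>M M)))" by (rule integrable_Re)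
    then show ?thesis unfolding inner_w(3) exp_of_real by simp
  qed
  have "(\<integral>\<omega>. exp (\<theta> * S \<omega>) \<partial>M) * (\<integral>\<omega>. exp (- \<theta> * S \<omega>) \<partial>M) = (\<integral>w. h w \<partial>(M \<Otimes>\<^sub>M M))"
    using MM.integral_fst'[OF int_h] by (simp add: h_def[abs_def])
  also have "\<dots> = Re (\<integral>w. of_real (h w) \<partial>(M \<Otimes>\<^sub>M M))" by simp
  also have "(\<integral>w. complex_of_real (h w) \<partial>(M \<Otimes>\<^sub>M M)) = (\<integral>w. \<integral>z. f z w \<partial>(?N \<Otimes>\<^sub>M ?N) \<partial>(M \<Otimes>\<^sub>M M))"
    by (intro integral_cong_AE borel_measurable_integrable[OF P.integrable_snd[OF int_f]])
      (use inner_z_AE in \<open>auto simp: eq_commute\<close>)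
  also have "\<dots> = (\<integral>z. \<integral>w. f z w \<partial>(M \<Otimes>\<^sub>M M) \<partial>(?N \<Otimes>\<^sub>M ?N))" by (rule P.Fubini_integral[OF int_f])
  also have "Re \<dots> = (\<integral>z. exp (2 * \<theta> * B (fst z) (snd z)) \<partial>(?N \<Otimes>\<^sub>M ?N))"
    unfolding inner_w(3) exp_of_real by simp
  also have "\<dots> = (\<integral>x. \<integral>y. exp (2 * \<theta> * B x y) \<partial>?N \<partial>?N)"
    using NN.integral_fst'[OF int_B] by simp
  also have "\<dots> = (\<integral>x. exp (2 * \<theta>\<^sup>2 * (\<Sum>s<n. (\<Sum>t<n. G s t * x t)\<^sup>2)) \<partial>?N)"
  proof (rule Bochner_Integration.integral_cong[OF refl])
    fix x
    define g where "g s = 2 * \<theta> * (\<Sum>t<n. G s t * x t)" for s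
    have B_eq: "2 * \<theta> * B x y = (\<Sum>s<n. g s * y s)" for y
      by (simp add: B_def g_def sum_distrib_left mult_ac)
    have "(\<integral>y. exp (2 * \<theta> * B x y) \<partial>?N) = (\<integral>y. Re (exp (\<Sum>s<n. of_real (g s) * of_real (y s))) \<partial>?N)"
      unfolding B_eq by (simp only: of_real_mult[symmetric] of_real_sum[symmetric] exp_of_real Re_complex_of_real)
    also have "\<dots> = Re (exp (\<Sum>s<n. (of_real (g s))\<^sup>2 / 2))"
      by (subst integral_Re) (simp_all add: iid_normal_cexp)
    also have "(\<Sum>s<n. (complex_of_real (g s))\<^sup>2 / 2) = of_real (2 * \<theta>\<^sup>2 * (\<Sum>s<n. (\<Sum>t<n. G s t * x t)\<^sup>2))"
    proof -
      have "(complex_of_real (g s))\<^sup>2 / 2 = of_real (2 * \<theta>\<^sup>2 * (\<Sum>t<n. G s t * x t)\<^sup>2)" for s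
        unfolding g_def by (simp only: of_real_power[symmetric] power_mult_distrib) simp
      then show ?thesis by (simp only: of_real_sum[symmetric] sum_distrib_left)
    qed
    finally show "(\<integral>y. exp (2 * \<theta> * B x y) \<partial>?N) = exp (2 * \<theta>\<^sup>2 * (\<Sum>s<n. (\<Sum>t<n. G s t * x t)\<^sup>2))"
      by (simp only: exp_of_real Re_complex_of_real)
  qed
  also have "\<dots> \<le> (\<integral>x. exp (2 * \<theta>\<^sup>2 * L\<^sup>2 * (\<Sum>s<n. (x s)\<^sup>2)) \<partial>?N)"
  proof (rule integral_mono')
    have "(\<theta> * L)\<^sup>2 < (1 / 2)\<^sup>2" using \<theta> L by (intro power_strict_mono) auto
    then have c: "2 * \<theta>\<^sup>2 * L\<^sup>2 < 1 / 2" by (simp add: power_mult_distrib power_divide)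
    show "integrable ?N (\<lambda>x. exp (2 * \<theta>\<^sup>2 * L\<^sup>2 * (\<Sum>s<n. (x s)\<^sup>2)))" by (rule iid_normal_exp_square(1)[OF c])
    fix x show "exp (2 * \<theta>\<^sup>2 * (\<Sum>s<n. (\<Sum>t<n. G s t * x t)\<^sup>2)) \<le> exp (2 * \<theta>\<^sup>2 * L\<^sup>2 * (\<Sum>s<n. (x s)\<^sup>2))"
      using mult_left_mono[OF row_sum_norm_bounds(2)[of n G L x], of "2 * \<theta>\<^sup>2"] G_sym row'
      by (auto simp: mult.assoc)
  qed auto
  also have "\<dots> = (1 / sqrt (1 - 4 * \<theta>\<^sup>2 * L\<^sup>2)) ^ n"
  proof -
    have "(\<theta> * L)\<^sup>2 < (1 / 2)\<^sup>2" using \<theta> L by (intro power_strict_mono) auto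
    then have c: "2 * \<theta>\<^sup>2 * L\<^sup>2 < 1 / 2" by (simp add: power_mult_distrib power_divide)
    then show ?thesis unfolding iid_normal_exp_square(2)[OF c] by (simp add: mult.assoc)
  qed
  finally show "(\<integral>\<omega>. exp (\<theta> * (\<Sum>t<n. (W t \<omega>)\<^sup>2)) \<partial>M) * (\<integral>\<omega>. exp (- \<theta> * (\<Sum>t<n. (W t \<omega>)\<^sup>2)) \<partial>M)
           \<le> (1 / sqrt (1 - 4 * \<theta>\<^sup>2 * L\<^sup>2)) ^ n"
    by (simp add: S_def)
qed

lemma deviation_sets:
  fixes f :: "'a \<Rightarrow> real"
  assumes [measurable]: "f \<in> borel_measurable M"
  shows "{\<omega>\<in>space M. c \<le> e * (f \<omega> - m)} \<in> sets M" "{\<omega>\<in>space M. c \<le> \<bar>f \<omega> - m\<bar>} \<in> sets M"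
  by measurable

text \<open>
  With \<open>m = E S\<close> for the sum of squares \<open>S\<close>, Jensen's inequality gives \<open>exp (- \<theta> m) \<le> E exp (- \<theta> S)\<close> and
  \<open>exp (\<theta> m) \<le> E exp (\<theta> S)\<close>.  Hence \<open>E exp (\<theta> S) * E exp (- \<theta> S)\<close> dominates the moment generating
  function of \<open>S - m\<close> at both \<open>\<theta>\<close> and \<open>- \<theta>\<close>, and Chernoff's bound applies to both tails at once.
\<close>

lemma (in prob_space) gaussian_sum_squares_concentration:
  fixes W :: "nat \<Rightarrow> 'a \<Rightarrow> real"
  assumes H: "gaussian_space M H" and W: "\<And>t. t < n \<Longrightarrow> W t \<in> H"
    and row: "\<And>t. t < n \<Longrightarrow> (\<Sum>s<n. \<bar>cov (W t) (W s)\<bar>) \<le> L"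
    and x: "0 < x" "x \<le> L"
  shows "prob {\<omega>\<in>space M. real n * x \<le> \<bar>(\<Sum>t<n. (W t \<omega>)\<^sup>2) - (\<Sum>t<n. \<integral>\<omega>. (W t \<omega>)\<^sup>2 \<partial>M)\<bar>}
    \<le> 2 * exp (- (real n * x\<^sup>2 / (16 * L\<^sup>2)))"
proof -
  define S where "S \<omega> = (\<Sum>t<n. (W t \<omega>)\<^sup>2)" for \<omega>
  define m where "m = (\<Sum>t<n. \<integral>\<omega>. (W t \<omega>)\<^sup>2 \<partial>M)"
  (* The minimizer of 4 \<theta>^2 L^2 - \<theta> x, which is then - x^2 / (16 L^2). *)
  define \<theta> where "\<theta> = x / (8 * L\<^sup>2)"
  define z where "z = x\<^sup>2 / (16 * L\<^sup>2)"
  have L: "L > 0" using x by simp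
  have W_meas[measurable]: "W t \<in> borel_measurable M" if "t < n" for t
    using gaussian_space_rv[OF H W[OF that]] by measurable
  have S_meas[measurable]: "S \<in> borel_measurable M" unfolding S_def by measurable
  have \<theta>: "\<theta> > 0" using x L by (simp add: \<theta>_def)
  have \<theta>L: "\<theta> * L < 1 / 2" using x L by (simp add: \<theta>_def power2_eq_square field_simps)
  have z: "4 * \<theta>\<^sup>2 * L\<^sup>2 = z" using L by (simp add: \<theta>_def z_def power_divide power_mult_distrib field_simps power2_eq_square)
  have z0: "z \<ge> 0" by (simp add: z_def)
  have z1: "z \<le> 1 / 2"
  proof -
    have "x\<^sup>2 \<le> L\<^sup>2" using x by (intro power_mono) auto
    then have "x\<^sup>2 \<le> 8 * L\<^sup>2" using zero_le_power2[of L] by linarith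
    then show ?thesis using L by (simp add: z_def field_simps)
  qed
  note mgf = gaussian_square_mgf_product[OF H W row less_imp_le[OF \<theta>] \<theta>L less_imp_le[OF L], folded S_def, unfolded z]
  have bound: "(1 / sqrt (1 - z)) ^ n \<le> exp (real n * z)"
  proof -
    (* Since z \<le> 1/2, 1 - z is at least exp (- 2 z). *)
    have "1 \<le> (1 + 2 * z) * (1 - z)"
    proof -
      have "0 \<le> z * (1 - 2 * z)" using z0 z1 by (intro mult_nonneg_nonneg) auto
      then show ?thesis by (simp add: algebra_simps)
    qed
    also have "\<dots> \<le> exp (2 * z) * (1 - z)" using z1 by (intro mult_right_mono exp_ge_add_one_self) auto
    finally have "sqrt 1 \<le> sqrt (exp (2 * z) * (1 - z))" by (rule real_sqrt_le_mono)
    also have "\<dots> = exp z * sqrt (1 - z)"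
      by (simp add: real_sqrt_mult exp_double)
    finally have "1 / sqrt (1 - z) \<le> exp z" using z1 by (simp add: field_simps)
    then have "(1 / sqrt (1 - z)) ^ n \<le> exp z ^ n" using z1 by (intro power_mono) auto
    then show ?thesis by (simp add: exp_of_nat_mult)
  qed
  have int_S: "integrable M S" unfolding S_def
    using W by (intro Bochner_Integration.integrable_sum gaussian_rv_square_integrable gaussian_space_rv[OF H]) auto
  have E_S: "(\<integral>\<omega>. S \<omega> \<partial>M) = m" unfolding S_def m_def
    using W by (intro Bochner_Integration.integral_sum gaussian_rv_square_integrable gaussian_space_rv[OF H]) auto
  have S0: "S \<omega> \<ge> 0" for \<omega> by (simp add: S_def sum_nonneg)
  have int_neg: "integrable M (\<lambda>\<omega>. exp (- \<theta> * S \<omega>))"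
    by (rule integrable_const_bound[of _ 1]) (use \<theta> S0 in auto)
  have jensen: "exp (c * m) \<le> (\<integral>\<omega>. exp (c * S \<omega>) \<partial>M)" if int: "integrable M (\<lambda>\<omega>. exp (c * S \<omega>))" for c
  proof -
    have "exp (c * m) = (\<integral>\<omega>. exp (c * m) * (1 + c * (S \<omega> - m)) \<partial>M)"
      using int_S by (simp add: E_S prob_space)
    also have "\<dots> \<le> (\<integral>\<omega>. exp (c * S \<omega>) \<partial>M)"
    proof (rule integral_mono[OF _ int])
      show "integrable M (\<lambda>\<omega>. exp (c * m) * (1 + c * (S \<omega> - m)))" using int_S by auto
      fix \<omega>
      have "exp (c * m) * (1 + c * (S \<omega> - m)) \<le> exp (c * m) * exp (c * (S \<omega> - m))"
        by (intro mult_left_mono exp_ge_add_one_self) auto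
      also have "\<dots> = exp (c * S \<omega>)" by (simp add: mult_exp_exp algebra_simps)
      finally show "exp (c * m) * (1 + c * (S \<omega> - m)) \<le> exp (c * S \<omega>)" .
    qed
    finally show ?thesis .
  qed
  have tail: "prob {\<omega>\<in>space M. real n * x \<le> e * (S \<omega> - m)} \<le> exp (- (real n * z))"
    if e: "e = 1 \<or> e = - 1" for e
  proof -
    have int: "integrable M (\<lambda>\<omega>. exp (c * \<theta> * S \<omega>))" if "c = 1 \<or> c = -1" for c
      using that mgf(1) int_neg by auto
    have e': "- e = 1 \<or> - e = - 1" using e by auto
    have "prob {\<omega>\<in>space M. real n * x \<le> e * (S \<omega> - m)}
        = prob {\<omega>\<in>space M. exp (\<theta> * (real n * x) + e * \<theta> * m) \<le> exp (e * \<theta> * S \<omega>)}"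
    proof (intro arg_cong[where f = prob] Collect_cong conj_cong refl)
      fix \<omega>
      have "real n * x \<le> e * (S \<omega> - m) \<longleftrightarrow> \<theta> * (real n * x) \<le> \<theta> * (e * (S \<omega> - m))" using \<theta> by simp
      also have "\<dots> \<longleftrightarrow> \<theta> * (real n * x) + e * \<theta> * m \<le> e * \<theta> * S \<omega>" by (simp add: algebra_simps)
      finally show "real n * x \<le> e * (S \<omega> - m) \<longleftrightarrow> exp (\<theta> * (real n * x) + e * \<theta> * m) \<le> exp (e * \<theta> * S \<omega>)" by simp
    qed
    also have "\<dots> \<le> (\<integral>\<omega>. exp (e * \<theta> * S \<omega>) \<partial>M) / exp (\<theta> * (real n * x) + e * \<theta> * m)"
      by (rule integral_Markov_inequality_measure[where A = "{}"]) (use int[OF e] in auto)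
    also have "\<dots> = exp (- \<theta> * (real n * x)) * ((\<integral>\<omega>. exp (e * \<theta> * S \<omega>) \<partial>M) * exp (- e * \<theta> * m))"
      by (simp add: exp_add exp_minus field_simps)
    also have "\<dots> \<le> exp (- \<theta> * (real n * x)) * ((\<integral>\<omega>. exp (e * \<theta> * S \<omega>) \<partial>M) * (\<integral>\<omega>. exp (- e * \<theta> * S \<omega>) \<partial>M))"
      using jensen[OF int[OF e']] by (intro mult_left_mono) (auto intro!: integral_nonneg)
    also have "(\<integral>\<omega>. exp (e * \<theta> * S \<omega>) \<partial>M) * (\<integral>\<omega>. exp (- e * \<theta> * S \<omega>) \<partial>M)
        = (\<integral>\<omega>. exp (\<theta> * S \<omega>) \<partial>M) * (\<integral>\<omega>. exp (- \<theta> * S \<omega>) \<partial>M)"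
      using e by (auto simp: mult.commute)
    also have "exp (- \<theta> * (real n * x)) * \<dots> \<le> exp (- \<theta> * (real n * x)) * exp (real n * z)"
      using order_trans[OF mgf(2) bound] by (intro mult_left_mono) auto
    also have "\<theta> * x = 2 * z" by (simp add: \<theta>_def z_def power2_eq_square)
    then have "exp (- \<theta> * (real n * x)) * exp (real n * z) = exp (- (real n * z))"
      unfolding mult_exp_exp by (intro arg_cong[where f = exp]) (simp add: mult.left_commute[of \<theta>])
    finally show ?thesis .
  qed
  define Up where "Up = {\<omega>\<in>space M. real n * x \<le> 1 * (S \<omega> - m)}"
  define Lo where "Lo = {\<omega>\<in>space M. real n * x \<le> (- 1) * (S \<omega> - m)}"
  have sets: "Up \<in> sets M" "Lo \<in> sets M"
    unfolding Up_def Lo_def by (rule deviation_sets(1)[OF S_meas])+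
  have "{\<omega>\<in>space M. real n * x \<le> \<bar>S \<omega> - m\<bar>} = Up \<union> Lo" by (auto simp: Up_def Lo_def)
  then have "prob {\<omega>\<in>space M. real n * x \<le> \<bar>S \<omega> - m\<bar>} \<le> prob Up + prob Lo"
    by (simp add: measure_Un_le[OF sets])
  also have "\<dots> \<le> exp (- (real n * z)) + exp (- (real n * z))"
    unfolding Up_def Lo_def by (intro add_mono tail) auto
  finally show ?thesis by (simp add: S_def m_def z_def)
qed

text \<open>
  Polarization: \<open>X Y = ((X + Y)\<^sup>2 - (X - Y)\<^sup>2) / 4\<close>, and the covariances of \<open>X \<plusminus> Y\<close> have absolute row sums at
  most \<open>4 L\<close>.
\<close>

lemma (in prob_space) gaussian_sum_products_concentration:
  fixes X Y :: "nat \<Rightarrow> 'a \<Rightarrow> real"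
  assumes H: "gaussian_space M H" and X: "\<And>t. t < n \<Longrightarrow> X t \<in> H" and Y: "\<And>t. t < n \<Longrightarrow> Y t \<in> H"
    and row: "\<And>t. t < n \<Longrightarrow> (\<Sum>s<n. \<bar>cov (X t) (X s)\<bar>) \<le> L"
      "\<And>t. t < n \<Longrightarrow> (\<Sum>s<n. \<bar>cov (Y t) (Y s)\<bar>) \<le> L"
      "\<And>t. t < n \<Longrightarrow> (\<Sum>s<n. \<bar>cov (X t) (Y s)\<bar>) \<le> L"
      "\<And>t. t < n \<Longrightarrow> (\<Sum>s<n. \<bar>cov (Y t) (X s)\<bar>) \<le> L"
    and x: "0 < x" "x \<le> L"
  shows "prob {\<omega>\<in>space M. real n * x \<le> \<bar>(\<Sum>t<n. X t \<omega> * Y t \<omega>) - (\<Sum>t<n. cov (X t) (Y t))\<bar>}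
    \<le> 4 * exp (- (real n * x\<^sup>2 / (64 * L\<^sup>2)))"
proof -
  define W where "W e t \<omega> = X t \<omega> + e * Y t \<omega>" for e t \<omega>
  have W: "W e t \<in> H" if "t < n" for e t
    unfolding W_def using that by (intro gaussian_space_add[OF H] gaussian_space_scale[OF H] X Y)
  have int: "integrable M (\<lambda>\<omega>. U \<omega> * V \<omega>)" if "U \<in> H" "V \<in> H" for U V
    by (rule gaussian_space_integrable_mult[OF H that])
  have W_cov: "(cov (W e t) (W e s)) = (cov (X t) (X s)) + e * (cov (X t) (Y s))
      + e * (cov (Y t) (X s)) + e\<^sup>2 * (cov (Y t) (Y s))" if "t < n" "s < n" for e t s
  proof -
    have "W e t \<omega> * W e s \<omega> = X t \<omega> * X s \<omega> + e * (X t \<omega> * Y s \<omega>) + e * (Y t \<omega> * X s \<omega>) + e\<^sup>2 * (Y t \<omega> * Y s \<omega>)" for \<omega>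
      by (simp add: W_def algebra_simps power2_eq_square)
    then show ?thesis using that by (simp add: int X Y)
  qed
  have tail: "prob {\<omega>\<in>space M. real n * (2 * x) \<le> \<bar>(\<Sum>t<n. (W e t \<omega>)\<^sup>2) - (\<Sum>t<n. \<integral>\<omega>. (W e t \<omega>)\<^sup>2 \<partial>M)\<bar>}
     \<le> 2 * exp (- (real n * x\<^sup>2 / (64 * L\<^sup>2)))" if e: "\<bar>e\<bar> = 1" for e
  proof -
    have "(\<Sum>s<n. \<bar>cov (W e t) (W e s)\<bar>) \<le> 4 * L" if t: "t < n" for t
    proof -
      have "(\<Sum>s<n. \<bar>cov (W e t) (W e s)\<bar>) \<le> (\<Sum>s<n. \<bar>cov (X t) (X s)\<bar> + \<bar>cov (X t) (Y s)\<bar>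
          + \<bar>cov (Y t) (X s)\<bar> + \<bar>cov (Y t) (Y s)\<bar>)"
      proof (intro sum_mono)
        fix s assume s: "s \<in> {..<n}"
        have "e\<^sup>2 = 1" using e by (metis abs_square_eq_1)
        then have "(cov (W e t) (W e s)) = (cov (X t) (X s)) + e * (cov (X t) (Y s))
            + e * (cov (Y t) (X s)) + (cov (Y t) (Y s))"
          using W_cov[of t s e] t s by simp
        moreover have abs_e: "\<bar>e * z\<bar> = \<bar>z\<bar>" for z using e by (simp add: abs_mult)
        ultimately show "\<bar>cov (W e t) (W e s)\<bar> \<le> \<bar>cov (X t) (X s)\<bar> + \<bar>cov (X t) (Y s)\<bar>
          + \<bar>cov (Y t) (X s)\<bar> + \<bar>cov (Y t) (Y s)\<bar>"
          using abs_e[of "cov (X t) (Y s)"] abs_e[of "cov (Y t) (X s)"] by linarith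
      qed
      also have "\<dots> \<le> 4 * L" using row(1-4)[OF t] by (simp add: sum.distrib)
      finally show ?thesis .
    qed
    from gaussian_sum_squares_concentration[OF H, where W = "W e" and n = n and L = "4 * L" and x = "2 * x", OF W this] x
    show ?thesis by (simp add: power_mult_distrib)
  qed
  have W_meas[measurable]: "W e t \<in> borel_measurable M" if "t < n" for e t
    using gaussian_space_rv[OF H W[OF that]] by measurable
  define D where "D e = {\<omega>\<in>space M. real n * (2 * x) \<le> \<bar>(\<Sum>t<n. (W e t \<omega>)\<^sup>2) - (\<Sum>t<n. \<integral>\<omega>. (W e t \<omega>)\<^sup>2 \<partial>M)\<bar>}" for e
  have D_sets: "D e \<in> sets M" for e
    unfolding D_def by (intro deviation_sets(2) borel_measurable_sum borel_measurable_power W_meas) simp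
  have pol: "U * V = ((U + 1 * V)\<^sup>2 - (U + (-1) * V)\<^sup>2) / 4" for U V :: real
    by (simp add: power2_sum power2_diff)
  have E_pol: "(cov (X t) (Y t)) = ((\<integral>\<omega>. (W 1 t \<omega>)\<^sup>2 \<partial>M) - (\<integral>\<omega>. (W (-1) t \<omega>)\<^sup>2 \<partial>M)) / 4" if "t < n" for t
    using W_cov[OF that that, of 1] W_cov[OF that that, of "-1"] by (simp add: power2_eq_square mult.commute)
  have "{\<omega>\<in>space M. real n * x \<le> \<bar>(\<Sum>t<n. X t \<omega> * Y t \<omega>) - (\<Sum>t<n. cov (X t) (Y t))\<bar>}
     \<subseteq> {\<omega>\<in>space M. real n * (2 * x) \<le> \<bar>(\<Sum>t<n. (W 1 t \<omega>)\<^sup>2) - (\<Sum>t<n. \<integral>\<omega>. (W 1 t \<omega>)\<^sup>2 \<partial>M)\<bar>}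
     \<union> {\<omega>\<in>space M. real n * (2 * x) \<le> \<bar>(\<Sum>t<n. (W (-1) t \<omega>)\<^sup>2) - (\<Sum>t<n. \<integral>\<omega>. (W (-1) t \<omega>)\<^sup>2 \<partial>M)\<bar>}"
  proof -
    have "(\<Sum>t<n. X t \<omega> * Y t \<omega>) = ((\<Sum>t<n. (W 1 t \<omega>)\<^sup>2) - (\<Sum>t<n. (W (-1) t \<omega>)\<^sup>2)) / 4" for \<omega>
      unfolding W_def by (subst pol) (simp add: sum_divide_distrib[symmetric] sum_subtractf)
    moreover have "(\<Sum>t<n. cov (X t) (Y t)) = ((\<Sum>t<n. \<integral>\<omega>. (W 1 t \<omega>)\<^sup>2 \<partial>M) - (\<Sum>t<n. \<integral>\<omega>. (W (-1) t \<omega>)\<^sup>2 \<partial>M)) / 4"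
      by (simp add: E_pol sum_divide_distrib[symmetric] sum_subtractf)
    ultimately have "(\<Sum>t<n. X t \<omega> * Y t \<omega>) - (\<Sum>t<n. cov (X t) (Y t))
        = (((\<Sum>t<n. (W 1 t \<omega>)\<^sup>2) - (\<Sum>t<n. \<integral>\<omega>. (W 1 t \<omega>)\<^sup>2 \<partial>M))
          - ((\<Sum>t<n. (W (-1) t \<omega>)\<^sup>2) - (\<Sum>t<n. \<integral>\<omega>. (W (-1) t \<omega>)\<^sup>2 \<partial>M))) / 4" for \<omega>
      by (simp add: diff_divide_distrib)
    moreover have "n * (2 * x) \<le> \<bar>p\<bar> \<or> n * (2 * x) \<le> \<bar>q\<bar>" if "n * x \<le> \<bar>(p - q) / 4\<bar>" for p q n :: real
    proof -
      have "\<bar>(p - q) / 4\<bar> \<le> (\<bar>p\<bar> + \<bar>q\<bar>) / 4" by simp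
      then have "4 * (n * x) \<le> \<bar>p\<bar> + \<bar>q\<bar>" using that by (simp add: field_simps)
      then show ?thesis by arith
    qed
    ultimately show ?thesis by (simp only: Un_iff subset_iff mem_Collect_eq) blast
  qed
  then have "prob {\<omega>\<in>space M. real n * x \<le> \<bar>(\<Sum>t<n. X t \<omega> * Y t \<omega>) - (\<Sum>t<n. cov (X t) (Y t))\<bar>}
     \<le> prob (D 1 \<union> D (-1))"
    unfolding D_def[symmetric] by (intro finite_measure_mono sets.Un D_sets)
  also have "\<dots> \<le> prob (D 1) + prob (D (-1))" by (intro measure_Un_le D_sets)
  also have "\<dots> \<le> 2 * exp (- (real n * x\<^sup>2 / (64 * L\<^sup>2))) + 2 * exp (- (real n * x\<^sup>2 / (64 * L\<^sup>2)))"
    unfolding D_def by (intro add_mono tail) auto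
  also have "\<dots> = 4 * exp (- (real n * x\<^sup>2 / (64 * L\<^sup>2)))" by simp
  finally show ?thesis .
qed

section \<open>Almost sure limits of Gaussian variables\<close>

text \<open>
  The characteristic functions \<open>exp (- u\<^sup>2 v\<^sub>N / 2)\<close> converge to that of the limit, which is nonzero near 0.
  A single such \<open>u \<noteq> 0\<close> already forces the variances \<open>v\<^sub>N\<close> to converge.
\<close>

lemma (in prob_space) gaussian_rv_AE_limit:
  fixes X :: "'a \<Rightarrow> real" and Y :: "nat \<Rightarrow> 'a \<Rightarrow> real"
  assumes Y: "\<And>N. gaussian_rv M (Y N)" and X[measurable]: "X \<in> borel_measurable M"
    and lim: "AE \<omega> in M. (\<lambda>N. Y N \<omega>) \<longlonglongrightarrow> X \<omega>"
  shows "gaussian_rv M X" and "(\<lambda>N. \<integral>\<omega>. (Y N \<omega>)\<^sup>2 \<partial>M) \<longlonglongrightarrow> (\<integral>\<omega>. (X \<omega>)\<^sup>2 \<partial>M)"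
proof -
  have Y_meas[measurable]: "Y N \<in> borel_measurable M" for N using Y[of N] by measurable
  define v where "v N = (\<integral>\<omega>. (Y N \<omega>)\<^sup>2 \<partial>M)" for N
  have v0: "v N \<ge> 0" for N by (simp add: v_def)
  define \<phi> where "\<phi> u = (\<integral>\<omega>. iexp (u * X \<omega>) \<partial>M)" for u
  have char_Y: "(\<integral>\<omega>. iexp (u * Y N \<omega>) \<partial>M) = of_real (exp (- (u\<^sup>2 * v N / 2)))" for u N
    using gaussian_rv_cexp(2)[OF Y, of "\<i> * of_real u" N]
    by (simp add: v_def power_mult_distrib exp_of_real[symmetric] mult.assoc)
  have conv: "(\<lambda>N. complex_of_real (exp (- (u\<^sup>2 * v N / 2)))) \<longlonglongrightarrow> \<phi> u" for u
    unfolding char_Y[symmetric] \<phi>_def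
  proof (rule integral_dominated_convergence[where w = "\<lambda>_. 1"])
    show "AE \<omega> in M. (\<lambda>N. iexp (u * Y N \<omega>)) \<longlonglongrightarrow> iexp (u * X \<omega>)"
      using lim by eventually_elim (intro tendsto_intros)
  qed auto
  interpret D: real_distribution "distr M borel X" by simp
  have \<phi>_char: "\<phi> u = char (distr M borel X) u" for u
    unfolding char_def \<phi>_def by (subst integral_distr) auto
  have "((\<lambda>u. norm (\<phi> u)) \<longlongrightarrow> 1) (at 0)"
    using tendsto_norm[OF D.isCont_char[of 0, unfolded isCont_def]] by (simp add: D.char_zero \<phi>_char)
  then have "((\<lambda>u. norm (\<phi> u)) \<longlongrightarrow> 1) (at_right 0)" by (rule filterlim_mono) (auto simp: at_le)
  then have "eventually (\<lambda>u. norm (\<phi> u) > 1 / 2) (at_right 0)" by (rule order_tendstoD) simp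
  moreover have "eventually (\<lambda>u :: real. u > 0) (at_right 0)" by (simp add: eventually_at_right_less)
  ultimately have "eventually (\<lambda>u. norm (\<phi> u) > 1 / 2 \<and> u > 0) (at_right 0)" by eventually_elim simp
  then obtain u where u: "u > 0" "norm (\<phi> u) > 1 / 2"
    using eventually_happens'[OF trivial_limit_at_right_real] by blast
  define \<rho> where "\<rho> = Re (\<phi> u)"
  have lim_\<rho>: "(\<lambda>N. exp (- (u\<^sup>2 * v N / 2))) \<longlonglongrightarrow> \<rho>"
    using tendsto_Re[OF conv[of u]] by (simp add: \<rho>_def)
  have "\<phi> u = of_real \<rho>"
    using LIMSEQ_unique[OF conv[of u] tendsto_of_real[OF lim_\<rho>]] .
  moreover have "\<rho> \<ge> 0" by (rule LIMSEQ_le_const[OF lim_\<rho>]) auto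
  ultimately have \<rho>: "\<rho> > 0" using u by (cases "\<rho> = 0") auto
  define v' where "v' = - 2 * ln \<rho> / u\<^sup>2"
  have "(\<lambda>N. - 2 * ln (exp (- (u\<^sup>2 * v N / 2))) / u\<^sup>2) \<longlonglongrightarrow> v'"
    unfolding v'_def using \<rho> u by (intro tendsto_intros lim_\<rho>) auto
  then have lim_v: "v \<longlonglongrightarrow> v'" using u by simp
  have v'0: "v' \<ge> 0" by (rule LIMSEQ_le_const[OF lim_v]) (use v0 in auto)
  have "\<phi> w = exp (- of_real (w\<^sup>2 * v' / 2))" for w
  proof -
    have "(\<lambda>N. complex_of_real (exp (- (w\<^sup>2 * v N / 2)))) \<longlonglongrightarrow> of_real (exp (- (w\<^sup>2 * v' / 2)))"
      by (intro tendsto_intros lim_v) auto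
    from LIMSEQ_unique[OF conv this] show ?thesis by (simp add: exp_of_real[symmetric])
  qed
  then have *: "gaussian_rv M X \<and> (\<integral>\<omega>. (X \<omega>)\<^sup>2 \<partial>M) = v'"
    using gaussian_rv_iff_char[OF X v'0] by (simp add: \<phi>_def)
  then show "gaussian_rv M X" by simp
  show "(\<lambda>N. \<integral>\<omega>. (Y N \<omega>)\<^sup>2 \<partial>M) \<longlonglongrightarrow> (\<integral>\<omega>. (X \<omega>)\<^sup>2 \<partial>M)"
    using * lim_v unfolding v_def[abs_def] by simp
qed

text \<open>
  Polarization of the convergence of variances.
\<close>

lemma (in prob_space) gaussian_cov_AE_limit:
  fixes X Y :: "'a \<Rightarrow> real" and YN :: "nat \<Rightarrow> 'a \<Rightarrow> real"
  assumes H: "gaussian_space M H" and X: "X \<in> H" and Y: "Y \<in> borel_measurable M" and YN: "\<And>N. YN N \<in> H"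
    and lim: "AE \<omega> in M. (\<lambda>N. YN N \<omega>) \<longlonglongrightarrow> Y \<omega>"
  shows "(\<lambda>N. cov X (YN N)) \<longlonglongrightarrow> (cov X Y)"
proof -
  have XY_meas: "(\<lambda>\<omega>. X \<omega> + Y \<omega>) \<in> borel_measurable M"
    using gaussian_space_rv[OF H X] Y by measurable
  have lim': "AE \<omega> in M. (\<lambda>N. X \<omega> + YN N \<omega>) \<longlonglongrightarrow> X \<omega> + Y \<omega>"
    using lim by eventually_elim (intro tendsto_intros)
  note 1 = gaussian_rv_AE_limit[OF gaussian_space_rv[OF H YN] Y lim]
  note 2 = gaussian_rv_AE_limit[OF gaussian_space_rv[OF H gaussian_space_add[OF H X YN]] XY_meas lim']
  have pol: "(cov X Z) = ((\<integral>\<omega>. (X \<omega> + Z \<omega>)\<^sup>2 \<partial>M) - (\<integral>\<omega>. (X \<omega>)\<^sup>2 \<partial>M) - (\<integral>\<omega>. (Z \<omega>)\<^sup>2 \<partial>M)) / 2"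
    if "gaussian_rv M Z" "gaussian_rv M (\<lambda>\<omega>. X \<omega> + Z \<omega>)" for Z
  proof -
    have int: "integrable M (\<lambda>\<omega>. (X \<omega> + Z \<omega>)\<^sup>2)" "integrable M (\<lambda>\<omega>. (X \<omega>)\<^sup>2)" "integrable M (\<lambda>\<omega>. (Z \<omega>)\<^sup>2)"
      using that gaussian_space_rv[OF H X] by (auto intro: gaussian_rv_square_integrable)
    have "(cov X Z) = (\<integral>\<omega>. ((X \<omega> + Z \<omega>)\<^sup>2 - (X \<omega>)\<^sup>2 - (Z \<omega>)\<^sup>2) / 2 \<partial>M)"
      by (simp add: power2_sum)
    then show ?thesis using int by simp
  qed
  have eqN: "(cov X (YN N)) = ((\<integral>\<omega>. (X \<omega> + YN N \<omega>)\<^sup>2 \<partial>M) - (\<integral>\<omega>. (X \<omega>)\<^sup>2 \<partial>M) - (\<integral>\<omega>. (YN N \<omega>)\<^sup>2 \<partial>M)) / 2" for N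
    by (intro pol gaussian_space_rv[OF H] gaussian_space_add[OF H] X YN)
  have eq: "(cov X Y) = ((\<integral>\<omega>. (X \<omega> + Y \<omega>)\<^sup>2 \<partial>M) - (\<integral>\<omega>. (X \<omega>)\<^sup>2 \<partial>M) - (\<integral>\<omega>. (Y \<omega>)\<^sup>2 \<partial>M)) / 2"
    by (intro pol 1(1) 2(1))
  show ?thesis unfolding eqN eq by (intro tendsto_intros 1(2) 2(2)) auto
qed

section \<open>The Gaussian space spanned by the noise\<close>

context gaussian_var
begin

lemma noise_measurable [measurable]: "i < k \<Longrightarrow> \<epsilon> t i \<in> borel_measurable M"
  using noise_normal by (simp add: multivariate_normal_def)

lemma noise_combination_gaussian: "gaussian_rv M (\<lambda>\<omega>. \<Sum>i<k. u i * \<epsilon> t i \<omega>)"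
proof -
  have "Matrix.vec k u \<in> carrier_vec k" by simp
  then have "distr M borel (\<lambda>\<omega>. \<Sum>i<k. Matrix.vec k u $ i * \<epsilon> t i \<omega>) = centered_normal (Matrix.vec k u \<bullet> (S *\<^sub>v Matrix.vec k u))"
    "Matrix.vec k u \<bullet> (S *\<^sub>v Matrix.vec k u) \<ge> 0"
    using noise_normal[of t] unfolding multivariate_normal_def by blast+
  moreover have "(\<lambda>\<omega>. \<Sum>i<k. Matrix.vec k u $ i * \<epsilon> t i \<omega>) = (\<lambda>\<omega>. \<Sum>i<k. u i * \<epsilon> t i \<omega>)"
    by (auto intro!: sum.cong)
  ultimately show ?thesis unfolding gaussian_rv_def by auto
qed

lemma noise_combination_indep:
  "indep_vars (\<lambda>_. borel) (\<lambda>t \<omega>. \<Sum>i<k. u t i * \<epsilon> t i \<omega>) A"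
proof -
  have "indep_vars (\<lambda>_. borel) (\<lambda>t. (\<lambda>v. \<Sum>i<k. u t i * v i) \<circ> (\<lambda>\<omega>. \<lambda>i\<in>{..<k}. \<epsilon> t i \<omega>)) UNIV"
    unfolding comp_def by (rule indep_vars_compose2[OF noise_indep]) measurable
  then have "indep_vars (\<lambda>_. borel) (\<lambda>t \<omega>. \<Sum>i<k. u t i * \<epsilon> t i \<omega>) UNIV"
    by (simp add: comp_def)
  then show ?thesis by (rule indep_vars_subset) simp
qed

definition noise_sums :: "int set \<Rightarrow> ('a \<Rightarrow> real) set" where
  "noise_sums U = {X. \<exists>A c. finite A \<and> A \<subseteq> U \<and> X = (\<lambda>\<omega>. \<Sum>t\<in>A. \<Sum>i<k. c t i * \<epsilon> t i \<omega>)}"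

text \<open>
  The times in \<open>U\<close> record which noise variables enter.  Disjoint sets of times give orthogonal
  variables, which is the only form of independence used below.
\<close>

definition noise_space :: "int set \<Rightarrow> ('a \<Rightarrow> real) set" where
  "noise_space U = {X \<in> borel_measurable M. \<exists>Y. (\<forall>N. Y N \<in> noise_sums U) \<and> (AE \<omega> in M. (\<lambda>N. Y N \<omega>) \<longlonglongrightarrow> X \<omega>)}"

lemma noise_sums_gaussian:
  assumes "X \<in> noise_sums U" shows "gaussian_rv M X"
proof -
  from assms obtain A c where A: "finite A" and X: "X = (\<lambda>\<omega>. \<Sum>t\<in>A. \<Sum>i<k. c t i * \<epsilon> t i \<omega>)"
    by (auto simp: noise_sums_def)
  define V where "V t = (\<lambda>\<omega>. \<Sum>i<k. c t i * \<epsilon> t i \<omega>)" for t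
  have V: "gaussian_rv M (V t)" for t unfolding V_def by (rule noise_combination_gaussian)
  define v where "v t = (\<integral>\<omega>. (V t \<omega>)\<^sup>2 \<partial>M)" for t
  have [measurable]: "V t \<in> borel_measurable M" for t unfolding V_def by measurable
  have char_V: "char (distr M borel (V t)) u = exp (- of_real (u\<^sup>2 * v t / 2))" for t u
    using gaussian_rv_cexp(2)[OF V, of "\<i> * of_real u" t]
    by (simp add: char_def integral_distr v_def power_mult_distrib mult.assoc)
  show ?thesis
  proof (rule gaussian_rv_iff_char(1))
    show "X \<in> borel_measurable M" unfolding X by measurable
    show "0 \<le> (\<Sum>t\<in>A. v t)" by (intro sum_nonneg) (simp add: v_def)
    fix u
    have "(\<integral>\<omega>. iexp (u * X \<omega>) \<partial>M) = char (distr M borel (\<lambda>\<omega>. \<Sum>t\<in>A. V t \<omega>)) u"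
      by (simp add: X V_def char_def integral_distr)
    also have "\<dots> = (\<Prod>t\<in>A. exp (- of_real (u\<^sup>2 * v t / 2)))"
      unfolding char_V[symmetric] by (rule char_distr_sum) (simp add: V_def noise_combination_indep)
    also have "\<dots> = exp (- of_real (u\<^sup>2 * (\<Sum>t\<in>A. v t) / 2))"
      by (simp add: exp_sum[OF A, symmetric] sum_negf sum_distrib_left sum_divide_distrib)
    finally show "(\<integral>\<omega>. iexp (u * X \<omega>) \<partial>M) = exp (- of_real (u\<^sup>2 * (\<Sum>t\<in>A. v t) / 2))" .
  qed
qed

lemma noise_sums_zero: "(\<lambda>_. 0) \<in> noise_sums U"
  unfolding noise_sums_def by (intro CollectI exI[of _ "{}"]) auto

lemma noise_sums_scale: "X \<in> noise_sums U \<Longrightarrow> (\<lambda>\<omega>. c * X \<omega>) \<in> noise_sums U"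
proof -
  assume "X \<in> noise_sums U"
  then obtain A u where "finite A" "A \<subseteq> U" "X = (\<lambda>\<omega>. \<Sum>t\<in>A. \<Sum>i<k. u t i * \<epsilon> t i \<omega>)"
    by (auto simp: noise_sums_def)
  then show ?thesis unfolding noise_sums_def
    by (intro CollectI exI[of _ A] exI[of _ "\<lambda>t i. c * u t i"]) (auto simp: sum_distrib_left mult.assoc)
qed

lemma noise_sums_add: 
  assumes "X \<in> noise_sums U" "Y \<in> noise_sums U" shows "(\<lambda>\<omega>. X \<omega> + Y \<omega>) \<in> noise_sums U"
proof -
  from assms obtain A u B v where A: "finite A" "A \<subseteq> U" and X: "X = (\<lambda>\<omega>. \<Sum>t\<in>A. \<Sum>i<k. u t i * \<epsilon> t i \<omega>)"
    and B: "finite B" "B \<subseteq> U" and Y: "Y = (\<lambda>\<omega>. \<Sum>t\<in>B. \<Sum>i<k. v t i * \<epsilon> t i \<omega>)"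
    by (auto simp: noise_sums_def)
  define w where "w t i = (if t \<in> A then u t i else 0) + (if t \<in> B then v t i else 0)" for t i
  have "(\<lambda>\<omega>. X \<omega> + Y \<omega>) = (\<lambda>\<omega>. \<Sum>t\<in>A \<union> B. \<Sum>i<k. w t i * \<epsilon> t i \<omega>)"
  proof
    fix \<omega>
    have "X \<omega> = (\<Sum>t\<in>A \<union> B. \<Sum>i<k. (if t \<in> A then u t i else 0) * \<epsilon> t i \<omega>)"
      unfolding X using A B by (intro sum.mono_neutral_cong_left) auto
    moreover have "Y \<omega> = (\<Sum>t\<in>A \<union> B. \<Sum>i<k. (if t \<in> B then v t i else 0) * \<epsilon> t i \<omega>)"
      unfolding Y using A B by (intro sum.mono_neutral_cong_left) auto
    ultimately show "X \<omega> + Y \<omega> = (\<Sum>t\<in>A \<union> B. \<Sum>i<k. w t i * \<epsilon> t i \<omega>)"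
      by (simp add: w_def sum.distrib distrib_right)
  qed
  then show ?thesis using A B unfolding noise_sums_def by blast
qed

lemma noise_sums_mono: "U \<subseteq> V \<Longrightarrow> noise_sums U \<subseteq> noise_sums V"
  unfolding noise_sums_def by blast

lemma noise_space_mono: "U \<subseteq> V \<Longrightarrow> noise_space U \<subseteq> noise_space V"
  unfolding noise_space_def using noise_sums_mono by blast

lemma noise_sums_subset_space: "noise_sums U \<subseteq> noise_space U"
proof
  fix X assume X: "X \<in> noise_sums U"
  show "X \<in> noise_space U" unfolding noise_space_def
    using noise_sums_gaussian[OF X] X by (auto simp: gaussian_rv_def intro!: exI[of _ "\<lambda>_. X"])
qed

lemma gaussian_space_noise: "gaussian_space M (noise_space U)"
proof -
  have "gaussian_rv M X" if "X \<in> noise_space U" for X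
    using that gaussian_rv_AE_limit(1) noise_sums_gaussian unfolding noise_space_def by blast
  moreover have "(\<lambda>_. 0) \<in> noise_space U" using noise_sums_zero noise_sums_subset_space by blast
  moreover have "(\<lambda>\<omega>. X \<omega> + Y \<omega>) \<in> noise_space U" if "X \<in> noise_space U" "Y \<in> noise_space U" for X Y
  proof -
    from that obtain XN YN where XN: "\<And>N. XN N \<in> noise_sums U" "AE \<omega> in M. (\<lambda>N. XN N \<omega>) \<longlonglongrightarrow> X \<omega>"
      and YN: "\<And>N. YN N \<in> noise_sums U" "AE \<omega> in M. (\<lambda>N. YN N \<omega>) \<longlonglongrightarrow> Y \<omega>"
      by (auto simp: noise_space_def)
    have "AE \<omega> in M. (\<lambda>N. XN N \<omega> + YN N \<omega>) \<longlonglongrightarrow> X \<omega> + Y \<omega>"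
      using XN(2) YN(2) by eventually_elim (intro tendsto_intros)
    then show ?thesis using that XN(1) YN(1) unfolding noise_space_def
      by (intro CollectI conjI exI[of _ "\<lambda>N \<omega>. XN N \<omega> + YN N \<omega>"]) (auto intro: noise_sums_add)
  qed
  moreover have "(\<lambda>\<omega>. c * X \<omega>) \<in> noise_space U" if "X \<in> noise_space U" for X c
  proof -
    from that obtain XN where XN: "\<And>N. XN N \<in> noise_sums U" "AE \<omega> in M. (\<lambda>N. XN N \<omega>) \<longlonglongrightarrow> X \<omega>"
      by (auto simp: noise_space_def)
    have "AE \<omega> in M. (\<lambda>N. c * XN N \<omega>) \<longlonglongrightarrow> c * X \<omega>"
      using XN(2) by eventually_elim (intro tendsto_intros)
    then show ?thesis using that XN(1) unfolding noise_space_def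
      by (intro CollectI conjI exI[of _ "\<lambda>N \<omega>. c * XN N \<omega>"]) (auto intro: noise_sums_scale)
  qed
  ultimately show ?thesis unfolding gaussian_space_def by blast
qed

lemma noise_in_sums:
  assumes "i < k" shows "\<epsilon> t i \<in> noise_sums {t}"
  unfolding noise_sums_def
proof (intro CollectI exI[of _ "{t}"] exI[of _ "\<lambda>_ j. of_bool (j = i)"] conjI)
  show "\<epsilon> t i = (\<lambda>\<omega>. \<Sum>t\<in>{t}. \<Sum>j<k. of_bool (j = i) * \<epsilon> t j \<omega>)"
    using assms by (auto simp: of_bool_def if_distrib[of "\<lambda>x. x * _"] cong: if_cong)
qed auto

lemma noise_in_space: "i < k \<Longrightarrow> \<epsilon> t i \<in> noise_space {t}"
  using noise_in_sums noise_sums_subset_space by blast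

text \<open>
  Causality, with the moving average truncated after finitely many terms.
\<close>

lemma process_in_space:
  assumes i: "i < k" shows "y t i \<in> noise_space {..t}"
proof -
  from causal obtain \<Psi> :: "nat \<Rightarrow> real mat" where
    \<Psi>: "\<And>t i. i < k \<Longrightarrow> AE \<omega> in M. (\<lambda>j. \<Sum>m<k. \<Psi> j $$ (i, m) * \<epsilon> (t - int j) m \<omega>) sums y t i \<omega>"
    unfolding causal_process_def by blast
  define Y where "Y N = (\<lambda>\<omega>. \<Sum>j<N. \<Sum>m<k. \<Psi> j $$ (i, m) * \<epsilon> (t - int j) m \<omega>)" for N
  have "Y N \<in> noise_sums {..t}" for N
  proof -
    have "Y N = (\<lambda>\<omega>. \<Sum>s\<in>(\<lambda>j. t - int j) ` {..<N}. \<Sum>m<k. \<Psi> (nat (t - s)) $$ (i, m) * \<epsilon> s m \<omega>)"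
      unfolding Y_def by (subst sum.reindex) (auto simp: inj_on_def)
    then show ?thesis unfolding noise_sums_def
      by (intro CollectI exI[of _ "(\<lambda>j. t - int j) ` {..<N}"] exI[of _ "\<lambda>s m. \<Psi> (nat (t - s)) $$ (i, m)"]) auto
  qed
  moreover have "AE \<omega> in M. (\<lambda>N. Y N \<omega>) \<longlonglongrightarrow> y t i \<omega>"
    using \<Psi>[OF i, of t] by eventually_elim (simp add: sums_def Y_def)
  ultimately show ?thesis using y_measurable[OF i] unfolding noise_space_def by blast
qed

lemma noise_uncorrelated:
  assumes "s \<noteq> t" shows "(\<integral>\<omega>. (\<Sum>i<k. c i * \<epsilon> s i \<omega>) * (\<Sum>i<k. d i * \<epsilon> t i \<omega>) \<partial>M) = 0"
proof -
  let ?u = "\<lambda>r. if r = s then c else d"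
  have int: "integrable M (\<lambda>\<omega>. \<Sum>i<k. u i * \<epsilon> r i \<omega>)" for u r
    by (rule square_integrable_imp_integrable[OF gaussian_rv_measurable[OF noise_combination_gaussian]
        gaussian_rv_square_integrable[OF noise_combination_gaussian]])
  have "(\<integral>\<omega>. (\<Prod>r\<in>{s, t}. \<Sum>i<k. ?u r i * \<epsilon> r i \<omega>) \<partial>M) = (\<Prod>r\<in>{s, t}. \<integral>\<omega>. (\<Sum>i<k. ?u r i * \<epsilon> r i \<omega>) \<partial>M)"
    by (intro indep_vars_lebesgue_integral noise_combination_indep int) auto
  then show ?thesis using assms by (simp add: gaussian_rv_mean[OF noise_combination_gaussian])
qed

lemma noise_sums_orthogonal:
  assumes X: "X \<in> noise_sums U" and Y: "Y \<in> noise_sums V" and disj: "U \<inter> V = {}"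
  shows "(cov X Y) = 0"
proof -
  from X Y obtain A u B v where A: "finite A" "A \<subseteq> U" and X': "X = (\<lambda>\<omega>. \<Sum>t\<in>A. \<Sum>i<k. u t i * \<epsilon> t i \<omega>)"
    and B: "finite B" "B \<subseteq> V" and Y': "Y = (\<lambda>\<omega>. \<Sum>t\<in>B. \<Sum>i<k. v t i * \<epsilon> t i \<omega>)"
    by (auto simp: noise_sums_def)
  have in_sums: "(\<lambda>\<omega>. \<Sum>i<k. w i * \<epsilon> t i \<omega>) \<in> noise_sums UNIV" for w t
    unfolding noise_sums_def by (intro CollectI exI[of _ "{t}"] exI[of _ "\<lambda>_. w"]) auto
  have int: "integrable M (\<lambda>\<omega>. (\<Sum>i<k. u s i * \<epsilon> s i \<omega>) * (\<Sum>i<k. v t i * \<epsilon> t i \<omega>))" for s t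
    using in_sums noise_sums_subset_space by (intro gaussian_space_integrable_mult[OF gaussian_space_noise[of UNIV]]) blast+
  have "(cov X Y) = (\<Sum>s\<in>A. \<Sum>t\<in>B. \<integral>\<omega>. (\<Sum>i<k. u s i * \<epsilon> s i \<omega>) * (\<Sum>i<k. v t i * \<epsilon> t i \<omega>) \<partial>M)"
    unfolding X' Y' sum_product[of _ A] using int by (simp add: Bochner_Integration.integral_sum)
  also have "\<dots> = 0" using A B disj by (intro sum.neutral ballI noise_uncorrelated) blast
  finally show ?thesis .
qed

text \<open>
  Orthogonality passes from finite sums to their limits one factor at a time.
\<close>

lemma noise_space_orthogonal:
  assumes X: "X \<in> noise_space U" and Y: "Y \<in> noise_space V" and disj: "U \<inter> V = {}"
  shows "(cov X Y) = 0"
proof -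
  note H = gaussian_space_noise[of UNIV]
  have sub: "noise_space W \<subseteq> noise_space UNIV" "noise_sums W \<subseteq> noise_space UNIV" for W
    using noise_space_mono[of W UNIV] noise_sums_subset_space[of W] by auto
  from X obtain XN where XN: "\<And>N. XN N \<in> noise_sums U" "AE \<omega> in M. (\<lambda>N. XN N \<omega>) \<longlonglongrightarrow> X \<omega>" "X \<in> borel_measurable M"
    by (auto simp: noise_space_def)
  from Y obtain YN where YN: "\<And>N. YN N \<in> noise_sums V" "AE \<omega> in M. (\<lambda>N. YN N \<omega>) \<longlonglongrightarrow> Y \<omega>" "Y \<in> borel_measurable M"
    by (auto simp: noise_space_def)
  have *: "(cov X0 Y) = 0" if X0: "X0 \<in> noise_sums U" for X0
  proof -
    have "(\<lambda>N. cov X0 (YN N)) \<longlonglongrightarrow> (cov X0 Y)"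
      using X0 YN sub by (intro gaussian_cov_AE_limit[OF H]) blast+
    then show ?thesis unfolding noise_sums_orthogonal[OF X0 YN(1) disj] by (simp add: LIMSEQ_const_iff)
  qed
  have "(\<lambda>N. cov Y (XN N)) \<longlonglongrightarrow> (cov Y X)"
    using Y XN sub by (intro gaussian_cov_AE_limit[OF H]) blast+
  then show ?thesis using *[OF XN(1)] by (simp add: mult.commute LIMSEQ_const_iff)
qed

end

section \<open>Spectral norms and restricted eigenvalues\<close>

lemma sum_lag_coordinate:
  fixes f :: "nat \<Rightarrow> nat \<Rightarrow> real"
  assumes "k > 0"
  shows "(\<Sum>b<k * p. f (b div k) (b mod k)) = (\<Sum>l<p. \<Sum>m<k. f l m)"
proof -
  have "(\<Sum>b<k * p. f (b div k) (b mod k)) = (\<Sum>l<p. \<Sum>b = l * k..<l * k + k. f (b div k) (b mod k))"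
    by (simp add: sum.nat_group mult.commute)
  also have "\<dots> = (\<Sum>l<p. \<Sum>m<k. f l m)"
  proof (rule sum.cong[OF refl])
    fix l
    have "(\<Sum>b = l * k..<l * k + k. f (b div k) (b mod k)) = (\<Sum>m = 0..<k. f ((m + l * k) div k) ((m + l * k) mod k))"
      using sum.shift_bounds_nat_ivl[of "\<lambda>b. f (b div k) (b mod k)" 0 "l * k" k] by (simp add: add.commute)
    also have "\<dots> = (\<Sum>m<k. f l m)" using assms by (intro sum.cong) auto
    finally show "(\<Sum>b = l * k..<l * k + k. f (b div k) (b mod k)) = (\<Sum>m<k. f l m)" .
  qed
  finally show ?thesis .
qed

lemma sum_le_sum_of_inj:
  fixes f :: "'b \<Rightarrow> real"
  assumes "finite B" "inj_on h S" "h ` S \<subseteq> B" "\<And>b. b \<in> B \<Longrightarrow> f b \<ge> 0"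
  shows "(\<Sum>x\<in>S. f (h x)) \<le> (\<Sum>b\<in>B. f b)"
proof -
  have "(\<Sum>x\<in>S. f (h x)) = (\<Sum>b\<in>h ` S. f b)" by (simp add: sum.reindex[OF assms(2)])
  also have "\<dots> \<le> (\<Sum>b\<in>B. f b)" using assms by (intro sum_mono2) auto
  finally show ?thesis .
qed

lemma l2_norm_vec_nonneg: "l2_norm_vec v \<ge> 0"
  by (simp add: l2_norm_vec_def)

lemma l2_norm_vec_power2: "v \<in> carrier_vec n \<Longrightarrow> (l2_norm_vec v)\<^sup>2 = (\<Sum>j<n. (v $ j)\<^sup>2)"
  by (simp add: l2_norm_vec_def L2_set_def sum_nonneg)

lemma abs_vec_index_le_l2_norm: "v \<in> carrier_vec n \<Longrightarrow> i < n \<Longrightarrow> \<bar>v $ i\<bar> \<le> l2_norm_vec v"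
  using member_le_L2_set[of "{..<n}" i "\<lambda>j. \<bar>v $ j\<bar>"] by (simp add: l2_norm_vec_def L2_set_def)

lemma l2_norm_vec_smult: "l2_norm_vec (c \<cdot>\<^sub>v v) = \<bar>c\<bar> * l2_norm_vec v"
  by (simp add: l2_norm_vec_def L2_set_def power_mult_distrib sum_distrib_left[symmetric] real_sqrt_mult)

lemma mult_mat_vec_index: 
  fixes A :: "real mat"
  assumes "A \<in> carrier_mat n m" "v \<in> carrier_vec m" "i < n" shows "(A *\<^sub>v v) $ i = (\<Sum>j<m. A $$ (i, j) * v $ j)"
  using assms by (auto simp: scalar_prod_def atLeast0LessThan intro!: sum.cong)

lemma spectral_norm_bdd_above:
  assumes A: "A \<in> carrier_mat n m"
  shows "bdd_above ((\<lambda>v. l2_norm_vec (A *\<^sub>v v)) ` {v \<in> carrier_vec (dim_col A). l2_norm_vec v \<le> 1})"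
proof (rule bdd_aboveI2)
  fix v assume "v \<in> {v \<in> carrier_vec (dim_col A). l2_norm_vec v \<le> 1}"
  then have v: "v \<in> carrier_vec m" and v1: "l2_norm_vec v \<le> 1" using A by auto
  have "l2_norm_vec (A *\<^sub>v v) \<le> (\<Sum>i<n. \<bar>(A *\<^sub>v v) $ i\<bar>)"
    using A by (simp add: l2_norm_vec_def L2_set_le_sum_abs del: index_mult_mat_vec)
  also have "\<dots> \<le> (\<Sum>i<n. \<Sum>j<m. \<bar>A $$ (i, j)\<bar>)"
  proof (intro sum_mono)
    fix i assume i: "i \<in> {..<n}"
    have "\<bar>(A *\<^sub>v v) $ i\<bar> = \<bar>\<Sum>j<m. A $$ (i, j) * v $ j\<bar>" using mult_mat_vec_index[OF A v] i by simp
    also have "\<dots> \<le> (\<Sum>j<m. \<bar>A $$ (i, j)\<bar> * \<bar>v $ j\<bar>)" by (rule order_trans[OF sum_abs]) (simp add: abs_mult)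
    also have "\<dots> \<le> (\<Sum>j<m. \<bar>A $$ (i, j)\<bar> * 1)"
      using abs_vec_index_le_l2_norm[OF v] v1 by (intro sum_mono mult_left_mono) (auto intro: order_trans)
    finally show "\<bar>(A *\<^sub>v v) $ i\<bar> \<le> (\<Sum>j<m. \<bar>A $$ (i, j)\<bar>)" by simp
  qed
  finally show "l2_norm_vec (A *\<^sub>v v) \<le> (\<Sum>i<n. \<Sum>j<m. \<bar>A $$ (i, j)\<bar>)" .
qed

lemma spectral_norm_nonneg:
  assumes A: "A \<in> carrier_mat n m" shows "spectral_norm A \<ge> 0"
proof -
  have "l2_norm_vec (A *\<^sub>v 0\<^sub>v m) \<le> spectral_norm A"
    unfolding spectral_norm_def using A
    by (intro cSUP_upper spectral_norm_bdd_above[OF A]) (auto simp: l2_norm_vec_def L2_set_def)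
  then show ?thesis using l2_norm_vec_nonneg order_trans by blast
qed

lemma spectral_norm_bound:
  assumes A: "A \<in> carrier_mat n m" and v: "v \<in> carrier_vec m"
  shows "l2_norm_vec (A *\<^sub>v v) \<le> spectral_norm A * l2_norm_vec v"
proof (cases "l2_norm_vec v = 0")
  case True
  have "v $ j = 0" if "j < m" for j
    using abs_vec_index_le_l2_norm[OF v that] True by simp
  then have "v = 0\<^sub>v m" using v by auto
  then have "A *\<^sub>v v = 0\<^sub>v n" using A by auto
  then show ?thesis using True by (simp add: l2_norm_vec_def L2_set_def)
next
  case False
  then have pos: "l2_norm_vec v > 0" using l2_norm_vec_nonneg[of v] by simp
  let ?c = "1 / l2_norm_vec v"
  have "l2_norm_vec (A *\<^sub>v (?c \<cdot>\<^sub>v v)) \<le> spectral_norm A"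
    unfolding spectral_norm_def using A v pos
    by (intro cSUP_upper spectral_norm_bdd_above[OF A]) (auto simp: l2_norm_vec_smult)
  also have "A *\<^sub>v (?c \<cdot>\<^sub>v v) = ?c \<cdot>\<^sub>v (A *\<^sub>v v)" using A v by (rule mult_mat_vec)
  finally show ?thesis using pos by (simp add: l2_norm_vec_smult field_simps)
qed

text \<open>
  The Cauchy-Schwarz inequality and the definition of the spectral norm.
\<close>

lemma quadratic_form_le_spectral_norm:
  assumes A: "A \<in> carrier_mat n n" and v: "v \<in> carrier_vec n"
  shows "v \<bullet> (A *\<^sub>v v) \<le> spectral_norm A * (l2_norm_vec v)\<^sup>2"
proof -
  have "v \<bullet> (A *\<^sub>v v) \<le> (\<Sum>j<n. \<bar>v $ j\<bar> * \<bar>(A *\<^sub>v v) $ j\<bar>)"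
    using A unfolding scalar_prod_def by (auto simp: atLeast0LessThan abs_mult[symmetric] intro!: sum_mono)
  also have "\<dots> \<le> l2_norm_vec v * l2_norm_vec (A *\<^sub>v v)"
    using L2_set_mult_ineq[of "\<lambda>j. v $ j" "\<lambda>j. (A *\<^sub>v v) $ j" "{..<n}"] A v by (auto simp: l2_norm_vec_def)
  also have "\<dots> \<le> l2_norm_vec v * (spectral_norm A * l2_norm_vec v)"
    by (intro mult_left_mono spectral_norm_bound[OF A v] l2_norm_vec_nonneg)
  finally show ?thesis by (simp add: power2_eq_square mult_ac)
qed

lemma quadratic_form_sum:
  fixes A :: "real mat"
  assumes A: "A \<in> carrier_mat n n" and v: "v \<in> carrier_vec n"
  shows "v \<bullet> (A *\<^sub>v v) = (\<Sum>i<n. \<Sum>j<n. v $ i * v $ j * A $$ (i, j))"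
proof -
  have "v \<bullet> (A *\<^sub>v v) = (\<Sum>i<n. v $ i * (A *\<^sub>v v) $ i)"
    using A unfolding scalar_prod_def by (auto simp: atLeast0LessThan)
  also have "\<dots> = (\<Sum>i<n. \<Sum>j<n. v $ i * v $ j * A $$ (i, j))"
    by (intro sum.cong refl) (simp add: mult_mat_vec_index[OF A v] sum_distrib_left mult_ac)
  finally show ?thesis .
qed

text \<open>
  Positive semidefiniteness bounds the quotients below by 0, so that their infimum is a genuine lower
  bound; it also settles the case \<open>\<delta>\<^sub>J = 0\<close>, in which \<open>\<delta>\<close> may be 0 and need not be admissible.
\<close>

lemma restricted_eigenvalue_bound:
  fixes G :: "real mat" and \<delta> :: "nat \<Rightarrow> real"
  assumes G: "G \<in> carrier_mat n n"
    and psd: "\<And>\<delta> :: nat \<Rightarrow> real. (\<Sum>i<n. \<Sum>j<n. \<delta> i * \<delta> j * G $$ (i, j)) \<ge> 0"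
    and d: "d > 0" "d \<le> restricted_eigenvalue G r"
    and J: "J \<subseteq> {..<n}" "card J \<le> r"
    and cone: "(\<Sum>j\<in>{..<n} - J. \<bar>\<delta> j\<bar>) \<le> 3 * (\<Sum>j\<in>J. \<bar>\<delta> j\<bar>)"
  shows "d\<^sup>2 * (\<Sum>j\<in>J. (\<delta> j)\<^sup>2) \<le> (\<Sum>i<n. \<Sum>j<n. \<delta> i * \<delta> j * G $$ (i, j))"
proof (cases "(\<Sum>j\<in>J. (\<delta> j)\<^sup>2) = 0")
  case False
  have finJ: "finite J" using J finite_subset by auto
  define V where "V = {\<delta> \<bullet> (G *\<^sub>v \<delta>) / (L2_set (\<lambda>j. \<delta> $ j) R)\<^sup>2 | R \<delta>.
       R \<subseteq> {..<n} \<and> card R \<le> r \<and> \<delta> \<in> carrier_vec n \<and> \<delta> \<noteq> 0\<^sub>v n \<and>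
       (\<Sum>j\<in>{..<n} - R. \<bar>\<delta> $ j\<bar>) \<le> 3 * (\<Sum>j\<in>R. \<bar>\<delta> $ j\<bar>)}"
  have re: "restricted_eigenvalue G r = sqrt (Inf V)"
    using G by (simp add: restricted_eigenvalue_def V_def)
  have bdd: "bdd_below V"
    unfolding V_def by (intro bdd_belowI[of _ 0]) (auto simp: quadratic_form_sum[OF G] psd)
  let ?v = "Matrix.vec n \<delta>"
  obtain j where j: "j \<in> J" "\<delta> j \<noteq> 0" using False finJ by (auto simp: sum_nonneg_eq_0_iff)
  then have "?v $ j \<noteq> 0" "j < n" using J by auto
  then have "?v \<noteq> 0\<^sub>v n" by (metis index_zero_vec(1))
  moreover have "(\<Sum>j\<in>{..<n} - J. \<bar>?v $ j\<bar>) = (\<Sum>j\<in>{..<n} - J. \<bar>\<delta> j\<bar>)" by (intro sum.cong) auto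
  moreover have "(\<Sum>j\<in>J. \<bar>?v $ j\<bar>) = (\<Sum>j\<in>J. \<bar>\<delta> j\<bar>)" using J by (intro sum.cong) auto
  ultimately have "?v \<bullet> (G *\<^sub>v ?v) / (L2_set (\<lambda>j. ?v $ j) J)\<^sup>2 \<in> V"
    using J cone unfolding V_def by (intro CollectI exI[of _ J] exI[of _ ?v]) simp
  then have "Inf V \<le> ?v \<bullet> (G *\<^sub>v ?v) / (L2_set (\<lambda>j. ?v $ j) J)\<^sup>2" by (rule cInf_lower[OF _ bdd])
  also have "?v \<bullet> (G *\<^sub>v ?v) = (\<Sum>i<n. \<Sum>j<n. \<delta> i * \<delta> j * G $$ (i, j))"
    by (simp add: quadratic_form_sum[OF G])
  also have "(L2_set (\<lambda>j. ?v $ j) J)\<^sup>2 = (\<Sum>j\<in>J. (\<delta> j)\<^sup>2)"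
    using J by (auto simp: L2_set_def sum_nonneg intro!: sum.cong)
  finally have "Inf V \<le> (\<Sum>i<n. \<Sum>j<n. \<delta> i * \<delta> j * G $$ (i, j)) / (\<Sum>j\<in>J. (\<delta> j)\<^sup>2)" .
  moreover have "d\<^sup>2 \<le> Inf V"
  proof -
    have le: "d \<le> sqrt (Inf V)" using d re by simp
    then have "Inf V > 0" using d by (metis less_le_trans real_sqrt_gt_0_iff)
    moreover have "d\<^sup>2 \<le> (sqrt (Inf V))\<^sup>2" using le d by (intro power_mono) auto
    ultimately show ?thesis by simp
  qed
  moreover have "(\<Sum>j\<in>J. (\<delta> j)\<^sup>2) > 0" using False by (simp add: order_less_le sum_nonneg)
  ultimately show ?thesis using order_trans pos_le_divide_eq by blast
qed (use psd in simp)

section \<open>Second moments of the lagged process\<close>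

context gaussian_var
begin

text \<open>
  The coordinates of the stacked regressor \<open>Z\<^sub>t\<close>, indexed as in \<open>lagged\<close>.
\<close>

definition Z :: "int \<Rightarrow> nat \<Rightarrow> 'a \<Rightarrow> real" where
  "Z t a \<omega> = y (t - int (a div k + 1)) (a mod k) \<omega>"

lemma lagged_index: "a < k * p \<Longrightarrow> lagged k p y t \<omega> $ a = Z t a \<omega>"
  by (simp add: lagged_def Z_def)

abbreviation F :: "real mat" where "F \<equiv> companion_mat k p \<Phi>"
abbreviation \<Gamma> :: "real mat" where "\<Gamma> \<equiv> lag_cov M k p y"

lemma F_carrier: "F \<in> carrier_mat (k * p) (k * p)" by (simp add: companion_mat_def)
lemma F_pow_carrier: "F ^\<^sub>m j \<in> carrier_mat (k * p) (k * p)" using F_carrier by simp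
lemma \<Gamma>_carrier: "\<Gamma> \<in> carrier_mat (k * p) (k * p)" by (simp add: lag_cov_def)

lemma \<Gamma>_index: "a < k * p \<Longrightarrow> b < k * p \<Longrightarrow> \<Gamma> $$ (a, b) = (cov (Z 1 a) (Z 1 b))"
  by (simp add: lag_cov_def lagged_index)

lemma Z_in_space: "Z t a \<in> noise_space {..t - 1}"
proof -
  have "y (t - int (a div k + 1)) (a mod k) \<in> noise_space {..t - int (a div k + 1)}"
    using k_pos by (intro process_in_space) simp
  also have "\<dots> \<subseteq> noise_space {..t - 1}" by (rule noise_space_mono) auto
  finally show ?thesis by (simp add: Z_def[abs_def])
qed

lemma noise_space_UNIV: "X \<in> noise_space U \<Longrightarrow> X \<in> noise_space UNIV"
  using noise_space_mono[of U UNIV] by auto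

lemma Z_in_UNIV: "Z t a \<in> noise_space UNIV"
  by (rule noise_space_UNIV[OF Z_in_space])

lemma noise_in_UNIV: "i < k \<Longrightarrow> \<epsilon> t i \<in> noise_space UNIV"
  by (rule noise_space_UNIV[OF noise_in_space])

lemma Z_measurable [measurable]: "Z t a \<in> borel_measurable M"
  using gaussian_space_rv[OF gaussian_space_noise Z_in_UNIV] by (rule gaussian_rv_measurable)

lemma var_equation_lagged:
  assumes i: "i < k"
  shows "AE \<omega> in M. y t i \<omega> = (\<Sum>b<k * p. \<Phi> (b div k + 1) $$ (i, b mod k) * Z t b \<omega>) + \<epsilon> t i \<omega>"
  using var_equation[OF i, of t]
proof eventually_elim
  fix \<omega> assume y: "y t i \<omega> = (\<Sum>l = 1..p. \<Sum>m<k. \<Phi> l $$ (i, m) * y (t - int l) m \<omega>) + \<epsilon> t i \<omega>"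
  have "(\<Sum>b<k * p. \<Phi> (b div k + 1) $$ (i, b mod k) * Z t b \<omega>)
      = (\<Sum>l<p. \<Sum>m<k. \<Phi> (l + 1) $$ (i, m) * y (t - int (l + 1)) m \<omega>)"
    unfolding Z_def using k_pos
    by (intro sum_lag_coordinate[of k "\<lambda>l m. \<Phi> (l + 1) $$ (i, m) * y (t - int (l + 1)) m \<omega>" p]) simp
  also have "\<dots> = (\<Sum>l = 1..p. \<Sum>m<k. \<Phi> l $$ (i, m) * y (t - int l) m \<omega>)"
    by (rule sum.reindex_bij_witness[of _ "\<lambda>l. l - 1" "\<lambda>l. l + 1"]) auto
  finally show "y t i \<omega> = (\<Sum>b<k * p. \<Phi> (b div k + 1) $$ (i, b mod k) * Z t b \<omega>) + \<epsilon> t i \<omega>"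
    using y by simp
qed

text \<open>
  The first \<open>k\<close> rows are the model equations; the other rows shift the lags by one block.
\<close>

lemma Z_step:
  assumes a: "a < k * p"
  shows "AE \<omega> in M. Z (t + 1) a \<omega> = (\<Sum>b<k * p. F $$ (a, b) * Z t b \<omega>) + (if a < k then \<epsilon> t a \<omega> else 0)"
proof (cases "a < k")
  case True
  then show ?thesis using var_equation_lagged[OF True, of t] a
    by (auto simp: Z_def companion_mat_def elim!: eventually_mono)
next
  case False
  have "Z (t + 1) a \<omega> = (\<Sum>b<k * p. F $$ (a, b) * Z t b \<omega>)" for \<omega>
  proof -
    have "(\<Sum>b<k * p. F $$ (a, b) * Z t b \<omega>) = (\<Sum>b<k * p. of_bool (b = a - k) * Z t b \<omega>)"
      using a False by (intro sum.cong) (auto simp: companion_mat_def)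
    also have "\<dots> = Z t (a - k) \<omega>"
      using a False by (auto simp: of_bool_def if_distrib[of "\<lambda>x. x * _"] cong: if_cong)
    also have "\<dots> = Z (t + 1) a \<omega>"
    proof -
      have "a div k = (a - k) div k + 1" "a mod k = (a - k) mod k"
        using False k_pos by (simp_all add: le_div_geq le_mod_geq)
      then show ?thesis by (simp add: Z_def algebra_simps)
    qed
    finally show ?thesis by simp
  qed
  then show ?thesis using False by simp
qed

lemma cov_Z_step:
  assumes a: "a < k * p" and X: "X \<in> noise_space U" and U: "t \<notin> U"
  shows "(cov (Z (t + 1) a) X) = (\<Sum>b<k * p. F $$ (a, b) * (cov (Z t b) X))"
proof -
  note H = gaussian_space_noise[of UNIV]
  have X': "X \<in> noise_space UNIV" by (rule noise_space_UNIV[OF X])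
  have [measurable]: "X \<in> borel_measurable M" using X by (simp add: noise_space_def)
  let ?e = "\<lambda>\<omega>. if a < k then \<epsilon> t a \<omega> else 0" and ?L = "\<lambda>\<omega>. \<Sum>b<k * p. F $$ (a, b) * Z t b \<omega>"
  have e_meas[measurable]: "?e \<in> borel_measurable M" by (cases "a < k") auto
  have L: "?L \<in> noise_space UNIV"
    by (intro gaussian_space_sum[OF H] gaussian_space_scale[OF H] Z_in_UNIV) simp
  have e: "?e \<in> noise_space {t}"
    using noise_in_space[of a t] gaussian_space_zero[OF gaussian_space_noise[of "{t}"]] by (cases "a < k") auto
  have "(cov (Z (t + 1) a) X) = (\<integral>\<omega>. (?L \<omega> + ?e \<omega>) * X \<omega> \<partial>M)"
    by (rule integral_cong_AE) (use Z_step[OF a, of t] in \<open>auto elim!: eventually_mono\<close>)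
  also have "\<dots> = (cov ?L X) + (cov ?e X)"
    unfolding distrib_right
    by (intro Bochner_Integration.integral_add gaussian_space_integrable_mult[OF H] L X' noise_space_UNIV[OF e])
  also have "(cov ?e X) = 0" by (rule noise_space_orthogonal[OF e X]) (use U in auto)
  also have "(cov ?L X) = (\<Sum>b<k * p. F $$ (a, b) * (cov (Z t b) X))"
    by (intro gaussian_space_cov_sum_left[OF H] Z_in_UNIV X') simp
  finally show ?thesis by simp
qed

text \<open>
  Variables \<open>X\<close> from before time \<open>t\<close> are orthogonal to the noise at time \<open>t\<close> and later, so each step in
  time multiplies the vector of covariances with \<open>X\<close> by the companion matrix.
\<close>

lemma cov_Z_power:
  assumes X: "X \<in> noise_space {..<t}"
  shows "Matrix.vec (k * p) (\<lambda>a. cov (Z (t + int j) a) X)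
    = (F ^\<^sub>m j) *\<^sub>v Matrix.vec (k * p) (\<lambda>a. cov (Z t a) X)"
  using X
proof (induction j arbitrary: t)
  case 0
  then show ?case using F_carrier by simp
next
  case (Suc j)
  let ?w = "\<lambda>t. Matrix.vec (k * p) (\<lambda>a. cov (Z t a) X)"
  have X': "X \<in> noise_space {..<t + 1}" using Suc.prems noise_space_mono[of "{..<t}" "{..<t + 1}"] by auto
  have step: "?w (t + 1) = F *\<^sub>v ?w t"
  proof (rule eq_vecI)
    fix a assume "a < dim_vec (F *\<^sub>v ?w t)"
    then have a: "a < k * p" using F_carrier by simp
    show "?w (t + 1) $ a = (F *\<^sub>v ?w t) $ a"
      using cov_Z_step[OF a Suc.prems, of t] mult_mat_vec_index[OF F_carrier, of "?w t" a] a by simp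
  qed (use F_carrier in simp)
  have "?w (t + int (Suc j)) = (F ^\<^sub>m j) *\<^sub>v ?w (t + 1)"
    using Suc.IH[OF X'] by (simp add: add.assoc)
  also have "\<dots> = (F ^\<^sub>m Suc j) *\<^sub>v ?w t"
    unfolding step using assoc_mult_mat_vec[OF F_pow_carrier F_carrier, of "?w t" j] by simp
  finally show ?case .
qed

lemma process_cov_stationary:
  assumes i: "i < k" "j < k"
  shows "(cov (y (t + h) i) (y (s + h) j)) = (cov (y t i) (y s j))"
proof -
  let ?P = "Pi\<^sub>M (UNIV \<times> {..<k}) (\<lambda>_ :: int \<times> nat. borel :: real measure)"
  let ?g = "\<lambda>h \<omega>. \<lambda>(t, i)\<in>UNIV \<times> {..<k}. y (t + h) i \<omega>"
  have g: "?g h \<in> M \<rightarrow>\<^sub>M ?P" for h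
    by (rule measurable_restrict) (auto intro: y_measurable)
  have f[measurable]: "(\<lambda>v. v (t, i) * v (s, j)) \<in> borel_measurable ?P"
    using i by (intro borel_measurable_times measurable_component_singleton) auto
  have "distr M ?P (?g h) = distr M ?P (?g 0)"
    using stationary unfolding stationary_process_def by simp
  then have "(\<integral>v. v (t, i) * v (s, j) \<partial>distr M ?P (?g h)) = (\<integral>v. v (t, i) * v (s, j) \<partial>distr M ?P (?g 0))"
    by simp
  then show ?thesis using i by (simp add: integral_distr[OF g[of h] f] integral_distr[OF g[of 0, simplified] f])
qed

lemma Z_cov: "a < k * p \<Longrightarrow> b < k * p \<Longrightarrow> (cov (Z t a) (Z t b)) = \<Gamma> $$ (a, b)"
  using process_cov_stationary[of "a mod k" "b mod k" "1 - int (a div k + 1)" "t - 1" "1 - int (b div k + 1)"] k_pos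
  by (simp add: \<Gamma>_index Z_def algebra_simps)

lemma \<Gamma>_quadratic_form:
  "(\<Sum>a<k * p. \<Sum>b<k * p. u a * u b * \<Gamma> $$ (a, b)) = (\<integral>\<omega>. (\<Sum>a<k * p. u a * Z t a \<omega>)\<^sup>2 \<partial>M)"
  using gaussian_space_cov_sum[OF gaussian_space_noise[of UNIV], of "{..<k * p}" "Z t" u] Z_in_UNIV
  by (simp add: Z_cov)

lemma \<Gamma>_psd: "(\<Sum>a<k * p. \<Sum>b<k * p. u a * u b * \<Gamma> $$ (a, b)) \<ge> 0"
  unfolding \<Gamma>_quadratic_form[where t = 1] by simp

text \<open>
  For \<open>X = Z\<^sub>t\<^sub>,\<^sub>b\<close> the vector of covariances at time \<open>t\<close> is column \<open>b\<close> of \<open>\<Gamma>\<close>.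
\<close>

lemma abs_cov_Z_le:
  assumes a: "a < k * p" and b: "b < k * p"
  shows "\<bar>cov (Z (t + int j) a) (Z t b)\<bar> \<le> spectral_norm (F ^\<^sub>m j) * spectral_norm \<Gamma>"
proof -
  let ?w = "\<lambda>t'. Matrix.vec (k * p) (\<lambda>a. cov (Z t' a) (Z t b))"
  have "Z t b \<in> noise_space {..<t}" by (rule subsetD[OF noise_space_mono Z_in_space]) auto
  from cov_Z_power[OF this, of j] have w: "?w (t + int j) = F ^\<^sub>m j *\<^sub>v ?w t" .
  have "?w t = \<Gamma> *\<^sub>v unit_vec (k * p) b"
  proof (rule eq_vecI)
    fix c assume "c < dim_vec (\<Gamma> *\<^sub>v unit_vec (k * p) b)"
    then have c: "c < k * p" using \<Gamma>_carrier by simp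
    then show "?w t $ c = (\<Gamma> *\<^sub>v unit_vec (k * p) b) $ c"
      using \<Gamma>_carrier b by (simp add: Z_cov scalar_prod_right_unit[of b "k * p" "row \<Gamma> c"])
  qed (use \<Gamma>_carrier in simp)
  moreover have "l2_norm_vec (unit_vec (k * p) b) = 1"
    using b by (simp add: l2_norm_vec_def L2_set_def if_distrib[of "\<lambda>x. x\<^sup>2"] cong: if_cong)
  ultimately have "l2_norm_vec (?w t) \<le> spectral_norm \<Gamma>"
    using spectral_norm_bound[OF \<Gamma>_carrier, of "unit_vec (k * p) b"] by simp
  then have "l2_norm_vec (?w (t + int j)) \<le> spectral_norm (F ^\<^sub>m j) * spectral_norm \<Gamma>"
    unfolding w
    by (intro order_trans[OF spectral_norm_bound[OF F_pow_carrier] mult_left_mono] spectral_norm_nonneg[OF F_pow_carrier]) auto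
  then show ?thesis using abs_vec_index_le_l2_norm[of "?w (t + int j)" "k * p" a] a by simp
qed

text \<open>
  Let \<open>w\<close> be the vector of covariances and \<open>V = w \<bullet> Z\<^sub>t\<close>.  Then \<open>E V X = |w|\<^sup>2\<close> while
  \<open>E V\<^sup>2 = w' \<Gamma> w \<le> \<parallel>\<Gamma>\<parallel> |w|\<^sup>2\<close>; expanding \<open>0 \<le> E (\<parallel>\<Gamma>\<parallel> X - V)\<^sup>2\<close> gives the claim.
\<close>

lemma l2_norm_cov_Z_le:
  assumes X: "X \<in> noise_space UNIV" and pos: "spectral_norm \<Gamma> > 0"
  shows "l2_norm_vec (Matrix.vec (k * p) (\<lambda>a. cov (Z t a) X)) \<le> sqrt (spectral_norm \<Gamma> * (\<integral>\<omega>. (X \<omega>)\<^sup>2 \<partial>M))"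
proof -
  note H = gaussian_space_noise[of UNIV]
  define w where "w = Matrix.vec (k * p) (\<lambda>a. cov (Z t a) X)"
  have w: "w \<in> carrier_vec (k * p)" by (simp add: w_def)
  define g where "g = spectral_norm \<Gamma>"
  define V where "V = (\<lambda>\<omega>. \<Sum>a<k * p. w $ a * Z t a \<omega>)"
  have V: "V \<in> noise_space UNIV" unfolding V_def
    by (intro gaussian_space_sum[OF H] gaussian_space_scale[OF H] Z_in_UNIV) simp
  have VX: "(cov V X) = (l2_norm_vec w)\<^sup>2"
    unfolding V_def l2_norm_vec_power2[OF w]
    by (subst gaussian_space_cov_sum_left[OF H]) (auto simp: Z_in_UNIV X w_def power2_eq_square)
  have VV: "(cov V V) \<le> g * (l2_norm_vec w)\<^sup>2"
    using quadratic_form_le_spectral_norm[OF \<Gamma>_carrier w] \<Gamma>_quadratic_form[of "\<lambda>a. w $ a" t]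
    unfolding quadratic_form_sum[OF \<Gamma>_carrier w] g_def V_def by (simp add: power2_eq_square)
  have int: "integrable M (\<lambda>\<omega>. X \<omega> * X \<omega>)" "integrable M (\<lambda>\<omega>. V \<omega> * X \<omega>)" "integrable M (\<lambda>\<omega>. V \<omega> * V \<omega>)"
    by (intro gaussian_space_integrable_mult[OF H] X V)+
  (* This multiple of X avoids a division by E V^2, which may be 0. *)
  have "0 \<le> (\<integral>\<omega>. (g * X \<omega> - V \<omega>)\<^sup>2 \<partial>M)" by simp
  also have "(\<lambda>\<omega>. (g * X \<omega> - V \<omega>)\<^sup>2) = (\<lambda>\<omega>. g\<^sup>2 * (X \<omega> * X \<omega>) - 2 * g * (V \<omega> * X \<omega>) + V \<omega> * V \<omega>)"
    by (auto simp: power2_eq_square algebra_simps)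
  also have "(\<integral>\<omega>. g\<^sup>2 * (X \<omega> * X \<omega>) - 2 * g * (V \<omega> * X \<omega>) + V \<omega> * V \<omega> \<partial>M)
     = g\<^sup>2 * (cov X X) - 2 * g * (l2_norm_vec w)\<^sup>2 + (cov V V)"
    using int by (simp add: VX)
  also have "\<dots> \<le> g * (g * (cov X X) - (l2_norm_vec w)\<^sup>2)"
    using VV by (simp add: power2_eq_square algebra_simps)
  finally have "(l2_norm_vec w)\<^sup>2 \<le> g * (cov X X)"
    using pos by (simp add: g_def zero_le_mult_iff)
  then show ?thesis unfolding w_def[symmetric] g_def power2_eq_square[symmetric]
    by (simp add: real_le_rsqrt power2_eq_square)
qed

lemma abs_cov_Z_noise_le:
  assumes a: "a < k * p" and i: "i < k" and pos: "spectral_norm \<Gamma> > 0"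
  shows "\<bar>cov (Z (t + 1 + int j) a) (\<epsilon> t i)\<bar>
    \<le> spectral_norm (F ^\<^sub>m j) * sqrt (spectral_norm \<Gamma> * (\<integral>\<omega>. (\<epsilon> t i \<omega>)\<^sup>2 \<partial>M))"
proof -
  let ?w = "\<lambda>t'. Matrix.vec (k * p) (\<lambda>a. cov (Z t' a) (\<epsilon> t i))"
  have "\<epsilon> t i \<in> noise_space {..<t + 1}"
    using noise_in_space[OF i, of t] noise_space_mono[of "{t}" "{..<t + 1}"] by auto
  from cov_Z_power[OF this, of j] have w: "?w (t + 1 + int j) = F ^\<^sub>m j *\<^sub>v ?w (t + 1)" .
  have "l2_norm_vec (?w (t + 1 + int j)) \<le> spectral_norm (F ^\<^sub>m j) * sqrt (spectral_norm \<Gamma> * (\<integral>\<omega>. (\<epsilon> t i \<omega>)\<^sup>2 \<partial>M))"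
    unfolding w using l2_norm_cov_Z_le[OF noise_in_UNIV[OF i] pos, of "t + 1" t]
    by (intro order_trans[OF spectral_norm_bound[OF F_pow_carrier] mult_left_mono] spectral_norm_nonneg[OF F_pow_carrier]) auto
  then show ?thesis using abs_vec_index_le_l2_norm[of "?w (t + 1 + int j)" "k * p" a] a by simp
qed

lemma cov_Z_noise_zero:
  assumes i: "i < k" and "s \<le> t" shows "(cov (Z s a) (\<epsilon> t i)) = 0"
  by (rule noise_space_orthogonal[OF Z_in_space noise_in_space[OF i]]) (use assms in auto)

lemma noise_variance_constant:
  assumes i: "i < k" shows "(\<integral>\<omega>. (\<epsilon> t i \<omega>)\<^sup>2 \<partial>M) = (\<integral>\<omega>. (\<epsilon> s i \<omega>)\<^sup>2 \<partial>M)"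
proof -
  have u: "unit_vec k i \<in> carrier_vec k" by simp
  have eq: "(\<lambda>\<omega>. \<Sum>j<k. (unit_vec k i :: real vec) $ j * \<epsilon> t j \<omega>) = \<epsilon> t i" for t
    using i by (auto simp: if_distrib[of "\<lambda>x. x * _"] cong: if_cong)
  have "distr M borel (\<epsilon> t i) = distr M borel (\<epsilon> s i)"
    using noise_normal[of t] noise_normal[of s] u eq[of t] eq[of s] unfolding multivariate_normal_def by metis
  then have "(\<integral>x. x\<^sup>2 \<partial>distr M borel (\<epsilon> t i)) = (\<integral>x. x\<^sup>2 \<partial>distr M borel (\<epsilon> s i))" by simp
  then show ?thesis using i by (simp add: integral_distr)
qed

lemma max_sd_bounds:
  assumes i: "i < k"
  shows "(\<integral>\<omega>. (y t i \<omega>)\<^sup>2 \<partial>M) \<le> (max_sd M k \<epsilon> y)\<^sup>2" "(\<integral>\<omega>. (\<epsilon> t i \<omega>)\<^sup>2 \<partial>M) \<le> (max_sd M k \<epsilon> y)\<^sup>2"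
    "max_sd M k \<epsilon> y \<ge> 0"
proof -
  have le: "max (sqrt (variance (y 1 i))) (sqrt (variance (\<epsilon> 1 i))) \<le> max_sd M k \<epsilon> y"
    unfolding max_sd_def using i by (intro Max_ge) auto
  have vy: "variance (y 1 i) = (\<integral>\<omega>. (y 1 i \<omega>)\<^sup>2 \<partial>M)"
    by (simp add: gaussian_rv_mean[OF gaussian_space_rv[OF gaussian_space_noise process_in_space[OF i]]])
  have ve: "variance (\<epsilon> 1 i) = (\<integral>\<omega>. (\<epsilon> 1 i \<omega>)\<^sup>2 \<partial>M)"
    by (simp add: gaussian_rv_mean[OF gaussian_space_rv[OF gaussian_space_noise noise_in_space[OF i]]])
  have "(\<integral>\<omega>. (y 1 i \<omega>)\<^sup>2 \<partial>M) \<le> (max_sd M k \<epsilon> y)\<^sup>2" "(\<integral>\<omega>. (\<epsilon> 1 i \<omega>)\<^sup>2 \<partial>M) \<le> (max_sd M k \<epsilon> y)\<^sup>2"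
    using le unfolding vy ve by (simp_all add: sqrt_le_D)
  moreover have "(\<integral>\<omega>. (y t i \<omega>)\<^sup>2 \<partial>M) = (\<integral>\<omega>. (y 1 i \<omega>)\<^sup>2 \<partial>M)"
    using process_cov_stationary[OF i i, of 1 "t - 1" 1] by (simp add: power2_eq_square)
  ultimately show "(\<integral>\<omega>. (y t i \<omega>)\<^sup>2 \<partial>M) \<le> (max_sd M k \<epsilon> y)\<^sup>2" "(\<integral>\<omega>. (\<epsilon> t i \<omega>)\<^sup>2 \<partial>M) \<le> (max_sd M k \<epsilon> y)\<^sup>2"
    using noise_variance_constant[OF i, of t 1] by auto
  have "0 \<le> sqrt (variance (y 1 i))" by (intro real_sqrt_ge_zero integral_nonneg) auto
  then show "max_sd M k \<epsilon> y \<ge> 0" using le by linarith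
qed

end

section \<open>The error of all equations at a fixed sample size\<close>

context gaussian_var
begin

lemma lasso_objective_sum:
  assumes "\<beta> \<in> carrier_vec (k * p)"
  shows "lasso_objective (design_mat T k p y \<omega>) (response_vec T y i \<omega>) l \<beta>
    = (\<Sum>r<T. (y (int T - int r) i \<omega> - (\<Sum>j<k * p. Z (int T - int r) j \<omega> * \<beta> $ j))\<^sup>2) / T + 2 * l * (\<Sum>j<k * p. \<bar>\<beta> $ j\<bar>)"
proof -
  have X: "design_mat T k p y \<omega> \<in> carrier_mat T (k * p)" by (simp add: design_mat_def)
  have v: "response_vec T y i \<omega> - design_mat T k p y \<omega> *\<^sub>v \<beta> \<in> carrier_vec T"
    using mult_mat_vec_carrier[OF X assms] by (intro minus_carrier_vec) (auto simp: response_vec_def)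
  have "(l2_norm_vec (response_vec T y i \<omega> - design_mat T k p y \<omega> *\<^sub>v \<beta>))\<^sup>2
     = (\<Sum>r<T. (y (int T - int r) i \<omega> - (\<Sum>j<k * p. Z (int T - int r) j \<omega> * \<beta> $ j))\<^sup>2)"
    unfolding l2_norm_vec_power2[OF v]
  proof (intro sum.cong refl)
    fix r assume r: "r \<in> {..<T}"
    have "(response_vec T y i \<omega> - design_mat T k p y \<omega> *\<^sub>v \<beta>) $ r
        = y (int T - int r) i \<omega> - (design_mat T k p y \<omega> *\<^sub>v \<beta>) $ r"
      using r X by (simp add: response_vec_def del: index_mult_mat_vec)
    also have "(design_mat T k p y \<omega> *\<^sub>v \<beta>) $ r = (\<Sum>j<k * p. Z (int T - int r) j \<omega> * \<beta> $ j)"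
      using mult_mat_vec_index[OF X assms, of r] r by (simp add: design_mat_def lagged_index)
    finally show "((response_vec T y i \<omega> - design_mat T k p y \<omega> *\<^sub>v \<beta>) $ r)\<^sup>2
       = (y (int T - int r) i \<omega> - (\<Sum>j<k * p. Z (int T - int r) j \<omega> * \<beta> $ j))\<^sup>2" by simp
  qed
  then show ?thesis using assms
    by (simp add: lasso_objective_def response_vec_def l1_norm_vec_def)
qed

lemma kp_pos: "0 < k * p"
  using k_pos p_pos by simp

text \<open>
  The covariance at time distance \<open>j\<close> is at most \<open>\<parallel>F\<^sup>j\<parallel> \<parallel>\<Gamma>\<parallel>\<close>, and each distance occurs at most twice
  in a row: once in the past and once in the future.
\<close>

lemma row_sum_Z:
  assumes a: "a < k * p" and b: "b < k * p" and r: "r < T"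
    and K: "spectral_norm \<Gamma> * (\<Sum>j = 0..T. spectral_norm (F ^\<^sub>m j)) \<le> K"
  shows "(\<Sum>r'<T. \<bar>cov (Z (int T - int r) a) (Z (int T - int r') b)\<bar>) \<le> 2 * K"
proof -
  define f where "f j = spectral_norm (F ^\<^sub>m j) * spectral_norm \<Gamma>" for j
  have f0: "f j \<ge> 0" for j
    unfolding f_def by (intro mult_nonneg_nonneg spectral_norm_nonneg[OF F_pow_carrier] spectral_norm_nonneg[OF \<Gamma>_carrier])
  have f_sum: "(\<Sum>j = 0..T. f j) \<le> K" using K by (simp add: f_def sum_distrib_left mult.commute)
  have "(\<Sum>r'<T. \<bar>cov (Z (int T - int r) a) (Z (int T - int r') b)\<bar>)
     \<le> (\<Sum>r'<T. (if r' \<le> r then f (r - r') else 0) + (if r \<le> r' then f (r' - r) else 0))"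
  proof (intro sum_mono)
    fix r'
    consider "r' \<le> r" | "r \<le> r'" by linarith
    then show "\<bar>cov (Z (int T - int r) a) (Z (int T - int r') b)\<bar>
       \<le> (if r' \<le> r then f (r - r') else 0) + (if r \<le> r' then f (r' - r) else 0)"
    proof cases
      case 1
      then have t: "int T - int r' = int T - int r + int (r - r')" by simp
      have "\<bar>cov (Z (int T - int r) a) (Z (int T - int r') b)\<bar> \<le> f (r - r')"
        unfolding t f_def mult.commute[of "Z (int T - int r) a _"] by (rule abs_cov_Z_le[OF b a])
      then show ?thesis using 1 f0[of "r' - r"] by auto
    next
      case 2
      then have t: "int T - int r = int T - int r' + int (r' - r)" by simp
      have "\<bar>cov (Z (int T - int r) a) (Z (int T - int r') b)\<bar> \<le> f (r' - r)"
        unfolding t f_def by (rule abs_cov_Z_le[OF a b])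
      then show ?thesis using 2 f0[of "r - r'"] by auto
    qed
  qed
  also have "\<dots> = (\<Sum>r'\<in>{r'\<in>{..<T}. r' \<le> r}. f (r - r')) + (\<Sum>r'\<in>{r'\<in>{..<T}. r \<le> r'}. f (r' - r))"
    by (simp add: sum.distrib sum.inter_filter[symmetric])
  also have "\<dots> \<le> K + K"
    using r by (intro add_mono order_trans[OF sum_le_sum_of_inj[of "{0..T}"] f_sum] f0) (auto simp: inj_on_def)
  finally show ?thesis by simp
qed

lemma row_sum_noise:
  assumes i: "i < k" and r: "r < T"
  shows "(\<Sum>r'<T. \<bar>cov (\<epsilon> (int T - int r) i) (\<epsilon> (int T - int r') i)\<bar>) \<le> (max_sd M k \<epsilon> y)\<^sup>2"
proof -
  have "(\<Sum>r'<T. \<bar>cov (\<epsilon> (int T - int r) i) (\<epsilon> (int T - int r') i)\<bar>)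
      = (\<Sum>r'<T. if r' = r then \<integral>\<omega>. (\<epsilon> (int T - int r) i \<omega>)\<^sup>2 \<partial>M else 0)"
  proof (intro sum.cong refl)
    fix r'
    have "(cov (\<epsilon> (int T - int r) i) (\<epsilon> (int T - int r') i)) = 0" if "r' \<noteq> r"
      by (rule noise_space_orthogonal[OF noise_in_space[OF i] noise_in_space[OF i]]) (use that in auto)
    then show "\<bar>cov (\<epsilon> (int T - int r) i) (\<epsilon> (int T - int r') i)\<bar>
       = (if r' = r then \<integral>\<omega>. (\<epsilon> (int T - int r) i \<omega>)\<^sup>2 \<partial>M else 0)"
      by (simp add: power2_eq_square)
  qed
  then show ?thesis using r max_sd_bounds(2)[OF i] by simp
qed

text \<open>
  The regressor is correlated with earlier noise only, and the correlation decays like \<open>\<parallel>F\<^sup>j\<parallel>\<close>.  The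
  hypothesis controls \<open>\<parallel>\<Gamma>\<parallel> \<Sum> \<parallel>F\<^sup>j\<parallel>\<close> whereas the decay carries the factor \<open>\<parallel>\<Gamma>\<parallel>\<^bsup>1/2\<^esup>\<close>; the lower bound
  \<open>d\<^sup>2 \<le> \<parallel>\<Gamma>\<parallel>\<close> turns the latter into \<open>\<parallel>\<Gamma>\<parallel> / d\<close>.
\<close>

lemma row_sum_noise_Z:
  assumes a: "a < k * p" and i: "i < k" and r: "r < T"
    and K: "spectral_norm \<Gamma> * (\<Sum>j = 0..T. spectral_norm (F ^\<^sub>m j)) \<le> K"
    and d: "d > 0" "d\<^sup>2 \<le> spectral_norm \<Gamma>"
  shows "(\<Sum>r'<T. \<bar>cov (\<epsilon> (int T - int r) i) (Z (int T - int r') a)\<bar>) \<le> max_sd M k \<epsilon> y * K / d" (is ?row)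
    and "(\<Sum>r'<T. \<bar>cov (Z (int T - int r) a) (\<epsilon> (int T - int r') i)\<bar>) \<le> max_sd M k \<epsilon> y * K / d" (is ?col)
proof -
  define \<sigma> where "\<sigma> = max_sd M k \<epsilon> y"
  have \<sigma>0: "\<sigma> \<ge> 0" using max_sd_bounds(3)[OF i] by (simp add: \<sigma>_def)
  have pos: "spectral_norm \<Gamma> > 0" using d by (meson less_le_trans zero_less_power)
  define g where "g j = spectral_norm (F ^\<^sub>m j) * (spectral_norm \<Gamma> / d * \<sigma>)" for j
  have g0: "g j \<ge> 0" for j
    unfolding g_def using pos d \<sigma>0 by (intro mult_nonneg_nonneg spectral_norm_nonneg[OF F_pow_carrier]) auto
  have "(\<Sum>j = 0..T. g j) = spectral_norm \<Gamma> * (\<Sum>j = 0..T. spectral_norm (F ^\<^sub>m j)) * (\<sigma> / d)"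
    by (simp only: g_def sum_distrib_right[symmetric]) simp
  also have "\<dots> \<le> K * (\<sigma> / d)" using d \<sigma>0 by (intro mult_right_mono K) auto
  finally have g_sum: "(\<Sum>j = 0..T. g j) \<le> \<sigma> * K / d" by (simp add: mult.commute)
  have bound: "\<bar>cov (Z (int T - int s) a) (\<epsilon> (int T - int s') i)\<bar> \<le> (if s < s' then g (s' - s - 1) else 0)" for s s'
  proof (cases "s < s'")
    case True
    then have t: "int T - int s = int T - int s' + 1 + int (s' - s - 1)" by simp
    have "sqrt (spectral_norm \<Gamma> * (\<integral>\<omega>. (\<epsilon> (int T - int s') i \<omega>)\<^sup>2 \<partial>M)) \<le> spectral_norm \<Gamma> / d * \<sigma>"
    proof (rule real_le_lsqrt)
      have "spectral_norm \<Gamma> * (\<integral>\<omega>. (\<epsilon> (int T - int s') i \<omega>)\<^sup>2 \<partial>M) \<le> spectral_norm \<Gamma> * \<sigma>\<^sup>2"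
        using max_sd_bounds(2)[OF i] pos by (intro mult_left_mono) (auto simp: \<sigma>_def)
      also have "\<dots> \<le> spectral_norm \<Gamma> * (spectral_norm \<Gamma> / d\<^sup>2) * \<sigma>\<^sup>2"
      proof -
        have "1 \<le> spectral_norm \<Gamma> / d\<^sup>2" using d by simp
        then have "spectral_norm \<Gamma> * 1 \<le> spectral_norm \<Gamma> * (spectral_norm \<Gamma> / d\<^sup>2)" using pos by (intro mult_left_mono) auto
        then show ?thesis by (intro mult_right_mono) auto
      qed
      also have "\<dots> = (spectral_norm \<Gamma> / d * \<sigma>)\<^sup>2" by (simp add: power2_eq_square)
      finally show "spectral_norm \<Gamma> * (\<integral>\<omega>. (\<epsilon> (int T - int s') i \<omega>)\<^sup>2 \<partial>M) \<le> (spectral_norm \<Gamma> / d * \<sigma>)\<^sup>2" .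
    qed (use pos d \<sigma>0 in auto)
    then have "spectral_norm (F ^\<^sub>m (s' - s - 1)) * sqrt (spectral_norm \<Gamma> * (\<integral>\<omega>. (\<epsilon> (int T - int s') i \<omega>)\<^sup>2 \<partial>M)) \<le> g (s' - s - 1)"
      unfolding g_def by (intro mult_left_mono spectral_norm_nonneg[OF F_pow_carrier])
    then show ?thesis
      using order_trans[OF abs_cov_Z_noise_le[OF a i pos, of "int T - int s'" "s' - s - 1"]] True
      unfolding t by simp
  next
    case False
    then show ?thesis using cov_Z_noise_zero[OF i, of "int T - int s" "int T - int s'" a] by simp
  qed
  have "(\<Sum>r'<T. \<bar>cov (\<epsilon> (int T - int r) i) (Z (int T - int r') a)\<bar>)
     \<le> (\<Sum>r'<T. if r' < r then g (r - r' - 1) else 0)"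
    using bound by (intro sum_mono) (simp add: mult.commute[of "\<epsilon> _ _ _"])
  also have "\<dots> = (\<Sum>r'\<in>{r'\<in>{..<T}. r' < r}. g (r - r' - 1))" by (rule sum.inter_filter[symmetric]) simp
  also have "\<dots> \<le> \<sigma> * K / d"
    using r by (intro order_trans[OF sum_le_sum_of_inj[of "{0..T}" "\<lambda>r'. r - r' - 1"] g_sum] g0) (auto simp: inj_on_def)
  finally show ?row by (simp add: \<sigma>_def)
  have "(\<Sum>r'<T. \<bar>cov (Z (int T - int r) a) (\<epsilon> (int T - int r') i)\<bar>)
     \<le> (\<Sum>r'<T. if r < r' then g (r' - r - 1) else 0)"
    using bound by (intro sum_mono) simp
  also have "\<dots> = (\<Sum>r'\<in>{r'\<in>{..<T}. r < r'}. g (r' - r - 1))" by (rule sum.inter_filter[symmetric]) simp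
  also have "\<dots> \<le> \<sigma> * K / d"
    using r by (intro order_trans[OF sum_le_sum_of_inj[of "{0..T}" "\<lambda>r'. r' - r - 1"] g_sum] g0) (auto simp: inj_on_def)
  finally show ?col by (simp add: \<sigma>_def)
qed

text \<open>
  A coordinate vector supported on \<open>R = {a}\<close> is admissible in the restricted eigenvalue.
\<close>

lemma \<Gamma>_diagonal_ge:
  assumes d: "d > 0" "d \<le> restricted_eigenvalue \<Gamma> r" and r: "r \<ge> 1" and a: "a < k * p"
  shows "d\<^sup>2 \<le> \<Gamma> $$ (a, a)"
proof -
  have "d\<^sup>2 * (\<Sum>j\<in>{a}. (of_bool (j = a))\<^sup>2) \<le> (\<Sum>i<k * p. \<Sum>j<k * p. of_bool (i = a) * of_bool (j = a) * \<Gamma> $$ (i, j))"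
    using r a by (intro restricted_eigenvalue_bound[OF \<Gamma>_carrier \<Gamma>_psd d]) auto
  also have "\<dots> = \<Gamma> $$ (a, a)"
    using a by (simp add: of_bool_def if_distrib[of "\<lambda>x. x * _"] if_distrib[of "\<lambda>x. _ * x"] cong: if_cong)
  finally show ?thesis by simp
qed


lemma spectral_norm_\<Gamma>_ge:
  assumes d: "d > 0" "d \<le> restricted_eigenvalue \<Gamma> r" and r: "r \<ge> 1"
  shows "d\<^sup>2 \<le> spectral_norm \<Gamma>"
proof -
  let ?e = "unit_vec (k * p) 0 :: real vec"
  have "l2_norm_vec ?e = 1"
    using kp_pos by (simp add: l2_norm_vec_def L2_set_def if_distrib[of "\<lambda>x. x\<^sup>2"] cong: if_cong)
  moreover have "?e \<bullet> (\<Gamma> *\<^sub>v ?e) = \<Gamma> $$ (0, 0)"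
    using kp_pos \<Gamma>_carrier by (simp add: scalar_prod_left_unit[of _ "k * p"] scalar_prod_right_unit[of _ "k * p"])
  ultimately show ?thesis
    using \<Gamma>_diagonal_ge[OF d r kp_pos] quadratic_form_le_spectral_norm[OF \<Gamma>_carrier, of ?e] by simp
qed

text \<open>
  Keeps the penalty away from 0: it is proportional to the square of the largest standard deviation.
\<close>

lemma max_sd_ge:
  assumes d: "d > 0" "d \<le> restricted_eigenvalue \<Gamma> r" and r: "r \<ge> 1"
  shows "d \<le> max_sd M k \<epsilon> y"
proof -
  have k0: "0 < k" using k_pos by simp
  have "d\<^sup>2 \<le> (\<integral>\<omega>. (y 0 0 \<omega>)\<^sup>2 \<partial>M)"
    using \<Gamma>_diagonal_ge[OF d r kp_pos] \<Gamma>_index[OF kp_pos kp_pos] by (simp add: Z_def power2_eq_square)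
  also have "\<dots> \<le> (max_sd M k \<epsilon> y)\<^sup>2" by (rule max_sd_bounds(1)[OF k0])
  finally show ?thesis using max_sd_bounds(3)[OF k0] power2_le_imp_le by blast
qed

text \<open>
  The two terms are the union bounds over the \<open>(k p)\<^sup>2\<close> entries of the Gram matrix and over the \<open>k\<^sup>2 p\<close>
  pairs of a noise coordinate and a regressor.  Outside these events, and almost surely where the model
  equations hold, the deterministic bound applies to every equation.
\<close>

lemma lasso_total_error_prob:
  fixes b :: "nat \<Rightarrow> 'a \<Rightarrow> real vec" and T s :: nat
  assumes T: "T \<ge> 1" and d: "d > 0"
    and re: "\<And>i. i < k \<Longrightarrow> d \<le> restricted_eigenvalue \<Gamma> (sparsity k p \<Phi> i)"
    and sparse: "\<And>i. i < k \<Longrightarrow> 1 \<le> sparsity k p \<Phi> i" "\<And>i. i < k \<Longrightarrow> sparsity k p \<Phi> i \<le> s"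
    and K: "spectral_norm \<Gamma> * (\<Sum>j = 0..T. spectral_norm (F ^\<^sub>m j)) \<le> K"
    and L: "2 * K \<le> L" "(max_sd M k \<epsilon> y)\<^sup>2 \<le> L" "max_sd M k \<epsilon> y * K / d \<le> L"
    and q: "0 < q" "q \<le> L" "32 * q * s \<le> d\<^sup>2" and \<mu>: "0 < \<mu>" "\<mu> \<le> L"
    and l: "0 \<le> l" "(0 < l \<and> 2 * \<mu> \<le> l) \<or> k * p = 1"
    and minimizer: "\<And>i \<omega>. i < k \<Longrightarrow> \<omega> \<in> space M \<Longrightarrow>
       lasso_minimizer (design_mat T k p y \<omega>) (response_vec T y i \<omega>) l (b i \<omega>)"
  shows "prob {\<omega>\<in>space M. real k * (64 * (\<mu> + l) * real s / d\<^sup>2) < (\<Sum>i<k. l1_norm_vec (b i \<omega> - true_param k p \<Phi> i))}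
    \<le> 4 * (real k * real p)\<^sup>2 * exp (- (real T * q\<^sup>2 / (64 * L\<^sup>2)))
      + 4 * (real k)\<^sup>2 * real p * exp (- (real T * \<mu>\<^sup>2 / (64 * L\<^sup>2)))"
proof -
  note H = gaussian_space_noise[of UNIV]
  let ?t = "\<lambda>r. int T - int r" and ?n = "k * p"
  have k0: "0 < k" using k_pos by simp
  have normG: "d\<^sup>2 \<le> spectral_norm \<Gamma>" by (rule spectral_norm_\<Gamma>_ge[OF d re[OF k0] sparse(1)[OF k0]])
  define Gram where "Gram a c = {\<omega>\<in>space M. real T * q \<le> \<bar>(\<Sum>r<T. Z (?t r) a \<omega> * Z (?t r) c \<omega>) - (\<Sum>r<T. cov (Z (?t r) a) (Z (?t r) c))\<bar>}" for a c
  define Noise where "Noise i a = {\<omega>\<in>space M. real T * \<mu> \<le> \<bar>(\<Sum>r<T. \<epsilon> (?t r) i \<omega> * Z (?t r) a \<omega>) - (\<Sum>r<T. cov (\<epsilon> (?t r) i) (Z (?t r) a))\<bar>}" for i a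
  have Gram_sets: "Gram a c \<in> sets M" for a c
    unfolding Gram_def by (intro deviation_sets(2) borel_measurable_sum borel_measurable_times Z_measurable)
  have Noise_sets: "Noise i a \<in> sets M" if "i < k" for i a
    unfolding Noise_def by (intro deviation_sets(2) borel_measurable_sum borel_measurable_times Z_measurable noise_measurable that)
  have Gram_prob: "prob (Gram a c) \<le> 4 * exp (- (real T * q\<^sup>2 / (64 * L\<^sup>2)))" if "a < ?n" "c < ?n" for a c
    unfolding Gram_def
    using that by (intro gaussian_sum_products_concentration[OF H] Z_in_UNIV q order_trans[OF row_sum_Z[OF _ _ _ K] L(1)])
  have Noise_prob: "prob (Noise i a) \<le> 4 * exp (- (real T * \<mu>\<^sup>2 / (64 * L\<^sup>2)))" if "i < k" "a < ?n" for i a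
    unfolding Noise_def
    using that by (intro gaussian_sum_products_concentration[OF H] Z_in_UNIV noise_in_UNIV \<mu>
        order_trans[OF row_sum_Z[OF _ _ _ K] L(1)] order_trans[OF row_sum_noise L(2)]
        order_trans[OF row_sum_noise_Z(1)[OF _ _ _ K d normG] L(3)] order_trans[OF row_sum_noise_Z(2)[OF _ _ _ K d normG] L(3)])
  define G where "G = (\<Union>(a, c)\<in>{..<?n} \<times> {..<?n}. Gram a c)"
  define N where "N = (\<Union>(i, a)\<in>{..<k} \<times> {..<?n}. Noise i a)"
  have G_sets: "G \<in> sets M" unfolding G_def using Gram_sets by (intro sets.finite_UN) auto
  have N_sets: "N \<in> sets M" unfolding N_def using Noise_sets by (intro sets.finite_UN) auto
  have "prob G \<le> (\<Sum>(a, c)\<in>{..<?n} \<times> {..<?n}. prob (Gram a c))"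
    unfolding G_def case_prod_unfold
    by (rule finite_measure_subadditive_finite) (auto simp: Gram_sets)
  also have "\<dots> \<le> (\<Sum>(a, c)\<in>{..<?n} \<times> {..<?n}. 4 * exp (- (real T * q\<^sup>2 / (64 * L\<^sup>2))))"
    by (intro sum_mono) (auto intro: Gram_prob)
  also have "\<dots> = 4 * (real k * real p)\<^sup>2 * exp (- (real T * q\<^sup>2 / (64 * L\<^sup>2)))"
    by (simp add: power2_eq_square)
  finally have G_prob: "prob G \<le> 4 * (real k * real p)\<^sup>2 * exp (- (real T * q\<^sup>2 / (64 * L\<^sup>2)))" .
  have "prob N \<le> (\<Sum>(i, a)\<in>{..<k} \<times> {..<?n}. prob (Noise i a))"
    unfolding N_def case_prod_unfold
    by (rule finite_measure_subadditive_finite) (auto simp: Noise_sets)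
  also have "\<dots> \<le> (\<Sum>(i, a)\<in>{..<k} \<times> {..<?n}. 4 * exp (- (real T * \<mu>\<^sup>2 / (64 * L\<^sup>2))))"
    by (intro sum_mono) (auto intro: Noise_prob)
  also have "\<dots> = 4 * (real k)\<^sup>2 * real p * exp (- (real T * \<mu>\<^sup>2 / (64 * L\<^sup>2)))"
    by (simp add: power2_eq_square)
  finally have N_prob: "prob N \<le> 4 * (real k)\<^sup>2 * real p * exp (- (real T * \<mu>\<^sup>2 / (64 * L\<^sup>2)))" .
  have good: "l1_norm_vec (b i \<omega> - true_param k p \<Phi> i) \<le> 64 * (\<mu> + l) * real s / d\<^sup>2"
    if \<omega>: "\<omega> \<in> space M" "\<omega> \<notin> G" "\<omega> \<notin> N" and i: "i < k"
      and eqn: "\<forall>r<T. y (?t r) i \<omega> = (\<Sum>c<?n. \<Phi> (c div k + 1) $$ (i, c mod k) * Z (?t r) c \<omega>) + \<epsilon> (?t r) i \<omega>"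
    for \<omega> i
  proof -
    let ?b0 = "true_param k p \<Phi> i"
    have b0: "?b0 \<in> carrier_vec ?n" by (simp add: true_param_def)
    have b: "b i \<omega> \<in> carrier_vec ?n" and
      le: "lasso_objective (design_mat T k p y \<omega>) (response_vec T y i \<omega>) l (b i \<omega>)
        \<le> lasso_objective (design_mat T k p y \<omega>) (response_vec T y i \<omega>) l ?b0"
      using minimizer[OF i \<omega>(1)] b0 by (auto simp: lasso_minimizer_def design_mat_def)
    have eqn': "y (?t r) i \<omega> = (\<Sum>c<?n. Z (?t r) c \<omega> * ?b0 $ c) + \<epsilon> (?t r) i \<omega>" if "r < T" for r
      using eqn that by (simp add: true_param_def mult.commute)
    have "(\<Sum>j<?n. \<bar>b i \<omega> $ j - ?b0 $ j\<bar>) \<le> 64 * (\<mu> + l) * s / d\<^sup>2"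
    proof (rule lasso_l1_error[where x = "\<lambda>r j. Z (?t r) j \<omega>" and e = "\<lambda>r. \<epsilon> (?t r) i \<omega>"
          and G = "\<lambda>a c. \<Gamma> $$ (a, c)" and J = "active_set k p \<Phi> i" and N = T])
      show "(\<Sum>r<T. (\<epsilon> (?t r) i \<omega> - (\<Sum>j<?n. Z (?t r) j \<omega> * (b i \<omega> $ j - ?b0 $ j)))\<^sup>2) / real T
          + 2 * l * (\<Sum>j<?n. \<bar>b i \<omega> $ j\<bar>)
        \<le> (\<Sum>r<T. (\<epsilon> (?t r) i \<omega>)\<^sup>2) / real T + 2 * l * (\<Sum>j<?n. \<bar>?b0 $ j\<bar>)"
      proof -
        have "(\<Sum>r<T. (y (?t r) i \<omega> - (\<Sum>j<?n. Z (?t r) j \<omega> * b i \<omega> $ j))\<^sup>2)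
            = (\<Sum>r<T. (\<epsilon> (?t r) i \<omega> - (\<Sum>j<?n. Z (?t r) j \<omega> * (b i \<omega> $ j - ?b0 $ j)))\<^sup>2)"
          by (intro sum.cong refl arg_cong[where f = "\<lambda>x. x\<^sup>2"]) (simp add: eqn' right_diff_distrib sum_subtractf)
        moreover have "(\<Sum>r<T. (y (?t r) i \<omega> - (\<Sum>j<?n. Z (?t r) j \<omega> * ?b0 $ j))\<^sup>2) = (\<Sum>r<T. (\<epsilon> (?t r) i \<omega>)\<^sup>2)"
          by (intro sum.cong refl arg_cong[where f = "\<lambda>x. x\<^sup>2"]) (simp add: eqn')
        ultimately show ?thesis using le unfolding lasso_objective_sum[OF b] lasso_objective_sum[OF b0] by simp
      qed
      show "\<bar>(\<Sum>r<T. \<epsilon> (?t r) i \<omega> * Z (?t r) j \<omega>) / real T\<bar> \<le> \<mu>" if "j < ?n" for j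
      proof -
        have "\<omega> \<notin> Noise i j" using \<omega> i that by (auto simp: N_def)
        moreover have "(cov (\<epsilon> (?t r) i) (Z (?t r) j)) = 0" for r
          using cov_Z_noise_zero[OF i, of "?t r" "?t r" j] by (simp add: mult.commute)
        ultimately have "\<bar>\<Sum>r<T. \<epsilon> (?t r) i \<omega> * Z (?t r) j \<omega>\<bar> < real T * \<mu>"
          using \<omega> by (simp add: Noise_def not_le)
        then show ?thesis using T by (simp add: field_simps)
      qed
      show "\<bar>(\<Sum>r<T. Z (?t r) a \<omega> * Z (?t r) c \<omega>) / real T - \<Gamma> $$ (a, c)\<bar> \<le> q" if "a < ?n" "c < ?n" for a c
      proof -
        have "\<omega> \<notin> Gram a c" using \<omega> that by (auto simp: G_def)
        then have "\<bar>(\<Sum>r<T. Z (?t r) a \<omega> * Z (?t r) c \<omega>) - real T * \<Gamma> $$ (a, c)\<bar> < real T * q"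
          using \<omega> that by (simp add: Gram_def not_le Z_cov)
        moreover have "(\<Sum>r<T. Z (?t r) a \<omega> * Z (?t r) c \<omega>) / real T - \<Gamma> $$ (a, c)
            = ((\<Sum>r<T. Z (?t r) a \<omega> * Z (?t r) c \<omega>) - real T * \<Gamma> $$ (a, c)) / real T"
          using T by (simp add: field_simps)
        ultimately show ?thesis using T by (simp add: abs_divide field_simps)
      qed
      show "d\<^sup>2 * (\<Sum>j\<in>active_set k p \<Phi> i. (\<delta> j)\<^sup>2) \<le> (\<Sum>a<?n. \<Sum>c<?n. \<delta> a * \<delta> c * \<Gamma> $$ (a, c))"
        if "(\<Sum>j\<in>{..<?n} - active_set k p \<Phi> i. \<bar>\<delta> j\<bar>) \<le> 3 * (\<Sum>j\<in>active_set k p \<Phi> i. \<bar>\<delta> j\<bar>)" for \<delta>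
        by (rule restricted_eigenvalue_bound[OF \<Gamma>_carrier \<Gamma>_psd d re[OF i] _ _ that]) (auto simp: active_set_def sparsity_def)
      show "0 < l \<and> 2 * \<mu> \<le> l \<or> active_set k p \<Phi> i = {..<?n}"
        using l(2)
      proof
        (* With a single coefficient, sparsity at least 1 makes it active. *)
        assume kp: "k * p = 1"
        have "active_set k p \<Phi> i \<noteq> {}" using sparse(1)[OF i] by (auto simp: sparsity_def)
        then show ?thesis using kp by (auto simp: active_set_def)
      qed simp
    qed (use T q \<mu> d l sparse(2)[OF i] in \<open>auto simp: active_set_def sparsity_def\<close>)
    then show ?thesis using b b0 by (simp add: l1_norm_vec_def)
  qed
  let ?A = "{\<omega>\<in>space M. real k * (64 * (\<mu> + l) * real s / d\<^sup>2) < (\<Sum>i<k. l1_norm_vec (b i \<omega> - true_param k p \<Phi> i))}"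
  have "AE \<omega> in M. \<forall>i<k. \<forall>r<T. y (?t r) i \<omega> = (\<Sum>c<?n. \<Phi> (c div k + 1) $$ (i, c mod k) * Z (?t r) c \<omega>) + \<epsilon> (?t r) i \<omega>"
    using var_equation_lagged by (simp add: AE_all_countable)
  then have "AE \<omega> in M. \<omega> \<in> ?A \<longrightarrow> \<omega> \<in> G \<union> N"
  proof eventually_elim
    fix \<omega> assume eqn: "\<forall>i<k. \<forall>r<T. y (?t r) i \<omega> = (\<Sum>c<?n. \<Phi> (c div k + 1) $$ (i, c mod k) * Z (?t r) c \<omega>) + \<epsilon> (?t r) i \<omega>"
    show "\<omega> \<in> ?A \<longrightarrow> \<omega> \<in> G \<union> N"
    proof (intro impI, rule ccontr)
      assume \<omega>: "\<omega> \<in> ?A" and nb: "\<omega> \<notin> G \<union> N"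
      then have "(\<Sum>i<k. l1_norm_vec (b i \<omega> - true_param k p \<Phi> i)) \<le> (\<Sum>i<k. 64 * (\<mu> + l) * real s / d\<^sup>2)"
        using eqn by (intro sum_mono good) auto
      then show False using \<omega> by simp
    qed
  qed
  then have "prob ?A \<le> prob (G \<union> N)"
    using G_sets N_sets by (intro finite_measure_mono_AE) auto
  also have "\<dots> \<le> prob G + prob N" by (intro measure_Un_le G_sets N_sets)
  finally show ?thesis using G_prob N_prob by linarith
qed

end

section \<open>Rates and consistency\<close>

text \<open>
  The normalization \<open>C \<ge> 1\<close> keeps the logarithms of the constants nonnegative.
\<close>

lemma bigo_nonneg_bound:
  fixes f g :: "nat \<Rightarrow> real"
  assumes "f \<in> O(g)" "\<And>T. g T \<ge> 0"
  obtains C where "C \<ge> 1" "eventually (\<lambda>T. f T \<le> C * g T) sequentially"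
proof -
  from landau_o.bigE[OF assms(1)] obtain c where c: "c > 0" "eventually (\<lambda>T. norm (f T) \<le> c * norm (g T)) sequentially"
    by blast
  have "eventually (\<lambda>T. f T \<le> max 1 c * g T) sequentially"
    using c(2)
  proof eventually_elim
    fix T assume "norm (f T) \<le> c * norm (g T)"
    then have "f T \<le> c * g T" using assms(2)[of T] by simp
    also have "\<dots> \<le> max 1 c * g T" using assms(2)[of T] by (intro mult_right_mono) auto
    finally show "f T \<le> max 1 c * g T" .
  qed
  then show thesis by (rule that[rotated]) simp
qed

lemma number_of_noise_entries:
  assumes "k \<ge> 1" "p \<ge> 1"
  shows "1 \<le> real k ^ 2 * real p" and "k * p \<noteq> 1 \<Longrightarrow> 2 \<le> real k ^ 2 * real p"
proof -
  have le: "k * p \<le> k\<^sup>2 * p" using assms by (simp add: power2_eq_square)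
  have cast: "m \<le> k\<^sup>2 * p \<Longrightarrow> real m \<le> real k ^ 2 * real p" for m
    by (metis of_nat_le_iff of_nat_mult of_nat_power)
  have kp: "1 \<le> k * p" using assms by simp
  then show "1 \<le> real k ^ 2 * real p" using cast[of 1] le by simp
  assume "k * p \<noteq> 1"
  then have "2 \<le> k\<^sup>2 * p" using kp le by linarith
  then show "2 \<le> real k ^ 2 * real p" using cast[of 2] by simp
qed

lemma penalty_power2:
  assumes "k \<ge> 1" "p \<ge> 1"
  shows "(penalty T k p \<sigma>)\<^sup>2 = 8 * ln (1 + real T) ^ 5 * ln (1 + real k) ^ 4 * ln (1 + real p) ^ 2
             * ln (real k ^ 2 * real p) * \<sigma> ^ 4 / real T"
proof -
  have "1 \<le> real k ^ 2 * real p" by (rule number_of_noise_entries(1)[OF assms])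
  then have "0 \<le> 8 * ln (1 + real T) ^ 5 * ln (1 + real k) ^ 4 * ln (1 + real p) ^ 2
             * ln (real k ^ 2 * real p) * \<sigma> ^ 4 / real T"
    by (intro divide_nonneg_nonneg mult_nonneg_nonneg) (auto intro!: zero_le_power[OF ln_ge_zero])
  then show ?thesis unfolding penalty_def by (rule real_sqrt_pow2)
qed

lemma penalty_nonneg:
  assumes "k \<ge> 1" "p \<ge> 1"
  shows "penalty T k p \<sigma> \<ge> 0"
proof -
  have "1 \<le> real k ^ 2 * real p" by (rule number_of_noise_entries(1)[OF assms])
  then show ?thesis unfolding penalty_def
    by (intro real_sqrt_ge_zero divide_nonneg_nonneg mult_nonneg_nonneg) (auto intro!: zero_le_power[OF ln_ge_zero])
qed

text \<open>
  Each of \<open>ln (1 + T)\<close> and \<open>ln (1 + k)\<close> is at most a constant times \<open>ln (1 + T)\<close>, and they occur with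
  total power 9; \<open>ln (1 + p)\<close> is at most a constant times \<open>T\<^sup>a\<close>; and \<open>ln (k\<^sup>2 p)\<close> is at most a constant
  times \<open>ln (1 + T) T\<^sup>a\<close>.  The factor \<open>k s\<close> is of order \<open>T\<^bsup>b + c\<^esup>\<close>.  So the square of the sequence is at most a constant times
  \<open>ln (1 + T)\<^sup>1\<^sup>0 T\<^bsup>3a + 2b + 2c - 1\<^esup>\<close>.
\<close>

lemma penalty_rate:
  fixes k p s :: "nat \<Rightarrow> nat" and \<sigma> :: "nat \<Rightarrow> real"
  assumes exps: "a \<ge> 0" "b \<ge> 0" "c \<ge> 0" "3 * a + 2 * b + 2 * c < 1"
    and p_rate: "(\<lambda>T. real (p T)) \<in> O(\<lambda>T. exp (real T powr a))"
    and k_rate: "(\<lambda>T. real (k T)) \<in> O(\<lambda>T. real T powr b)"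
    and s_rate: "(\<lambda>T. real (s T)) \<in> O(\<lambda>T. real T powr c)"
    and pos: "\<And>T. T \<ge> 1 \<Longrightarrow> k T \<ge> 1" "\<And>T. T \<ge> 1 \<Longrightarrow> p T \<ge> 1"
    and \<sigma>: "\<And>T. T \<ge> 1 \<Longrightarrow> 0 \<le> \<sigma> T" "\<And>T. T \<ge> 1 \<Longrightarrow> \<sigma> T \<le> B"
  shows "(\<lambda>T. real (k T) * real (s T) * penalty T (k T) (p T) (\<sigma> T)) \<longlonglongrightarrow> 0"
proof -
  obtain Cp where Cp: "Cp \<ge> 1" "eventually (\<lambda>T. real (p T) \<le> Cp * exp (real T powr a)) sequentially"
    by (rule bigo_nonneg_bound[OF p_rate]) auto
  obtain Ck where Ck: "Ck \<ge> 1" "eventually (\<lambda>T. real (k T) \<le> Ck * real T powr b) sequentially"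
    by (rule bigo_nonneg_bound[OF k_rate]) auto
  obtain Cs where Cs: "Cs \<ge> 1" "eventually (\<lambda>T. real (s T) \<le> Cs * real T powr c) sequentially"
    by (rule bigo_nonneg_bound[OF s_rate]) auto
  define D where "D = ln (2 * Ck) + b + ln (2 * Cp) + 1"
  have D: "D \<ge> 1" "ln (2 * Ck) + b \<le> D" "ln (2 * Cp) + 1 \<le> D" using Ck Cp exps by (auto simp: D_def)
  define \<nu> where "\<nu> = 3 * a + 2 * b + 2 * c - 1"
  have \<nu>: "\<nu> < 0" using exps by (simp add: \<nu>_def)
  define C where "C = 24 * Ck\<^sup>2 * Cs\<^sup>2 * D ^ 7 * B ^ 4"
  let ?X = "\<lambda>T. real (k T) * real (s T) * penalty T (k T) (p T) (\<sigma> T)"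
  have "eventually (\<lambda>T. (?X T)\<^sup>2 \<le> C * (ln (1 + real T) ^ 10 * real T powr \<nu>)) sequentially"
    using Cp(2) Ck(2) Cs(2) eventually_ge_at_top[of "2::nat"]
  proof eventually_elim
    fix T assume p: "real (p T) \<le> Cp * exp (real T powr a)" and k: "real (k T) \<le> Ck * real T powr b"
      and s: "real (s T) \<le> Cs * real T powr c" and T: "(2::nat) \<le> T"
    define \<Lambda> where "\<Lambda> = ln (1 + real T)"
    have k1: "k T \<ge> 1" and p1: "p T \<ge> 1" using pos T by auto
    have \<Lambda>1: "1 \<le> \<Lambda>"
    proof -
      have "exp 1 \<le> (3 :: real)" by (rule exp_le)
      then have "exp 1 \<le> 1 + real T" using T by simp
      then show ?thesis unfolding \<Lambda>_def by (subst ln_ge_iff) auto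
    qed
    have Ta: "1 \<le> real T powr a" and Tb: "1 \<le> real T powr b" using T exps by (auto intro: ge_one_powr_ge_zero)
    have lk: "ln (1 + real (k T)) \<le> D * \<Lambda>"
    proof -
      have "1 + real (k T) \<le> 2 * Ck * real T powr b"
        using k Ck(1) Tb mult_mono[of 1 Ck 1 "real T powr b"] by simp
      then have "ln (1 + real (k T)) \<le> ln (2 * Ck * real T powr b)" by (intro ln_mono) auto
      also have "\<dots> = ln (2 * Ck) + b * ln (real T)" using T Ck(1) by (simp add: ln_mult ln_powr)
      also have "\<dots> \<le> ln (2 * Ck) * \<Lambda> + b * \<Lambda>"
        using \<Lambda>1 Ck(1) exps T unfolding \<Lambda>_def
        by (intro add_mono mult_left_mono mult_left_le[of _ 1, simplified]) (auto simp: mult_le_cancel_left1)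
      also have "\<dots> \<le> D * \<Lambda>" using D \<Lambda>1 by (simp flip: distrib_right)
      finally show ?thesis .
    qed
    have lp: "ln (1 + real (p T)) \<le> D * real T powr a"
    proof -
      have "1 + real (p T) \<le> 2 * Cp * exp (real T powr a)"
        using p Cp(1) Ta mult_mono[of 1 Cp 1 "exp (real T powr a)"] by simp
      then have "ln (1 + real (p T)) \<le> ln (2 * Cp * exp (real T powr a))" by (intro ln_mono) auto
      also have "\<dots> = ln (2 * Cp) + real T powr a" using Cp(1) by (simp add: ln_mult)
      also have "\<dots> \<le> ln (2 * Cp) * real T powr a + 1 * real T powr a"
        using Ta Cp(1) by (simp add: mult_le_cancel_left1)
      also have "\<dots> \<le> D * real T powr a" using mult_right_mono[OF D(3), of "real T powr a"] Ta by (simp add: distrib_right)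
      finally show ?thesis .
    qed
    have lkp: "ln (real (k T) ^ 2 * real (p T)) \<le> 3 * D * \<Lambda> * real T powr a"
    proof -
      have "ln (real (k T) ^ 2 * real (p T)) = 2 * ln (real (k T)) + ln (real (p T))"
        using k1 p1 by (simp add: ln_mult ln_realpow)
      also have "\<dots> \<le> 2 * ln (1 + real (k T)) + ln (1 + real (p T))" using k1 p1 by (intro add_mono mult_left_mono ln_mono) auto
      also have "\<dots> \<le> 2 * (D * \<Lambda>) * 1 + D * 1 * real T powr a" using lk lp by simp
      also have "\<dots> \<le> 2 * (D * \<Lambda>) * real T powr a + D * \<Lambda> * real T powr a"
        using D \<Lambda>1 Ta by (intro add_mono mult_left_mono mult_right_mono) auto
      finally show ?thesis by simp
    qed
    note kp = number_of_noise_entries(1)[OF k1 p1]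
    have pw: "real T powr \<nu> = (real T powr b)\<^sup>2 * (real T powr c)\<^sup>2 * (real T powr a) ^ 2 * real T powr a / real T"
    proof -
      have \<nu>_eq: "\<nu> = b + b + c + c + a + a + a - 1" by (simp add: \<nu>_def)
      show ?thesis using T unfolding \<nu>_eq powr_diff powr_add by (simp add: power2_eq_square)
    qed
    have "(?X T)\<^sup>2 = (real (k T))\<^sup>2 * (real (s T))\<^sup>2 * (8 * \<Lambda> ^ 5 * ln (1 + real (k T)) ^ 4 * ln (1 + real (p T)) ^ 2
             * ln (real (k T) ^ 2 * real (p T)) * \<sigma> T ^ 4 / real T)"
      by (simp only: power_mult_distrib penalty_power2[OF k1 p1] \<Lambda>_def)
    also have "\<dots> \<le> (Ck * real T powr b)\<^sup>2 * (Cs * real T powr c)\<^sup>2 * (8 * \<Lambda> ^ 5 * (D * \<Lambda>) ^ 4 * (D * real T powr a) ^ 2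
             * (3 * D * \<Lambda> * real T powr a) * B ^ 4 / real T)"
      using k s lk lp lkp kp \<sigma>[of T] T D \<Lambda>1 Ck(1) Cs(1)
      by (intro mult_mono divide_right_mono power_mono mult_nonneg_nonneg divide_nonneg_nonneg zero_le_power ln_ge_zero)
         (auto intro: order_trans)
    also have "\<dots> = C * (\<Lambda> ^ 10 * real T powr \<nu>)"
      unfolding pw C_def by (simp add: power_mult_distrib field_simps) (simp add: eval_nat_numeral)
    finally show "(?X T)\<^sup>2 \<le> C * (ln (1 + real T) ^ 10 * real T powr \<nu>)" by (simp add: \<Lambda>_def)
  qed
  moreover have "(\<lambda>T. C * (ln (1 + real T) ^ 10 * real T powr \<nu>)) \<longlonglongrightarrow> C * 0"
  proof (rule tendsto_mult_left)
    show "(\<lambda>T. ln (1 + real T) ^ 10 * real T powr \<nu>) \<longlonglongrightarrow> 0" using \<nu> by real_asymp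
  qed
  ultimately have "(\<lambda>T. (?X T)\<^sup>2) \<longlonglongrightarrow> 0"
    by (intro tendsto_sandwich[of "\<lambda>_. 0" "\<lambda>T. (?X T)\<^sup>2" sequentially]) auto
  from tendsto_real_sqrt[OF this] have "(\<lambda>T. \<bar>?X T\<bar>) \<longlonglongrightarrow> 0" by simp
  then show ?thesis by (simp add: tendsto_rabs_zero_iff)
qed

text \<open>
  The exponent is at least a multiple of \<open>T\<^bsup>1 - 2c\<^esup>\<close> and dominates \<open>2 ln p\<close>, which is at most of order
  \<open>T\<^sup>a\<close>, since \<open>a + 2c < 1\<close>.
\<close>

lemma gram_union_bound_rate:
  fixes k p s :: "nat \<Rightarrow> nat"
  assumes exps: "a \<ge> 0" "b \<ge> 0" "c \<ge> 0" "3 * a + 2 * b + 2 * c < 1"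
    and p_rate: "(\<lambda>T. real (p T)) \<in> O(\<lambda>T. exp (real T powr a))"
    and k_rate: "(\<lambda>T. real (k T)) \<in> O(\<lambda>T. real T powr b)"
    and s_rate: "(\<lambda>T. real (s T)) \<in> O(\<lambda>T. real T powr c)"
    and s_pos: "\<And>T. T \<ge> 1 \<Longrightarrow> s T \<ge> 1" and \<delta>: "\<delta> > 0"
  shows "(\<lambda>T. (real (k T) * real (p T))\<^sup>2 * exp (- (\<delta> * real T / (real (s T))\<^sup>2))) \<longlonglongrightarrow> 0"
proof -
  obtain Cp where Cp: "Cp \<ge> 1" "eventually (\<lambda>T. real (p T) \<le> Cp * exp (real T powr a)) sequentially"
    by (rule bigo_nonneg_bound[OF p_rate]) auto
  obtain Ck where Ck: "Ck \<ge> 1" "eventually (\<lambda>T. real (k T) \<le> Ck * real T powr b) sequentially"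
    by (rule bigo_nonneg_bound[OF k_rate]) auto
  obtain Cs where Cs: "Cs \<ge> 1" "eventually (\<lambda>T. real (s T) \<le> Cs * real T powr c) sequentially"
    by (rule bigo_nonneg_bound[OF s_rate]) auto
  define e where "e = 1 - 2 * c"
  define \<eta> where "\<eta> = \<delta> / (2 * Cs\<^sup>2)"
  have e: "e > 0" "a - e < 0" and \<eta>: "\<eta> > 0" using exps \<delta> Cs by (auto simp: e_def \<eta>_def)
  have "(\<lambda>T. real T powr (a - e)) \<longlonglongrightarrow> 0" using e(2) by real_asymp
  then have "eventually (\<lambda>T. real T powr (a - e) < \<eta> / 2) sequentially"
    using \<eta> by (intro order_tendstoD) auto
  then have ev: "eventually (\<lambda>T. (real (k T) * real (p T))\<^sup>2 * exp (- (\<delta> * real T / (real (s T))\<^sup>2))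
      \<le> Ck\<^sup>2 * Cp\<^sup>2 * ((real T powr b)\<^sup>2 * exp (- (\<eta> * real T powr e)))) sequentially"
    using Cp(2) Ck(2) Cs(2) eventually_ge_at_top[of "1::nat"]
  proof eventually_elim
    fix T assume small: "real T powr (a - e) < \<eta> / 2"
      and p: "real (p T) \<le> Cp * exp (real T powr a)" and k: "real (k T) \<le> Ck * real T powr b"
      and s: "real (s T) \<le> Cs * real T powr c" and T: "(1::nat) \<le> T"
    have s1: "real (s T) \<ge> 1" using s_pos[OF T] by simp
    have "2 * real T powr a = 2 * (real T powr (a - e) * real T powr e)" by (simp flip: powr_add)
    also have "\<dots> \<le> 2 * (\<eta> / 2 * real T powr e)" using small by (intro mult_left_mono mult_right_mono) auto
    finally have 1: "2 * real T powr a \<le> \<eta> * real T powr e" by simp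
    have "2 * \<eta> * real T powr e = \<delta> * real T / (Cs * real T powr c)\<^sup>2"
    proof -
      have "(real T powr c)\<^sup>2 = real T powr (2 * c)" using T by (simp add: powr_power)
      then show ?thesis using T by (simp add: \<eta>_def e_def powr_diff power_mult_distrib)
    qed
    also have "\<dots> \<le> \<delta> * real T / (real (s T))\<^sup>2"
      using s s1 \<delta> Cs(1) T by (intro divide_left_mono power_mono mult_pos_pos zero_less_power) auto
    finally have 2: "2 * \<eta> * real T powr e \<le> \<delta> * real T / (real (s T))\<^sup>2" .
    have "(real (k T) * real (p T))\<^sup>2 * exp (- (\<delta> * real T / (real (s T))\<^sup>2))
       \<le> ((Ck * real T powr b) * (Cp * exp (real T powr a)))\<^sup>2 * exp (- (2 * \<eta> * real T powr e))"
      using k p 2 Ck(1) Cp(1) by (intro mult_mono power_mono) auto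
    also have "\<dots> = Ck\<^sup>2 * Cp\<^sup>2 * ((real T powr b)\<^sup>2 * exp (2 * real T powr a - 2 * \<eta> * real T powr e))"
      by (simp add: power_mult_distrib exp_diff exp_minus exp_double field_simps)
    also have "\<dots> \<le> Ck\<^sup>2 * Cp\<^sup>2 * ((real T powr b)\<^sup>2 * exp (- (\<eta> * real T powr e)))"
      using 1 by (intro mult_left_mono) auto
    finally show "(real (k T) * real (p T))\<^sup>2 * exp (- (\<delta> * real T / (real (s T))\<^sup>2))
      \<le> Ck\<^sup>2 * Cp\<^sup>2 * ((real T powr b)\<^sup>2 * exp (- (\<eta> * real T powr e)))" .
  qed
  have "(\<lambda>T. Ck\<^sup>2 * Cp\<^sup>2 * ((real T powr b)\<^sup>2 * exp (- (\<eta> * real T powr e)))) \<longlonglongrightarrow> Ck\<^sup>2 * Cp\<^sup>2 * 0"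
  proof (rule tendsto_mult_left)
    show "(\<lambda>T. (real T powr b)\<^sup>2 * exp (- (\<eta> * real T powr e))) \<longlonglongrightarrow> 0"
      using e(1) \<eta> exps(2) by real_asymp
  qed
  then have lim: "(\<lambda>T. Ck\<^sup>2 * Cp\<^sup>2 * ((real T powr b)\<^sup>2 * exp (- (\<eta> * real T powr e)))) \<longlonglongrightarrow> 0" by simp
  show ?thesis by (rule tendsto_sandwich[OF _ ev tendsto_const lim]) simp
qed

text \<open>
  With \<open>n = k\<^sup>2 p \<ge> 2\<close> the exponent is at least \<open>A ln n\<close>, where \<open>A\<close> is the quantity assumed to be at least 1;
  then \<open>n exp (- A ln n) = exp ((1 - A) ln n)\<close> is largest at \<open>n = 2\<close>.
\<close>

lemma noise_union_bound:
  fixes k p T :: nat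
  assumes T: "T \<ge> 1" and pos: "k \<ge> 1" "p \<ge> 1" "k * p \<noteq> 1" and d: "0 \<le> d" "d \<le> \<sigma>" and L: "L > 0"
    and large: "1 \<le> d ^ 4 * ln 2 ^ 6 * ln (1 + real T) ^ 5 / (32 * L\<^sup>2)"
  shows "(real k)\<^sup>2 * real p * exp (- (real T * (penalty T k p \<sigma> / 2)\<^sup>2 / (64 * L\<^sup>2)))
     \<le> exp ((1 - d ^ 4 * ln 2 ^ 6 * ln (1 + real T) ^ 5 / (32 * L\<^sup>2)) * ln 2)"
proof -
  define n where "n = (real k)\<^sup>2 * real p"
  define A where "A = d ^ 4 * ln 2 ^ 6 * ln (1 + real T) ^ 5 / (32 * L\<^sup>2)"
  have n: "n \<ge> 2" unfolding n_def by (rule number_of_noise_entries(2)[OF pos])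
  have ln_n: "ln n \<ge> ln 2" using n by simp
  have lk: "ln (1 + real k) \<ge> ln 2" "ln (1 + real p) \<ge> ln 2" using pos by auto
  have "A * ln n = ln (1 + real T) ^ 5 * (ln 2 ^ 4 * (ln 2 ^ 2 * (ln n * (d ^ 4 / (32 * L\<^sup>2)))))"
    by (simp add: A_def mult_ac flip: power_add)
  also have "\<dots> \<le> ln (1 + real T) ^ 5 * (ln (1 + real k) ^ 4 * (ln (1 + real p) ^ 2 * (ln n * (\<sigma> ^ 4 / (32 * L\<^sup>2)))))"
  proof -
    have ln0: "0 \<le> ln n" using n by simp
    have "d ^ 4 / (32 * L\<^sup>2) \<le> \<sigma> ^ 4 / (32 * L\<^sup>2)" using d by (intro divide_right_mono power_mono) auto
    then have 1: "ln n * (d ^ 4 / (32 * L\<^sup>2)) \<le> ln n * (\<sigma> ^ 4 / (32 * L\<^sup>2))" using ln0 by (rule mult_left_mono)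
    have 2: "ln 2 ^ 2 * (ln n * (d ^ 4 / (32 * L\<^sup>2))) \<le> ln (1 + real p) ^ 2 * (ln n * (\<sigma> ^ 4 / (32 * L\<^sup>2)))"
      by (intro mult_mono[OF power_mono[OF lk(2)] 1] mult_nonneg_nonneg ln0) auto
    have 3: "ln 2 ^ 4 * (ln 2 ^ 2 * (ln n * (d ^ 4 / (32 * L\<^sup>2)))) \<le> ln (1 + real k) ^ 4 * (ln (1 + real p) ^ 2 * (ln n * (\<sigma> ^ 4 / (32 * L\<^sup>2))))"
      by (intro mult_mono[OF power_mono[OF lk(1)] 2] mult_nonneg_nonneg ln0) auto
    then show ?thesis by (rule mult_left_mono) simp
  qed
  also have "\<dots> = real T * (penalty T k p \<sigma> / 2)\<^sup>2 / (64 * L\<^sup>2)"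
    unfolding power_divide penalty_power2[OF pos(1,2)] n_def using T by (simp add: field_simps)
  finally have "exp (- (real T * (penalty T k p \<sigma> / 2)\<^sup>2 / (64 * L\<^sup>2))) \<le> exp (- (A * ln n))" by simp
  then have "n * exp (- (real T * (penalty T k p \<sigma> / 2)\<^sup>2 / (64 * L\<^sup>2))) \<le> n * exp (- (A * ln n))"
    using n by (intro mult_left_mono) auto
  also have "\<dots> = exp (ln n) * exp (- (A * ln n))" using n by simp
  also have "\<dots> = exp ((1 - A) * ln n)" by (simp add: mult_exp_exp algebra_simps)
  also have "\<dots> \<le> exp ((1 - A) * ln 2)"
    using mult_left_mono_neg[OF ln_n, of "1 - A"] large unfolding A_def[symmetric] by simp
  finally show ?thesis by (simp add: n_def A_def)
qed

lemma penalty_pos: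
  assumes "T \<ge> 1" "k \<ge> 1" "p \<ge> 1" "k * p \<noteq> 1" "\<sigma> > 0"
  shows "penalty T k p \<sigma> > 0"
proof -
  have "2 \<le> real k ^ 2 * real p" by (rule number_of_noise_entries(2)[OF assms(2-4)])
  then have "0 < ln (real k ^ 2 * real p)" by simp
  then show ?thesis unfolding penalty_def using assms
    by (intro real_sqrt_gt_zero divide_pos_pos mult_pos_pos zero_less_power) auto
qed

text \<open>
  The constant \<open>L\<close> bounds all row sums and exceeds the deviations \<open>q = d\<^sup>2 / (32 s)\<close>; \<open>\<mu>\<close> is half of the
  penalty except when \<open>k p = 1\<close>, where the penalty is 0.
\<close>

theorem theorem5:
  fixes M :: "nat \<Rightarrow> 'a measure"
    and k p :: "nat \<Rightarrow> nat"
    and \<Phi> :: "nat \<Rightarrow> nat \<Rightarrow> real mat"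
    and S :: "nat \<Rightarrow> real mat"
    and \<epsilon> y :: "nat \<Rightarrow> int \<Rightarrow> nat \<Rightarrow> 'a \<Rightarrow> real"
    and \<beta>_hat :: "nat \<Rightarrow> nat \<Rightarrow> 'a \<Rightarrow> real vec"
    and a b c d :: real
  assumes model: "\<And>T. T \<ge> 1 \<Longrightarrow> gaussian_var (M T) (k T) (p T) (\<Phi> T) (S T) (\<epsilon> T) (y T)"
    and s_pos: "\<And>T i. T \<ge> 1 \<Longrightarrow> i < k T \<Longrightarrow> sparsity (k T) (p T) (\<Phi> T) i \<ge> 1"
    and exponents: "a \<ge> 0" "b \<ge> 0" "c \<ge> 0" "3 * a + 2 * b + 2 * c < 1"
    and p_rate: "(\<lambda>T. real (p T)) \<in> O(\<lambda>T. exp (real T powr a))"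
    and k_rate: "(\<lambda>T. real (k T)) \<in> O(\<lambda>T. real T powr b)"
    and s_rate: "(\<lambda>T. real (max_sparsity (k T) (p T) (\<Phi> T))) \<in> O(\<lambda>T. real T powr c)"
    and d_pos: "d > 0"
    and kappa: "\<And>T i. T \<ge> 1 \<Longrightarrow> i < k T \<Longrightarrow>
      restricted_eigenvalue (lag_cov (M T) (k T) (p T) (y T)) (sparsity (k T) (p T) (\<Phi> T) i) \<ge> d"
    and sd_bounded: "bdd_above ((\<lambda>T. max_sd (M T) (k T) (\<epsilon> T) (y T)) ` {1..})"
    and cov_bounded: "bdd_above ((\<lambda>T. spectral_norm (lag_cov (M T) (k T) (p T) (y T)) *
      (\<Sum>j=0..T. spectral_norm (companion_mat (k T) (p T) (\<Phi> T) ^\<^sub>m j))) ` {1..})"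
    and estimator_measurable: "\<And>T i j. T \<ge> 1 \<Longrightarrow> i < k T \<Longrightarrow> j < k T * p T \<Longrightarrow>
      (\<lambda>\<omega>. \<beta>_hat T i \<omega> $ j) \<in> borel_measurable (M T)"
    and estimator: "\<And>T i \<omega>. T \<ge> 1 \<Longrightarrow> i < k T \<Longrightarrow> \<omega> \<in> space (M T) \<Longrightarrow>
      lasso_minimizer (design_mat T (k T) (p T) (y T) \<omega>) (response_vec T (y T) i \<omega>)
        (penalty T (k T) (p T) (max_sd (M T) (k T) (\<epsilon> T) (y T))) (\<beta>_hat T i \<omega>)"
  shows "tendsto_in_prob M
    (\<lambda>T \<omega>. \<Sum>i<k T. l1_norm_vec (\<beta>_hat T i \<omega> - true_param (k T) (p T) (\<Phi> T) i)) 0"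
proof -
  define s where "s T = max_sparsity (k T) (p T) (\<Phi> T)" for T
  define \<sigma> where "\<sigma> T = max_sd (M T) (k T) (\<epsilon> T) (y T)" for T
  define l where "l T = penalty T (k T) (p T) (\<sigma> T)" for T
  define \<mu> where "\<mu> T = (if k T * p T = 1 then real T powr (- (1 / 4)) else l T / 2)" for T
  define X where "X T \<omega> = (\<Sum>i<k T. l1_norm_vec (\<beta>_hat T i \<omega> - true_param (k T) (p T) (\<Phi> T) i))" for T \<omega>
  have kp: "k T \<ge> 1" "p T \<ge> 1" if "T \<ge> 1" for T
    using gaussian_var.k_pos[OF model[OF that]] gaussian_var.p_pos[OF model[OF that]] by auto
  have s_ge: "sparsity (k T) (p T) (\<Phi> T) i \<le> s T" if "i < k T" for T i
    unfolding s_def max_sparsity_def using that by (intro Max_ge) auto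
  have s1: "s T \<ge> 1" if "T \<ge> 1" for T
    using s_pos[OF that, of 0] s_ge[of 0 T] kp(1)[OF that] by linarith
  have s_le: "s T \<le> k T * p T" if "T \<ge> 1" for T
  proof -
    have "sparsity (k T) (p T) (\<Phi> T) i \<le> card {..<k T * p T}" for i
      unfolding sparsity_def active_set_def by (intro card_mono) auto
    then show ?thesis unfolding s_def max_sparsity_def using kp(1)[OF that] by (subst Max_le_iff) (auto simp: lessThan_empty_iff)
  qed
  obtain B where \<sigma>B: "\<And>T. T \<ge> 1 \<Longrightarrow> \<sigma> T \<le> B" using sd_bounded by (auto simp: bdd_above_def \<sigma>_def)
  obtain K0 where K0: "\<And>T. T \<ge> 1 \<Longrightarrow> spectral_norm (lag_cov (M T) (k T) (p T) (y T)) *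
      (\<Sum>j=0..T. spectral_norm (companion_mat (k T) (p T) (\<Phi> T) ^\<^sub>m j)) \<le> K0"
    using cov_bounded by (auto simp: bdd_above_def)
  define K where "K = max K0 0"
  have K: "spectral_norm (lag_cov (M T) (k T) (p T) (y T)) *
      (\<Sum>j=0..T. spectral_norm (companion_mat (k T) (p T) (\<Phi> T) ^\<^sub>m j)) \<le> K" if "T \<ge> 1" for T
    using K0[OF that] by (simp add: K_def)
  have K_nonneg: "K \<ge> 0" by (simp add: K_def)
  have \<sigma>d: "d \<le> \<sigma> T" if "T \<ge> 1" for T
  proof -
    have "0 < k T" using kp(1)[OF that] by simp
    then show ?thesis unfolding \<sigma>_def
      by (intro gaussian_var.max_sd_ge[OF model[OF that] d_pos kappa[OF that] s_pos[OF that]])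
  qed
  have \<sigma>0: "0 \<le> \<sigma> T" if "T \<ge> 1" for T using \<sigma>d[OF that] d_pos by simp
  define L where "L = 2 * K + B\<^sup>2 + B * K / d + d\<^sup>2 + 1"
  have B0: "B > 0" using \<sigma>B[of 1] \<sigma>d[of 1] d_pos by simp
  have BKd: "0 \<le> B * K / d" using B0 K_nonneg d_pos by simp
  have L: "2 * K \<le> L" "B\<^sup>2 \<le> L" "B * K / d \<le> L" "d\<^sup>2 \<le> L" "L > 0"
    using BKd K_nonneg zero_le_power2[of B] zero_le_power2[of d] unfolding L_def by linarith+
  (* T q^2 / (64 L^2) = \<delta> T / s^2 for q = d^2 / (32 s), as 32^2 * 64 = 65536. *)
  define \<delta> where "\<delta> = d ^ 4 / (65536 * L\<^sup>2)"
  have \<delta>: "\<delta> > 0" using d_pos L by (simp add: \<delta>_def)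
  define err where "err T = real (k T) * (64 * (\<mu> T + l T) * real (s T) / d\<^sup>2)" for T
  define fail where "fail T = 4 * ((real (k T) * real (p T))\<^sup>2 * exp (- (\<delta> * real T / (real (s T))\<^sup>2)))
      + 4 * ((real (k T))\<^sup>2 * real (p T) * exp (- (real T * (\<mu> T)\<^sup>2 / (64 * L\<^sup>2))))" for T
  have bound: "measure (M T) {\<omega>\<in>space (M T). err T < X T \<omega>} \<le> fail T"
    if T: "T \<ge> 1" and \<mu>L: "\<mu> T \<le> L" for T
  proof -
    define q where "q = d\<^sup>2 / (32 * real (s T))"
    have sT: "real (s T) \<ge> 1" using s1[OF T] by simp
    have q: "0 < q" "q \<le> L" "32 * q * real (s T) \<le> d\<^sup>2"
    proof -
      show "0 < q" using d_pos sT by (simp add: q_def)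
      have "q \<le> d\<^sup>2 / 1" unfolding q_def using sT by (intro divide_left_mono) auto
      then show "q \<le> L" using L by simp
      show "32 * q * real (s T) \<le> d\<^sup>2" using sT by (simp add: q_def)
    qed
    have lpos: "0 < l T" if "k T * p T \<noteq> 1"
      unfolding l_def using T kp[OF T] that \<sigma>d[OF T] d_pos by (intro penalty_pos) auto
    have l0: "0 \<le> l T" unfolding l_def by (intro penalty_nonneg kp T)
    have \<mu>0: "0 < \<mu> T" using lpos T by (simp add: \<mu>_def)
    have cone: "(0 < l T \<and> 2 * \<mu> T \<le> l T) \<or> k T * p T = 1" using lpos by (simp add: \<mu>_def)
    have L': "(\<sigma> T)\<^sup>2 \<le> L" "\<sigma> T * K / d \<le> L"
    proof -
      have "(\<sigma> T)\<^sup>2 \<le> B\<^sup>2" using \<sigma>B[OF T] \<sigma>0[OF T] by (intro power_mono)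
      then show "(\<sigma> T)\<^sup>2 \<le> L" using L by simp
      have "\<sigma> T * K / d \<le> B * K / d" using \<sigma>B[OF T] K_nonneg d_pos by (intro divide_right_mono mult_right_mono) auto
      then show "\<sigma> T * K / d \<le> L" using L by simp
    qed
    have "measure (M T) {\<omega>\<in>space (M T). err T < X T \<omega>}
       \<le> 4 * (real (k T) * real (p T))\<^sup>2 * exp (- (real T * q\<^sup>2 / (64 * L\<^sup>2)))
        + 4 * (real (k T))\<^sup>2 * real (p T) * exp (- (real T * (\<mu> T)\<^sup>2 / (64 * L\<^sup>2)))"
      unfolding X_def err_def
      using estimator[OF T] unfolding \<sigma>_def[symmetric] l_def[symmetric]
      by (intro gaussian_var.lasso_total_error_prob[OF model[OF T] T d_pos kappa[OF T] s_pos[OF T] s_ge K[OF T] L(1)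
            L'[unfolded \<sigma>_def] q \<mu>0 \<mu>L l0 cone])
    also have "real T * q\<^sup>2 / (64 * L\<^sup>2) = \<delta> * real T / (real (s T))\<^sup>2"
      by (simp add: q_def \<delta>_def power_divide power_mult_distrib mult.commute mult.left_commute flip: power_mult)
    finally show ?thesis unfolding fail_def by (simp only: mult.assoc)
  qed
  have rate: "(\<lambda>T. real (k T) * real (s T) * (\<mu> T + l T)) \<longlonglongrightarrow> 0"
  proof -
    have ksl: "(\<lambda>T. real (k T) * real (s T) * l T) \<longlonglongrightarrow> 0"
      unfolding l_def
      by (rule penalty_rate[OF exponents p_rate k_rate s_rate[folded s_def] kp \<sigma>0 \<sigma>B])
    have "(\<lambda>T. 2 * (real (k T) * real (s T) * l T) + real T powr (- (1 / 4))) \<longlonglongrightarrow> 2 * 0 + 0"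
      by (intro tendsto_add tendsto_mult_left ksl) real_asymp
    then have lim: "(\<lambda>T. 2 * (real (k T) * real (s T) * l T) + real T powr (- (1 / 4))) \<longlonglongrightarrow> 0" by simp
    have ev0: "eventually (\<lambda>T. 0 \<le> real (k T) * real (s T) * (\<mu> T + l T)) sequentially"
      using eventually_ge_at_top[of 1]
    proof eventually_elim
      fix T :: nat assume T: "1 \<le> T"
      have "0 \<le> l T" unfolding l_def by (intro penalty_nonneg kp T)
      then show "0 \<le> real (k T) * real (s T) * (\<mu> T + l T)" by (simp add: \<mu>_def)
    qed
    have ev1: "eventually (\<lambda>T. real (k T) * real (s T) * (\<mu> T + l T)
        \<le> 2 * (real (k T) * real (s T) * l T) + real T powr (- (1 / 4))) sequentially"
      using eventually_ge_at_top[of 1]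
    proof eventually_elim
      fix T :: nat assume T: "1 \<le> T"
      have l0: "0 \<le> l T" unfolding l_def by (intro penalty_nonneg kp T)
      show "real (k T) * real (s T) * (\<mu> T + l T) \<le> 2 * (real (k T) * real (s T) * l T) + real T powr (- (1 / 4))"
      proof (cases "k T * p T = 1")
        case True
        then have one: "k T = 1" "p T = 1" "s T = 1" using s_le[OF T] s1[OF T] by auto
        (* ln (k^2 p) = 0 *)
        then have "l T = 0" by (simp add: l_def penalty_def)
        then show ?thesis using one by (simp add: \<mu>_def)
      next
        case False
        have "\<mu> T = l T / 2" by (simp only: \<mu>_def False if_False)
        then have "real (k T) * real (s T) * (\<mu> T + l T) = 3 / 2 * (real (k T) * real (s T) * l T)" by simp
        moreover have "0 \<le> real (k T) * real (s T) * l T" using l0 by simp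
        ultimately show ?thesis using powr_ge_zero[of "real T" "- (1 / 4)"] by linarith
      qed
    qed
    show ?thesis by (rule tendsto_sandwich[OF ev0 ev1 tendsto_const lim])
  qed
  have \<mu>_small: "eventually (\<lambda>T. \<mu> T \<le> L) sequentially"
    using order_tendstoD(2)[OF rate L(5)] eventually_ge_at_top[of 1]
  proof eventually_elim
    fix T assume small: "real (k T) * real (s T) * (\<mu> T + l T) < L" and T: "1 \<le> T"
    have l0: "0 \<le> l T" unfolding l_def by (intro penalty_nonneg kp T)
    then have m0: "0 \<le> \<mu> T + l T" by (simp add: \<mu>_def)
    have "1 * 1 \<le> real (k T) * real (s T)" using kp[OF T] s1[OF T] by (intro mult_mono) auto
    then have "1 * (\<mu> T + l T) \<le> real (k T) * real (s T) * (\<mu> T + l T)" using m0 by (intro mult_right_mono) auto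
    then have "\<mu> T + l T < L" using small by (simp only: mult_1)
    then show "\<mu> T \<le> L" using l0 by linarith
  qed
  define \<kappa> where "\<kappa> = d ^ 4 * ln 2 ^ 6 / (32 * L\<^sup>2)"
  have \<kappa>: "\<kappa> > 0" using d_pos L by (simp add: \<kappa>_def)
  have \<kappa>_eq: "d ^ 4 * ln 2 ^ 6 * ln (1 + real T) ^ 5 / (32 * L\<^sup>2) = \<kappa> * ln (1 + real T) ^ 5" for T by (simp add: \<kappa>_def)
  have large: "eventually (\<lambda>T. 1 \<le> \<kappa> * ln (1 + real T) ^ 5) sequentially" using \<kappa> by real_asymp
  have noise: "(\<lambda>T. (real (k T))\<^sup>2 * real (p T) * exp (- (real T * (\<mu> T)\<^sup>2 / (64 * L\<^sup>2)))) \<longlonglongrightarrow> 0"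
  proof -
    define c' where "c' = 1 / (64 * L\<^sup>2)"
    have c': "c' > 0" using L by (simp add: c'_def)
    have ev: "eventually (\<lambda>T. (real (k T))\<^sup>2 * real (p T) * exp (- (real T * (\<mu> T)\<^sup>2 / (64 * L\<^sup>2)))
        \<le> exp ((1 - \<kappa> * ln (1 + real T) ^ 5) * ln 2) + exp (- (c' * real T powr (1 / 2)))) sequentially"
      using large eventually_ge_at_top[of 1]
    proof eventually_elim
      fix T assume large: "1 \<le> \<kappa> * ln (1 + real T) ^ 5" and T: "1 \<le> T"
      show "(real (k T))\<^sup>2 * real (p T) * exp (- (real T * (\<mu> T)\<^sup>2 / (64 * L\<^sup>2)))
        \<le> exp ((1 - \<kappa> * ln (1 + real T) ^ 5) * ln 2) + exp (- (c' * real T powr (1 / 2)))"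
      proof (cases "k T * p T = 1")
        case True
        have "real T * (real T powr (- (1 / 4)))\<^sup>2 = real T powr (1 / 2)"
        proof -
          have "real T * (real T powr (- (1 / 4)))\<^sup>2 = real T powr 1 * real T powr (- (1 / 2))"
            using T by (simp add: power2_eq_square flip: powr_add)
          also have "\<dots> = real T powr (1 / 2)" by (simp only: powr_add[symmetric]) simp
          finally show ?thesis .
        qed
        then show ?thesis using True by (simp add: \<mu>_def c'_def)
      next
        case False
        have \<mu>: "\<mu> T = l T / 2" by (simp only: \<mu>_def False if_False)
        have "(real (k T))\<^sup>2 * real (p T) * exp (- (real T * (\<mu> T)\<^sup>2 / (64 * L\<^sup>2)))
           \<le> exp ((1 - \<kappa> * ln (1 + real T) ^ 5) * ln 2)"
          using noise_union_bound[OF T kp[OF T] False less_imp_le[OF d_pos] \<sigma>d[OF T] L(5)] large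
          unfolding \<kappa>_eq \<mu> l_def by blast
        then show ?thesis by (rule order_trans) simp
      qed
    qed
    have lim: "(\<lambda>T. exp ((1 - \<kappa> * ln (1 + real T) ^ 5) * ln 2) + exp (- (c' * real T powr (1 / 2)))) \<longlonglongrightarrow> 0"
      using \<kappa> c' by real_asymp
    show ?thesis by (rule tendsto_sandwich[OF _ ev tendsto_const lim]) simp
  qed
  have total: "fail \<longlonglongrightarrow> 0"
  proof -
    have "fail \<longlonglongrightarrow> 4 * 0 + 4 * 0" unfolding fail_def
      by (intro tendsto_add tendsto_mult_left noise
          gram_union_bound_rate[OF exponents p_rate k_rate s_rate[folded s_def] s1 \<delta>])
    then show ?thesis by simp
  qed
  have X_meas: "X T \<in> borel_measurable (M T)" if T: "T \<ge> 1" for T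
  proof -
    have "X T = (\<lambda>\<omega>. \<Sum>i<k T. \<Sum>j<k T * p T. \<bar>\<beta>_hat T i \<omega> $ j - true_param (k T) (p T) (\<Phi> T) i $ j\<bar>)"
      unfolding X_def l1_norm_vec_def by (intro ext sum.cong refl) (auto simp: true_param_def)
    moreover have "\<dots> \<in> borel_measurable (M T)"
      using estimator_measurable[OF T]
      by (intro borel_measurable_sum borel_measurable_abs borel_measurable_diff borel_measurable_const) auto
    ultimately show ?thesis by simp
  qed
  show ?thesis
    unfolding tendsto_in_prob_def X_def[symmetric]
  proof (intro conjI allI impI)
    show "eventually (\<lambda>T. (\<lambda>\<omega>. X T \<omega>) \<in> borel_measurable (M T)) sequentially"
      using eventually_ge_at_top[of 1] by eventually_elim (simp add: X_meas)
    fix e :: real assume e: "e > 0"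
    have "(\<lambda>T. 64 / d\<^sup>2 * (real (k T) * real (s T) * (\<mu> T + l T))) \<longlonglongrightarrow> 64 / d\<^sup>2 * 0"
      by (intro tendsto_mult_left rate)
    then have "eventually (\<lambda>T. 64 / d\<^sup>2 * (real (k T) * real (s T) * (\<mu> T + l T)) < e) sequentially"
      using e by (intro order_tendstoD) auto
    then have ev: "eventually (\<lambda>T. measure (M T) {\<omega>\<in>space (M T). \<bar>X T \<omega> - 0\<bar> > e}
       \<le> fail T) sequentially"
      using \<mu>_small eventually_ge_at_top[of 1]
    proof eventually_elim
      fix T assume small: "64 / d\<^sup>2 * (real (k T) * real (s T) * (\<mu> T + l T)) < e" and \<mu>L: "\<mu> T \<le> L" and T: "1 \<le> T"
      interpret gaussian_var "M T" "k T" "p T" "\<Phi> T" "S T" "\<epsilon> T" "y T" by (rule model[OF T])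
      have [measurable]: "X T \<in> borel_measurable (M T)" by (rule X_meas[OF T])
      have X0: "X T \<omega> \<ge> 0" for \<omega> unfolding X_def l1_norm_vec_def by (intro sum_nonneg) auto
      have "measure (M T) {\<omega>\<in>space (M T). \<bar>X T \<omega> - 0\<bar> > e}
        \<le> measure (M T) {\<omega>\<in>space (M T). err T < X T \<omega>}"
      proof (rule finite_measure_mono)
        have "err T < e" using small by (simp add: err_def mult_ac)
        then show "{\<omega>\<in>space (M T). \<bar>X T \<omega> - 0\<bar> > e}
           \<subseteq> {\<omega>\<in>space (M T). err T < X T \<omega>}"
          using X0 by auto
      qed measurable
      also note bound[OF T \<mu>L]
      finally show "measure (M T) {\<omega>\<in>space (M T). \<bar>X T \<omega> - 0\<bar> > e}
       \<le> fail T" .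
    qed
    show "(\<lambda>T. measure (M T) {\<omega>\<in>space (M T). \<bar>X T \<omega> - 0\<bar> > e}) \<longlonglongrightarrow> 0"
      by (rule tendsto_sandwich[OF _ ev tendsto_const total]) (simp add: measure_nonneg)
  qed
qed

end
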